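(* In the setting of the context, assume $\kappa_m(e^{-f_Kh}\rho|y)<\infty$ for all $m\ge1$ and $y$, and that the total mass of the joint measure $$\Big[\prod_{i=1}^nK(X_i|Y_i)\mu(dY_i)\Big]e^{-\mu(f_K)}\,\mathcal{P}(d\mu|\rho,\eta)$$ of $(\mathbf{Y},\mu)$ is positive and finite. Then the posterior distribution of $(\mathbf{Y},\mu)$ given $\mathbf{X}=(X_1,\dots,X_n)$, i.e. this measure normalized to a probability, is $$\pi(d\mathbf{Y},d\mu|\mathbf{X})\propto\mathcal{P}(d\mu|e^{-f_Kh}\rho,\eta,\mathbf{Y})\Big[\prod_{j=1}^{n(\mathbf{p})}\Pr(dY_j^*|e^{-f_Kh}\rho,\eta,\mathbf{K})\Big]\pi(\mathbf{p}|\mathbf{X}),$$ where $\Pr(dY_j^*|e^{-f_Kh}\rho,\eta,\mathbf{K})$ is the probability measure proportional to $\big[\prod_{i\in C_j}K(X_i|Y_j^* )\big]\kappa_{e_{j,n}}(e^{-f_Kh}\rho|Y_j^* )\,\eta(dY_j^* )$, and $$\pi(\mathbf{p}|\mathbf{X})\propto\prod_{j=1}^{n(\mathbf{p})}\int_{\mathcal{Y}}\Big[\prod_{i\in C_j}K(X_i|Y_j^* )\Big]\kappa_{e_{j,n}}(e^{-f_Kh}\rho|Y_j^* )\,\eta(dY_j^* )$$ is a (posterior) distribution of $\mathbf{p}$ given $\mathbf{X}$.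
   Context: $\mathcal{S},\mathcal{Y}$ are Polish spaces; $\eta$ is a $\sigma$-finite non-atomic measure on $\mathcal{Y}$; $\rho(ds|y)$ is a measurable kernel of ($\sigma$-finite, Lévy-type) measures on $\mathcal{S}$; $h:\mathcal{S}\to(0,\infty)$ is measurable; and $\int_B\int_{\mathcal{S}}\min(h(s),1)\rho(ds|y)\eta(dy)<\infty$ for each bounded $B\subset\mathcal{Y}$. $\mathcal{P}(d\mu|\rho,\eta)$ is the law of $\mu(dy)=\int_{\mathcal{S}}h(s)N(ds,dy)$, $N$ a Poisson random measure on $\mathcal{S}\times\mathcal{Y}$ with intensity $\rho(ds|y)\eta(dy)$. $K(x|y)$ is a non-negative kernel on $\mathcal{X}\times\mathcal{Y}$ ($\mathcal{X}$ Polish), $\tau$ a measure on $\mathcal{X}$, $Y(\cdot)$ a given non-negative function on $\mathcal{X}$, $f_K(v)=\int_{\mathcal{X}}Y(s)K(s|v)\tau(ds)$ (assumed finite), $\mu(f_K)=\int f_Kd\mu$; $X_1,\dots,X_n\in\mathcal{X}$ are the observations. $e^{-f_Kh}\rho$ is the kernel $e^{-f_K(y)h(s)}\rho(ds|y)$ and $\kappa_m(e^{-f_Kh}\rho|y)=\int_{\mathcal{S}}e^{-f_K(y)h(s)}h(s)^m\rho(ds|y)$. $\mathbf{Y}=(Y_1,\dots,Y_n)$ is encoded as $(\mathbf{Y}^*,\mathbf{p})$: $Y_1^*,\dots,Y^*_{n(\mathbf{p})}$ are the distinct values, $\mathbf{p}=\{C_1,\dots,C_{n(\mathbf{p})}\}$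 is the partition of $\{1,\dots,n\}$ with $Y_i=Y_j^*$ iff $i\in C_j$, $e_{j,n}=|C_j|$. For a kernel $\rho'$, $\mathcal{P}(d\mu|\rho',\eta,\mathbf{Y})$ is the law of $\mu+\sum_{j}h(J_{j,n})\delta_{Y_j^*}$, with $\mu\sim\mathcal{P}(d\mu|\rho',\eta)$ independent of the independent variables $J_{j,n}$ with laws $h(s)^{e_{j,n}}\rho'(ds|Y_j^* )/\int h(u)^{e_{j,n}}\rho'(du|Y_j^* )$. *)

theory Defs
  imports "HOL-Probability.Probability"
begin

section \<open>Measures on a space of measures\<close>

text \<open>The \<open>\<sigma>\<close>-algebra generated by the evaluations \<open>L \<mapsto> L(A)\<close>, as in \<open>subprob_algebra\<close> but on
  all measures with the given \<open>\<sigma>\<close>-algebra.\<close>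

definition measure_algebra :: "'a measure \<Rightarrow> 'a measure measure" where
  "measure_algebra M =
     (SUP A\<in>sets M. vimage_algebra {L. sets L = sets M} (\<lambda>L. emeasure L A) borel)"

definition boundedly_finite :: "'y::polish_space measure set" where
  "boundedly_finite =
     {L. sets L = sets borel \<and> (\<forall>B\<in>sets borel. bounded B \<longrightarrow> emeasure L B < \<infinity>)}"

definition boundedly_finite_algebra :: "'y::polish_space measure measure" where
  "boundedly_finite_algebra = restrict_space (measure_algebra borel) boundedly_finite"

section \<open>Kernels\<close>

definition measurable_kernel :: "'y measure \<Rightarrow> 's measure \<Rightarrow> ('y \<Rightarrow> 's measure) \<Rightarrow> bool" where
  "measurable_kernel M L k \<longleftrightarrow>
     (\<forall>y\<in>space M. sets (k y) = sets L) \<and>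
     (\<forall>A\<in>sets L. (\<lambda>y. emeasure (k y) A) \<in> borel_measurable M)"

text \<open>The measure \<open>k(dx|y) M(dy)\<close> on pairs \<open>(x, y)\<close>; \<open>L\<close> only supplies the \<open>\<sigma>\<close>-algebra of the
  first coordinate.\<close>

definition kernel_measure :: "'x measure \<Rightarrow> ('y \<Rightarrow> 'x measure) \<Rightarrow> 'y measure \<Rightarrow> ('x \<times> 'y) measure" where
  "kernel_measure L k M =
     measure_of (space (L \<Otimes>\<^sub>M M)) (sets (L \<Otimes>\<^sub>M M))
       (\<lambda>A. \<integral>\<^sup>+y. emeasure (k y) ((\<lambda>x. (x, y)) -` A) \<partial>M)"

definition nonatomic :: "'a measure \<Rightarrow> bool" where
  "nonatomic M \<longleftrightarrow>
     (\<forall>A\<in>sets M. 0 < emeasure M A \<longrightarrow>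
        (\<exists>B\<in>sets M. B \<subseteq> A \<and> 0 < emeasure M B \<and> emeasure M B < emeasure M A))"

text \<open>Only meaningful when the total mass is positive and finite.\<close>

definition normalize_measure :: "'a measure \<Rightarrow> 'a measure" where
  "normalize_measure M = scale_measure (inverse (emeasure M (space M))) M"

section \<open>Poisson random measures and the law of the random measure they drive\<close>

definition poisson_random_measure :: "'w measure \<Rightarrow> ('w \<Rightarrow> 'a measure) \<Rightarrow> 'a measure \<Rightarrow> bool" where
  "poisson_random_measure \<Omega> N \<nu> \<longleftrightarrow>
     prob_space \<Omega> \<and>
     N \<in> \<Omega> \<rightarrow>\<^sub>M measure_algebra \<nu> \<and>
     (\<forall>A\<in>sets \<nu>. emeasure \<nu> A < \<infinity> \<longrightarrow>
        (\<forall>k::nat. Sigma_Algebra.measure \<Omega> {\<omega>\<in>space \<Omega>. emeasure (N \<omega>) A = of_nat k}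
           = Sigma_Algebra.measure \<nu> A ^ k / fact k * exp (- Sigma_Algebra.measure \<nu> A))) \<and>
     (\<forall>A\<in>sets \<nu>. emeasure \<nu> A = \<infinity> \<longrightarrow> (AE \<omega> in \<Omega>. emeasure (N \<omega>) A = \<infinity>)) \<and>
     (\<forall>A::nat \<Rightarrow> 'a set. range A \<subseteq> sets \<nu> \<and> disjoint_family A \<longrightarrow>
        prob_space.indep_vars \<Omega> (\<lambda>_. borel) (\<lambda>i \<omega>. emeasure (N \<omega>) (A i)) UNIV)"

text \<open>\<open>\<mu>(B) = \<integral> h(s) 1\<^sub>B(y) N(ds, dy)\<close>.\<close>

definition weighted_marginal ::
    "('s \<Rightarrow> real) \<Rightarrow> ('s \<times> 'y::polish_space) measure \<Rightarrow> 'y measure" where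
  "weighted_marginal h N =
     measure_of UNIV (sets borel)
       (\<lambda>B. \<integral>\<^sup>+z. ennreal (h (fst z)) * indicator B (snd z) \<partial>N)"

text \<open>The law of \<open>\<mu>\<close>, written \<open>P(d\<mu>|\<rho>,\<eta>)\<close> when \<open>N\<close> has intensity \<open>\<rho>(ds|y) \<eta>(dy)\<close>. Under the
  integrability condition on \<open>h\<close>, \<open>\<rho>\<close> and \<open>\<eta>\<close>, \<open>\<mu>\<close> is almost surely finite on bounded sets, so
  that the restriction discards a null set only.\<close>

definition random_measure_law ::
    "'w measure \<Rightarrow> ('w \<Rightarrow> ('s \<times> 'y::polish_space) measure) \<Rightarrow> ('s \<Rightarrow> real) \<Rightarrow> 'y measure measure" where
  "random_measure_law \<Omega> N h =
     restrict_space (distr \<Omega> (measure_algebra borel) (\<lambda>\<omega>. weighted_marginal h (N \<omega>)))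
       boundedly_finite"

section \<open>Tilted kernels and cumulants\<close>

definition mixture_fn :: "('x \<Rightarrow> real) \<Rightarrow> ('x \<Rightarrow> 'y \<Rightarrow> real) \<Rightarrow> 'x measure \<Rightarrow> 'y \<Rightarrow> ennreal" where
  "mixture_fn Yf K \<tau> v = (\<integral>\<^sup>+s. ennreal (Yf s * K s v) \<partial>\<tau>)"

definition tilted ::
    "('y \<Rightarrow> ennreal) \<Rightarrow> ('s \<Rightarrow> real) \<Rightarrow> ('y \<Rightarrow> 's measure) \<Rightarrow> 'y \<Rightarrow> 's measure" where
  "tilted f h \<rho> y = density (\<rho> y) (\<lambda>s. ennreal (exp (- (enn2real (f y) * h s))))"

definition kappa :: "('s \<Rightarrow> real) \<Rightarrow> nat \<Rightarrow> ('y \<Rightarrow> 's measure) \<Rightarrow> 'y \<Rightarrow> ennreal" where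
  "kappa h m \<rho> y = (\<integral>\<^sup>+s. ennreal (h s ^ m) \<partial>\<rho> y)"

section \<open>The joint measure of \<open>(Y, \<mu>)\<close>\<close>

definition exp_neg :: "ennreal \<Rightarrow> ennreal" where
  "exp_neg a = (if a = \<infinity> then 0 else ennreal (exp (- enn2real a)))"

definition joint_measure ::
    "nat \<Rightarrow> ('x \<Rightarrow> 'y \<Rightarrow> real) \<Rightarrow> (nat \<Rightarrow> 'x) \<Rightarrow> ('y::polish_space \<Rightarrow> ennreal) \<Rightarrow>
     'y measure measure \<Rightarrow> ((nat \<Rightarrow> 'y) \<times> 'y measure) measure" where
  "joint_measure n K X f P =
     kernel_measure (\<Pi>\<^sub>M i\<in>{1..n}. borel)
       (\<lambda>\<mu>. scale_measure (exp_neg (\<integral>\<^sup>+v. f v \<partial>\<mu>))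
              (density (\<Pi>\<^sub>M i\<in>{1..n}. \<mu>) (\<lambda>y. ennreal (\<Prod>i\<in>{1..n}. K (X i) (y i)))))
       P"

section \<open>Distinct values and partitions\<close>

text \<open>The distinct values of a vector are indexed by the blocks of its partition rather than by an
  enumeration of them.\<close>

definition ties :: "nat \<Rightarrow> (nat \<Rightarrow> 'y) \<Rightarrow> nat set set" where
  "ties n y = (\<lambda>v. {i\<in>{1..n}. y i = v}) ` (y ` {1..n})"

definition common_value :: "(nat \<Rightarrow> 'y) \<Rightarrow> nat set \<Rightarrow> 'y" where
  "common_value y C = the_elem (y ` C)"

definition expand :: "nat \<Rightarrow> nat set set \<Rightarrow> (nat set \<Rightarrow> 'y) \<Rightarrow> nat \<Rightarrow> 'y" where
  "expand n p ys = (\<lambda>i\<in>{1..n}. ys (THE C. C \<in> p \<and> i \<in> C))"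

section \<open>The law \<open>P(d\<mu>|\<rho>',\<eta>,Y)\<close>\<close>

definition jump_law ::
    "('s \<Rightarrow> real) \<Rightarrow> nat \<Rightarrow> ('y \<Rightarrow> 's measure) \<Rightarrow> 'y \<Rightarrow> 's measure" where
  "jump_law h e \<rho> v = normalize_measure (density (\<rho> v) (\<lambda>s. ennreal (h s ^ e)))"

definition add_jumps ::
    "('s \<Rightarrow> real) \<Rightarrow> nat \<Rightarrow> (nat \<Rightarrow> 'y::polish_space) \<Rightarrow> 'y measure \<Rightarrow> (nat set \<Rightarrow> 's) \<Rightarrow> 'y measure" where
  "add_jumps h n y \<mu> J =
     measure_of UNIV (sets borel)
       (\<lambda>B. emeasure \<mu> B + (\<Sum>C\<in>ties n y. ennreal (h (J C)) * indicator B (common_value y C)))"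

text \<open>Here \<open>P\<close> is the law \<open>P(d\<mu>|\<rho>,\<eta>)\<close>.\<close>

definition conditional_law ::
    "('s \<Rightarrow> real) \<Rightarrow> ('y \<Rightarrow> 's measure) \<Rightarrow> 'y::polish_space measure measure \<Rightarrow>
     nat \<Rightarrow> (nat \<Rightarrow> 'y) \<Rightarrow> 'y measure measure" where
  "conditional_law h \<rho> P n y =
     distr (P \<Otimes>\<^sub>M (\<Pi>\<^sub>M C\<in>ties n y. jump_law h (card C) \<rho> (common_value y C)))
       boundedly_finite_algebra (\<lambda>(\<mu>, J). add_jumps h n y \<mu> J)"

section \<open>The laws of the distinct values and of the partition\<close>

definition block_measure ::
    "('x \<Rightarrow> 'y \<Rightarrow> real) \<Rightarrow> (nat \<Rightarrow> 'x) \<Rightarrow> ('s \<Rightarrow> real) \<Rightarrow> ('y \<Rightarrow> 's measure) \<Rightarrow> 'y measure \<Rightarrow>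
     nat set \<Rightarrow> 'y measure" where
  "block_measure K X h \<rho> \<eta> C =
     density \<eta> (\<lambda>v. ennreal (\<Prod>i\<in>C. K (X i) v) * kappa h (card C) \<rho> v)"

definition block_law ::
    "('x \<Rightarrow> 'y \<Rightarrow> real) \<Rightarrow> (nat \<Rightarrow> 'x) \<Rightarrow> ('s \<Rightarrow> real) \<Rightarrow> ('y \<Rightarrow> 's measure) \<Rightarrow> 'y measure \<Rightarrow>
     nat set \<Rightarrow> 'y measure" where
  "block_law K X h \<rho> \<eta> C = normalize_measure (block_measure K X h \<rho> \<eta> C)"

definition partition_weight ::
    "('x \<Rightarrow> 'y \<Rightarrow> real) \<Rightarrow> (nat \<Rightarrow> 'x) \<Rightarrow> ('s \<Rightarrow> real) \<Rightarrow> ('y \<Rightarrow> 's measure) \<Rightarrow> 'y measure \<Rightarrow>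
     nat set set \<Rightarrow> ennreal" where
  "partition_weight K X h \<rho> \<eta> p =
     (\<Prod>C\<in>p. \<integral>\<^sup>+v. ennreal (\<Prod>i\<in>C. K (X i) v) * kappa h (card C) \<rho> v \<partial>\<eta>)"

definition partition_prob ::
    "nat \<Rightarrow> ('x \<Rightarrow> 'y \<Rightarrow> real) \<Rightarrow> (nat \<Rightarrow> 'x) \<Rightarrow> ('s \<Rightarrow> real) \<Rightarrow> ('y \<Rightarrow> 's measure) \<Rightarrow> 'y measure \<Rightarrow>
     nat set set \<Rightarrow> ennreal" where
  "partition_prob n K X h \<rho> \<eta> p =
     partition_weight K X h \<rho> \<eta> p /
     (\<Sum>q | partition_on {1..n} q. partition_weight K X h \<rho> \<eta> q)"

text \<open>The law of \<open>Y\<close> described by the product of the block laws and the law of the partition: draw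
  \<open>p\<close>, then independently one value for each block, and let \<open>Y\<^sub>i\<close> be the value of the block of
  \<open>i\<close>. Partitions of probability \<open>0\<close> do not contribute, whatever their block measures are.\<close>

definition latent_law ::
    "nat \<Rightarrow> ('x \<Rightarrow> 'y \<Rightarrow> real) \<Rightarrow> (nat \<Rightarrow> 'x) \<Rightarrow> ('s \<Rightarrow> real) \<Rightarrow> ('y \<Rightarrow> 's measure) \<Rightarrow>
     'y::polish_space measure \<Rightarrow> (nat \<Rightarrow> 'y) measure" where
  "latent_law n K X h \<rho> \<eta> =
     measure_of (space (\<Pi>\<^sub>M i\<in>{1..n}. borel)) (sets (\<Pi>\<^sub>M i\<in>{1..n}. borel))
       (\<lambda>A. \<Sum>p | partition_on {1..n} p. partition_prob n K X h \<rho> \<eta> p *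
          emeasure (distr (\<Pi>\<^sub>M C\<in>p. block_law K X h \<rho> \<eta> C) (\<Pi>\<^sub>M i\<in>{1..n}. borel) (expand n p)) A)"

text \<open>The law of \<open>(Y, \<mu>)\<close> under which \<open>Y\<close> has law \<open>latent_law\<close> and \<open>\<mu>\<close> has law
  \<open>conditional_law\<close> given \<open>Y\<close>; \<open>kernel_measure\<close> puts the kernel first, hence the swap.\<close>

definition posterior_law ::
    "nat \<Rightarrow> ('x \<Rightarrow> 'y \<Rightarrow> real) \<Rightarrow> (nat \<Rightarrow> 'x) \<Rightarrow> ('s \<Rightarrow> real) \<Rightarrow> ('y \<Rightarrow> 's measure) \<Rightarrow>
     'y::polish_space measure \<Rightarrow> 'y measure measure \<Rightarrow> ((nat \<Rightarrow> 'y) \<times> 'y measure) measure" where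
  "posterior_law n K X h \<rho> \<eta> P =
     distr
       (kernel_measure boundedly_finite_algebra (conditional_law h \<rho> P n)
          (latent_law n K X h \<rho> \<eta>))
       ((\<Pi>\<^sub>M i\<in>{1..n}. borel) \<Otimes>\<^sub>M boundedly_finite_algebra) prod.swap"

end

theory Submission
  imports Defs
begin

text \<open>
  The law of a boundedly finite random measure is determined by its Laplace functional. For the law
  driven by a Poisson random measure, the functional shows that the weight \<open>exp (- \<mu>(f))\<close> only
  multiplies the law by a constant and tilts the kernel \<open>\<rho>\<close> to \<open>\<rho>' = exp (- f h) \<rho>\<close>. Differentiating
  the functional gives the Mecke formula: sampling a point \<open>y\<close> from the tilted \<open>\<mu>\<close> amounts to
  sampling \<open>(s, y)\<close> from the intensity weighted by \<open>h(s)\<close> and adding the atom \<open>h(s) \<delta>\<^sub>y\<close> to \<open>\<mu>\<close>.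
  When this is iterated \<open>n\<close> times, each new point either samples afresh or falls on one of the atoms
  added before, in which case the jump there gets one more factor \<open>h(s)\<close>. The outcomes are indexed by
  the set partitions of \<open>{1..n}\<close>, and a block \<open>C\<close> contributes the intensity
  \<open>h(s)\<^bsup>|C|\<^esup> \<rho>'(ds|y) \<eta>(dy)\<close>. Weighting with the likelihood and splitting every such intensity
  into its mass, the law of \<open>y\<close> and the law of \<open>s\<close> given \<open>y\<close> yields the posterior; since \<open>\<eta>\<close> has
  no atoms, distinct blocks have distinct values almost surely.
\<close>

section \<open>The exponential on the extended non-negative reals\<close>

text \<open>Everything runs in the extended reals with \<open>exp_neg\<close>, whose value at
  infinity is 0. Laplace functionals then exist for every measurable argument, exponents may be
  infinite, and most limits are monotone, so that hardly any integrability conditions arise. The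
  Poisson random measures serve only to obtain a Laplace exponent; from then on \<open>P\<close> and
  \<open>P'\<close> are compared through their exponents and may come from unrelated probability
  spaces. One obstacle is joint measurability, since \<rho>(ds|y) can have infinite mass. Finiteness
  of the first tilted cumulant supplies sets of finite mass that work for whole ranges of y, which
  makes the kernels countable sums of weighted subprobability kernels. Another obstacle is
  degenerate normalization: a partition weight 0 may hide infinite factors, and the cumulants may
  vanish at some y. Such terms are shown to be null instead of being excluded beforehand. Positive
  and finite total mass of the joint measure makes the exponent of f and all partition weights
  finite.\<close>

definition nln :: "ennreal \<Rightarrow> ennreal" where
  "nln c = (if c = 0 then \<infinity> else ennreal (- ln (enn2real c)))"

lemma exp_neg_0 [simp]: "exp_neg 0 = 1"
  by (simp add: exp_neg_def)

lemma exp_neg_top [simp]: "exp_neg \<infinity> = 0" "exp_neg top = 0"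
  by (simp_all add: exp_neg_def)

lemma exp_neg_ennreal: "0 \<le> r \<Longrightarrow> exp_neg (ennreal r) = ennreal (exp (- r))"
  by (simp add: exp_neg_def)

lemma exp_neg_le_1 [simp]: "exp_neg a \<le> 1"
  by (cases a) (auto simp: exp_neg_ennreal ennreal_le_1)

lemma exp_neg_less_top [simp]: "exp_neg a < top" "exp_neg a \<noteq> top"
  using exp_neg_le_1[of a] by (auto simp: less_top[symmetric] top_unique simp del: exp_neg_le_1)

lemma exp_neg_add: "exp_neg (a + b) = exp_neg a * exp_neg b"
  by (cases a; cases b)
     (auto simp: exp_neg_ennreal exp_add[symmetric] ennreal_mult[symmetric] simp flip: ennreal_plus)

lemma exp_neg_measurable [measurable]: "exp_neg \<in> borel_measurable borel"
  unfolding exp_neg_def[abs_def] by measurable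

lemma nln_measurable [measurable]: "nln \<in> borel_measurable borel"
  unfolding nln_def[abs_def] by measurable

lemma nln_exp_neg [simp]: "nln (exp_neg a) = a"
  by (cases a) (auto simp: nln_def exp_neg_ennreal)

lemma exp_neg_nln: "c \<le> 1 \<Longrightarrow> exp_neg (nln c) = c"
proof (cases c)
  case (real r)
  assume "c \<le> 1"
  then have "r \<le> 1" using real by (simp add: ennreal_le_1)
  then show ?thesis using real
    by (cases "r = 0") (auto simp: nln_def exp_neg_ennreal)
qed (simp add: top_unique)

lemma exp_neg_le_iff: "exp_neg a \<le> exp_neg b \<longleftrightarrow> b \<le> a"
  by (cases a; cases b) (auto simp: exp_neg_ennreal top_unique ennreal_le_iff2)

lemma le_exp_neg_iff: "c \<le> 1 \<Longrightarrow> c \<le> exp_neg a \<longleftrightarrow> a \<le> nln c"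
  by (metis exp_neg_le_iff exp_neg_nln)

text \<open>\<open>exp_neg\<close> is an antitone bijection onto \<open>[0, 1]\<close> with inverse
  \<open>nln\<close>, so it turns suprema into infima. The empty family is separate: its supremum is
  0, with image 1, whereas its infimum is \<infinity>.\<close>

lemma exp_neg_SUP:
  "exp_neg (SUP k\<in>I. f k) = (if I = {} then 1 else (INF k\<in>I. exp_neg (f k)))"
proof (cases "I = {}")
  case False
  have "(INF k\<in>I. exp_neg (f k)) \<le> 1"
    using False by (meson INF_lower2 ex_in_conv exp_neg_le_1)
  moreover have "f k \<le> nln (INF k\<in>I. exp_neg (f k))" if "k \<in> I" for k
    using that \<open>(INF k\<in>I. exp_neg (f k)) \<le> 1\<close> by (subst le_exp_neg_iff[symmetric]) (auto intro: INF_lower)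
  ultimately have "(INF k\<in>I. exp_neg (f k)) \<le> exp_neg (SUP k\<in>I. f k)"
    by (subst le_exp_neg_iff) (auto intro: SUP_least)
  moreover have "exp_neg (SUP k\<in>I. f k) \<le> (INF k\<in>I. exp_neg (f k))"
    by (intro INF_greatest) (auto simp: exp_neg_le_iff intro: SUP_upper)
  ultimately show ?thesis using False by auto
qed (simp add: bot_ennreal)

lemma exp_neg_sum: "exp_neg (\<Sum>i\<in>I. f i) = (\<Prod>i\<in>I. exp_neg (f i))"
  by (induction I rule: infinite_finite_induct) (auto simp: exp_neg_add)

text \<open>For p = exp (-a) and q = exp (-b) this is 1 - p q = (1 - p) + p (1 - q); truncated
  subtraction is harmless because p and q are at most 1. The identity makes the Laplace exponent
  split under tilting, and it also compares a slope with the one at half the step.\<close>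

lemma one_minus_exp_neg_add:
  "1 - exp_neg (a + b) = (1 - exp_neg a) + exp_neg a * (1 - exp_neg b)"
  by (cases a; cases b)
     (auto simp: exp_neg_ennreal ennreal_minus ennreal_mult[symmetric] ennreal_1[symmetric] right_diff_distrib
        simp flip: ennreal_plus exp_add simp del: ennreal_1)

lemma one_minus_exp_neg_mono: "a \<le> b \<Longrightarrow> 1 - exp_neg a \<le> 1 - exp_neg b"
  by (intro ennreal_minus_mono) (auto simp: exp_neg_le_iff)

lemma one_minus_exp_neg_le: "1 - exp_neg a \<le> a"
proof (cases a)
  case (real r)
  have "1 - exp (- r) \<le> r" using exp_ge_add_one_self[of "-r"] by simp
  then show ?thesis using real
    by (auto simp: exp_neg_ennreal ennreal_minus ennreal_1[symmetric] simp del: ennreal_1 intro: ennreal_leI)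
qed simp

text \<open>The difference quotient at 0 of t -> 1 - exp (-t x) for the step
  \<open>1 / 2 ^ k\<close>. Concavity makes it increase to x as the step is halved, so that
  differentiation under an integral becomes monotone convergence.\<close>

definition dyadic_slope :: "nat \<Rightarrow> ennreal \<Rightarrow> ennreal" where
  "dyadic_slope k x = 2 ^ k * (1 - exp_neg (x / 2 ^ k))"

lemma dyadic_slope_measurable [measurable]: "dyadic_slope k \<in> borel_measurable borel"
  unfolding dyadic_slope_def[abs_def] by measurable

lemma dyadic_slope_mono: "x \<le> y \<Longrightarrow> dyadic_slope k x \<le> dyadic_slope k y"
  unfolding dyadic_slope_def
  by (intro mult_left_mono one_minus_exp_neg_mono) (auto intro!: divide_right_mono_ennreal)

text \<open>With u the argument at the smaller step, the argument at the larger step is u + u, and 1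
  - exp (-2u) = (1 - exp (-u)) + exp (-u) (1 - exp (-u)) is at most 2 (1 - exp (-u)).\<close>

lemma dyadic_slope_le_Suc: "dyadic_slope k x \<le> dyadic_slope (Suc k) x"
proof -
  define u where "u = x / 2 ^ Suc k"
  have "x / 2 ^ k = u + u"
  proof -
    have "u + u = 2 * u" by (simp add: mult_2)
    also have "\<dots> = x / 2 ^ k"
    proof -
      have "2 * inverse (2 ^ Suc k) = (inverse (2 ^ k) :: ennreal)"
      proof -
        have "(2::ennreal) * inverse (2 ^ Suc k) = ennreal 2 * inverse (ennreal (2 ^ Suc k))"
          by (simp add: ennreal_power[symmetric] del: power_Suc)
        also have "\<dots> = ennreal (2 * inverse (2 ^ Suc k))"
          by (subst inverse_ennreal) (auto simp: ennreal_mult simp del: power_Suc)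
        also have "\<dots> = inverse (ennreal (2 ^ k))"
          by (subst inverse_ennreal) (auto simp: field_simps)
        finally show ?thesis by (simp add: ennreal_power[symmetric])
      qed
      then show ?thesis
        by (simp add: u_def divide_ennreal_def mult.left_commute)
    qed
    finally show ?thesis by simp
  qed
  then have "dyadic_slope k x = 2 ^ k * ((1 - exp_neg u) + exp_neg u * (1 - exp_neg u))"
    by (simp add: dyadic_slope_def one_minus_exp_neg_add)
  also have "\<dots> \<le> 2 ^ k * ((1 - exp_neg u) + 1 * (1 - exp_neg u))"
    by (intro mult_left_mono add_left_mono mult_right_mono) auto
  also have "\<dots> = dyadic_slope (Suc k) x"
    by (simp add: dyadic_slope_def u_def mult_2[symmetric] mult.assoc mult.left_commute)
  finally show ?thesis .
qed

lemma incseq_dyadic_slope: "incseq (\<lambda>k. dyadic_slope k x)"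
  by (intro incseq_SucI dyadic_slope_le_Suc)

lemma dyadic_slope_SUP: "(SUP k. dyadic_slope k x) = x"
proof (cases x)
  case (real r)
  have *: "dyadic_slope k x = ennreal (2 ^ k * (1 - exp (- (r / 2 ^ k))))" for k
    using real by (auto simp: dyadic_slope_def exp_neg_ennreal divide_ennreal ennreal_minus ennreal_mult
       ennreal_1[symmetric] ennreal_numeral[symmetric] ennreal_power simp del: ennreal_1 ennreal_numeral)
  have "(\<lambda>k::nat. 2 ^ k * (1 - exp (- (r / 2 ^ k)))) \<longlonglongrightarrow> r"
    by real_asymp
  then have "(\<lambda>k. dyadic_slope k x) \<longlonglongrightarrow> x"
    unfolding * using real by (auto intro: tendsto_ennrealI)
  then show ?thesis
    using LIMSEQ_SUP[OF incseq_dyadic_slope[of x]] LIMSEQ_unique by blast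
next
  case top
  \<comment> \<open>At x = \<infinity> the quotient is exactly 2^k, which exceeds k.\<close>
  have "of_nat k \<le> dyadic_slope k x" for k
  proof -
    have "of_nat k \<le> (of_nat (2 ^ k) :: ennreal)"
      by (intro of_nat_mono) (simp add: less_imp_le)
    then show ?thesis by (simp add: dyadic_slope_def top ennreal_top_divide power_eq_top_ennreal)
  qed
  then have "(SUP k. of_nat k) \<le> (SUP k. dyadic_slope k x)"
    by (intro SUP_mono) auto
  then show ?thesis
    by (simp add: ennreal_SUP_of_nat_eq_top top top_unique)
qed


section \<open>Measures given by positive functionals\<close>

text \<open>A Daniell-type recipe: an additive, homogeneous and monotonically continuous functional
  is integration against the measure that it defines on indicators. Several measures here are given
  by a set function through \<open>measure_of\<close>; recognising the functional behind it proves
  countable additivity and yields the formula for integrals at once. Kernel measures, measures with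
  added atoms and the law of the latent vector are treated in this way.\<close>

locale positive_functional =
  fixes M :: "'a measure" and \<Phi> :: "('a \<Rightarrow> ennreal) \<Rightarrow> ennreal"
  assumes cong: "(\<And>x. x \<in> space M \<Longrightarrow> f x = g x) \<Longrightarrow> \<Phi> f = \<Phi> g"
    and add: "f \<in> borel_measurable M \<Longrightarrow> g \<in> borel_measurable M \<Longrightarrow> \<Phi> (\<lambda>x. f x + g x) = \<Phi> f + \<Phi> g"
    and cmult: "f \<in> borel_measurable M \<Longrightarrow> \<Phi> (\<lambda>x. c * f x) = c * \<Phi> f"
    and SUP: "(\<And>i. F i \<in> borel_measurable M) \<Longrightarrow> incseq F \<Longrightarrow>
       \<Phi> (\<lambda>x. SUP i. F i x) = (SUP i::nat. \<Phi> (F i))"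
begin

definition functional_measure :: "'a measure" where
  "functional_measure = measure_of (space M) (sets M) (\<lambda>A. \<Phi> (indicator A))"

lemma zero: "\<Phi> (\<lambda>x. 0) = 0"
  using cmult[of "\<lambda>x. 0" 0] by simp

lemma sum_lessThan: "(\<And>i. F i \<in> borel_measurable M) \<Longrightarrow> \<Phi> (\<lambda>x. \<Sum>i<(n::nat). F i x) = (\<Sum>i<n. \<Phi> (F i))"
  by (induction n) (simp_all add: zero add)

lemma sets_functional_measure [simp]: "sets functional_measure = sets M"
  by (simp add: functional_measure_def sets.sets_measure_of_eq)

lemma space_functional_measure [simp]: "space functional_measure = space M"
  by (rule sets_eq_imp_space_eq) simp

lemma emeasure_functional_measure:
  assumes "A \<in> sets M"
  shows "emeasure functional_measure A = \<Phi> (indicator A)"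
  unfolding functional_measure_def
proof (rule emeasure_measure_of_sigma)
  show "sigma_algebra (space M) (sets M)" by (rule sets.sigma_algebra_axioms)
  show "positive (sets M) (\<lambda>A. \<Phi> (indicator A))"
    using zero by (simp add: positive_def indicator_def[abs_def])
  show "countably_additive (sets M) (\<lambda>A. \<Phi> (indicator A))"
  proof (rule countably_additiveI)
    fix A :: "nat \<Rightarrow> 'a set"
    assume A: "range A \<subseteq> sets M" "disjoint_family A"
    have [measurable]: "A i \<in> sets M" for i using A by auto
    \<comment> \<open>Countable additivity is \<open>SUP\<close> applied to the partial sums of the
      indicators, which increase to the indicator of the union.\<close>
    have "\<Phi> (indicator (\<Union>i. A i)) = \<Phi> (\<lambda>x. SUP n. \<Sum>i<n. indicator (A i) x)"
      by (intro cong) (simp add: suminf_indicator[OF A(2), symmetric] suminf_eq_SUP)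
    also have "\<dots> = (SUP n. \<Phi> (\<lambda>x. \<Sum>i<n. indicator (A i) x))"
      by (intro SUP) (auto simp: incseq_def le_fun_def intro!: sum_mono2)
    also have "\<dots> = (\<Sum>i. \<Phi> (indicator (A i)))"
      by (simp add: sum_lessThan suminf_eq_SUP)
    finally show "(\<Sum>i. \<Phi> (indicator (A i))) = \<Phi> (indicator (\<Union>i. A i))" ..
  qed
  show "A \<in> sets M" by fact
qed

lemma nn_integral_functional_measure:
  assumes "f \<in> borel_measurable M"
  shows "(\<integral>\<^sup>+x. f x \<partial>functional_measure) = \<Phi> f"
  using assms
proof (induction rule: borel_measurable_induct)
  case (cong f g)
  then show ?case
    using positive_functional.cong[OF positive_functional_axioms, of f g]
    by (simp cong: nn_integral_cong_simp)
next
  case (set A)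
  then show ?case by (simp add: emeasure_functional_measure)
next
  case (mult u c)
  then show ?case by (subst nn_integral_cmult) (simp_all add: cmult cong: measurable_cong_sets)
next
  case (add u v)
  then show ?case
    by (subst nn_integral_add)
       (simp_all add: positive_functional.add[OF positive_functional_axioms] cong: measurable_cong_sets)
next
  case (seq U)
  then have "(\<integral>\<^sup>+x. (SUP i. U i x) \<partial>functional_measure) = \<Phi> (\<lambda>x. SUP i. U i x)"
    by (subst nn_integral_monotone_convergence_SUP) (auto simp: SUP cong: measurable_cong_sets)
  then show ?case by (simp add: SUP_apply[abs_def] image_comp)
qed

end

section \<open>Kernels of \<open>s\<close>-finite measures\<close>

text \<open>The decomposition is stated through integrals, with measurable coefficients and
  subprobability kernels: joint measurability of an integral in its parameter holds for
  subprobability kernels and survives multiplication by the coefficients and countable sums.\<close>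

definition s_finite_kernel :: "'a measure \<Rightarrow> 'b measure \<Rightarrow> ('a \<Rightarrow> 'b measure) \<Rightarrow> bool" where
  "s_finite_kernel M L k \<longleftrightarrow>
     (\<forall>x\<in>space M. sets (k x) = sets L) \<and>
     (\<exists>c \<kappa>. (\<forall>i::nat. c i \<in> borel_measurable M \<and> \<kappa> i \<in> M \<rightarrow>\<^sub>M subprob_algebra L) \<and>
       (\<forall>x\<in>space M. \<forall>g\<in>borel_measurable L.
          (\<integral>\<^sup>+y. g y \<partial>k x) = (\<Sum>i. c i x * (\<integral>\<^sup>+y. g y \<partial>\<kappa> i x))))"

lemma s_finite_kernel_sets: "s_finite_kernel M L k \<Longrightarrow> x \<in> space M \<Longrightarrow> sets (k x) = sets L"
  by (simp add: s_finite_kernel_def)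

lemma s_finite_kernelE:
  assumes "s_finite_kernel M L k"
  obtains c \<kappa> where "\<And>i::nat. c i \<in> borel_measurable M" "\<And>i. \<kappa> i \<in> M \<rightarrow>\<^sub>M subprob_algebra L"
    "\<And>x g. x \<in> space M \<Longrightarrow> g \<in> borel_measurable L \<Longrightarrow>
          (\<integral>\<^sup>+y. g y \<partial>k x) = (\<Sum>i. c i x * (\<integral>\<^sup>+y. g y \<partial>\<kappa> i x))"
  using assms unfolding s_finite_kernel_def
  by (elim conjE exE) (rule that, auto)

lemma s_finite_kernel_nn_integral:
  assumes k: "s_finite_kernel M L k" and X [measurable]: "X \<in> N \<rightarrow>\<^sub>M M"
    and [measurable]: "(\<lambda>(z, y). G z y) \<in> borel_measurable (N \<Otimes>\<^sub>M L)"
  shows "(\<lambda>z. \<integral>\<^sup>+y. G z y \<partial>k (X z)) \<in> borel_measurable N"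
proof -
  from k obtain c \<kappa> where
    [measurable]: "\<And>i::nat. c i \<in> borel_measurable M" "\<And>i. \<kappa> i \<in> M \<rightarrow>\<^sub>M subprob_algebra L"
    and eq: "\<And>x g. x \<in> space M \<Longrightarrow> g \<in> borel_measurable L \<Longrightarrow>
          (\<integral>\<^sup>+y. g y \<partial>k x) = (\<Sum>i. c i x * (\<integral>\<^sup>+y. g y \<partial>\<kappa> i x))"
    by (rule s_finite_kernelE) blast
  have "(\<lambda>z. \<integral>\<^sup>+y. G z y \<partial>\<kappa> i (X z)) \<in> borel_measurable N" for i
    by (rule nn_integral_measurable_subprob_algebra2[where N = L]) measurable
  then have "(\<lambda>z. \<Sum>i. c i (X z) * (\<integral>\<^sup>+y. G z y \<partial>\<kappa> i (X z))) \<in> borel_measurable N"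
    by measurable
  moreover have "(\<integral>\<^sup>+y. G z y \<partial>k (X z)) = (\<Sum>i. c i (X z) * (\<integral>\<^sup>+y. G z y \<partial>\<kappa> i (X z)))"
    if "z \<in> space N" for z
    using that measurable_space[OF X that] by (intro eq) auto
  ultimately show ?thesis by (simp cong: measurable_cong)
qed

lemma s_finite_kernel_compose:
  assumes "s_finite_kernel M L k" "X \<in> N \<rightarrow>\<^sub>M M"
  shows "s_finite_kernel N L (\<lambda>z. k (X z))"
proof -
  from assms(1) obtain c \<kappa> where k:
    "\<And>i::nat. c i \<in> borel_measurable M" "\<And>i. \<kappa> i \<in> M \<rightarrow>\<^sub>M subprob_algebra L"
    "\<And>x g. x \<in> space M \<Longrightarrow> g \<in> borel_measurable L \<Longrightarrow>
          (\<integral>\<^sup>+y. g y \<partial>k x) = (\<Sum>i. c i x * (\<integral>\<^sup>+y. g y \<partial>\<kappa> i x))"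
    by (rule s_finite_kernelE) blast
  show ?thesis unfolding s_finite_kernel_def
    using k s_finite_kernel_sets[OF assms(1)] measurable_space[OF assms(2)]
      measurable_compose[OF assms(2) k(1)] measurable_compose[OF assms(2) k(2)]
    by (intro conjI exI[of _ "\<lambda>i z. c i (X z)"] exI[of _ "\<lambda>i z. \<kappa> i (X z)"]) auto
qed

text \<open>The parameter space is cut into countably many pieces \<open>E q\<close>, and the
  exhausting sets \<open>C q i\<close> of finite mass may change from piece to piece. After making
  both families disjoint, the kernel restricted to one set and divided by a bound for its mass is a
  subprobability kernel, and the divisor returns as the coefficient.\<close>

lemma s_finite_kernelI:
  fixes C :: "nat \<Rightarrow> nat \<Rightarrow> 'b set"
  assumes s: "\<And>x. x \<in> space M \<Longrightarrow> sets (k x) = sets L"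
    and m: "\<And>A. A \<in> sets L \<Longrightarrow> (\<lambda>x. emeasure (k x) A) \<in> borel_measurable M"
    and E [measurable]: "\<And>q. E q \<in> sets M" and E_cover: "space M \<subseteq> (\<Union>q. E q)"
    and C [measurable]: "\<And>q i. C q i \<in> sets L" and C_cover: "\<And>q. space L \<subseteq> (\<Union>i. C q i)"
    and fin: "\<And>q i x. x \<in> E q \<Longrightarrow> emeasure (k x) (C q i) < \<infinity>"
    and ne: "space L \<noteq> {}"
  shows "s_finite_kernel M L k"
proof -
  define E' where "E' = disjointed E"
  define D where "D q = disjointed (C q)" for q
  have E' [measurable]: "E' q \<in> sets M" for q
    using sets.range_disjointed_sets[of E M] E unfolding E'_def by blast
  have D [measurable]: "D q i \<in> sets L" for q i
    using sets.range_disjointed_sets[of "C q" L] C unfolding D_def by blast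
  have DC: "D q i \<subseteq> C q i" for q i by (simp add: D_def disjointed_subset)
  have E'E: "E' q \<subseteq> E q" for q by (simp add: E'_def disjointed_subset)
  \<comment> \<open>The summand 1 keeps the divisor positive where the mass is 0; on
    \<open>E q\<close> the divisor is also finite, so that the coefficient cancels it.\<close>
  define d where "d q i x = 1 + emeasure (k x) (C q i)" for q i x
  have [measurable]: "d q i \<in> borel_measurable M" for q i
    unfolding d_def using m[OF C] by measurable
  define \<kappa>' where "\<kappa>' q i x = density (k x) (\<lambda>y. indicator (E' q) x * indicator (D q i) y / d q i x)" for q i x
  have em: "emeasure (\<kappa>' q i x) A = indicator (E' q) x * emeasure (k x) (A \<inter> D q i) / d q i x"
    if "x \<in> space M" "A \<in> sets L" for x A q i
  proof -
    have [measurable_cong, simp]: "sets (k x) = sets L" using s that by simp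
    have [measurable]: "A \<in> sets L" by fact
    have "emeasure (\<kappa>' q i x) A = (\<integral>\<^sup>+y. (indicator (E' q) x / d q i x) * indicator (A \<inter> D q i) y \<partial>k x)"
      unfolding \<kappa>'_def
      by (subst emeasure_density) (auto simp: divide_ennreal_def mult_ac split: split_indicator intro!: nn_integral_cong)
    also have "\<dots> = (indicator (E' q) x / d q i x) * emeasure (k x) (A \<inter> D q i)"
      by (subst nn_integral_cmult_indicator) auto
    finally show ?thesis by (simp add: divide_ennreal_def mult_ac)
  qed
  have \<kappa>': "\<kappa>' q i \<in> M \<rightarrow>\<^sub>M subprob_algebra L" for q i
  proof (rule measurable_subprob_algebra)
    fix x assume x: "x \<in> space M"
    show sets: "sets (\<kappa>' q i x) = sets L" using s[OF x] by (simp add: \<kappa>'_def)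
    have sp: "space (\<kappa>' q i x) = space L" using sets by (rule sets_eq_imp_space_eq)
    show "subprob_space (\<kappa>' q i x)"
    proof
      have "emeasure (\<kappa>' q i x) (space L) \<le> emeasure (k x) (C q i) / d q i x"
        using DC[of q i] s[OF x] C[of q i]
        by (subst em[OF x]) (auto split: split_indicator intro!: divide_right_mono_ennreal emeasure_mono)
      also have "\<dots> \<le> 1"
        unfolding d_def
        by (cases "emeasure (k x) (C q i)")
          (auto simp: divide_ennreal ennreal_1[symmetric] simp del: ennreal_1 simp flip: ennreal_plus)
      finally show "emeasure (\<kappa>' q i x) (space (\<kappa>' q i x)) \<le> 1" by (simp add: sp)
      show "space (\<kappa>' q i x) \<noteq> {}" using ne sp by simp
    qed
  next
    fix A assume A: "A \<in> sets L"
    then have [measurable]: "(\<lambda>x. emeasure (k x) (A \<inter> D q i)) \<in> borel_measurable M"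
      by (intro m) auto
    have "(\<lambda>x. indicator (E' q) x * emeasure (k x) (A \<inter> D q i) / d q i x) \<in> borel_measurable M"
      by measurable
    then show "(\<lambda>x. emeasure (\<kappa>' q i x) A) \<in> borel_measurable M"
      using em[OF _ A] by (simp cong: measurable_cong)
  qed
  define c where "c q i x = (indicator (E' q) x * d q i x)" for q i x
  have eq: "(\<integral>\<^sup>+y. g y \<partial>k x) = (\<Sum>j. case prod_decode j of (q, i) \<Rightarrow> c q i x * (\<integral>\<^sup>+y. g y \<partial>\<kappa>' q i x))"
    if x: "x \<in> space M" and g [measurable]: "g \<in> borel_measurable L" for x g
  proof -
    have [measurable_cong, simp]: "sets (k x) = sets L" using s x by simp
    have sp: "space (k x) = space L" by (rule sets_eq_imp_space_eq) simp
    have E1: "(\<Sum>q. indicator (E' q) x) = (1 :: ennreal)"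
      using x E_cover
      by (subst suminf_indicator) (auto simp: E'_def disjoint_family_disjointed UN_disjointed_eq indicator_def)
    have D1: "(\<Sum>i. indicator (D q i) y) = (1 :: ennreal)" if "y \<in> space L" for q y
      using that C_cover[of q]
      by (subst suminf_indicator) (auto simp: D_def disjoint_family_disjointed UN_disjointed_eq indicator_def)
    have c: "c q i x * (\<integral>\<^sup>+y. g y \<partial>\<kappa>' q i x) = indicator (E' q) x * (\<integral>\<^sup>+y. indicator (D q i) y * g y \<partial>k x)" for q i
    proof (cases "x \<in> E' q")
      case True
      then have d: "d q i x < \<infinity>" "d q i x \<noteq> 0"
        using fin[of x q i] E'E[of q] by (auto simp: d_def)
      have "(\<integral>\<^sup>+y. g y \<partial>\<kappa>' q i x) = (\<integral>\<^sup>+y. inverse (d q i x) * (indicator (D q i) y * g y) \<partial>k x)"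
        using True unfolding \<kappa>'_def
        by (subst nn_integral_density) (auto simp: divide_ennreal_def mult_ac)
      also have "\<dots> = inverse (d q i x) * (\<integral>\<^sup>+y. indicator (D q i) y * g y \<partial>k x)"
        by (rule nn_integral_cmult) measurable
      finally have "c q i x * (\<integral>\<^sup>+y. g y \<partial>\<kappa>' q i x)
          = (d q i x * inverse (d q i x)) * (\<integral>\<^sup>+y. indicator (D q i) y * g y \<partial>k x)"
        using True by (simp add: c_def mult.assoc)
      also have "d q i x * inverse (d q i x) = 1"
        using d ennreal_divide_self[of "d q i x"] by (simp add: divide_ennreal_def)
      finally show ?thesis using True by simp
    qed (simp add: c_def)
    have "(\<integral>\<^sup>+y. g y \<partial>k x) = (\<Sum>q. indicator (E' q) x * (\<integral>\<^sup>+y. g y \<partial>k x))"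
      by (simp add: ennreal_suminf_multc E1)
    also have "\<dots> = (\<Sum>q. \<Sum>i. indicator (E' q) x * (\<integral>\<^sup>+y. indicator (D q i) y * g y \<partial>k x))"
    proof (intro suminf_cong)
      fix q
      have "(\<integral>\<^sup>+y. g y \<partial>k x) = (\<integral>\<^sup>+y. (\<Sum>i. indicator (D q i) y * g y) \<partial>k x)"
        by (intro nn_integral_cong) (simp add: ennreal_suminf_multc D1 sp)
      also have "\<dots> = (\<Sum>i. \<integral>\<^sup>+y. indicator (D q i) y * g y \<partial>k x)"
        by (rule nn_integral_suminf) measurable
      finally show "indicator (E' q) x * (\<integral>\<^sup>+y. g y \<partial>k x) =
          (\<Sum>i. indicator (E' q) x * (\<integral>\<^sup>+y. indicator (D q i) y * g y \<partial>k x))"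
        by simp
    qed
    also have "\<dots> = (\<Sum>q. \<Sum>i. c q i x * (\<integral>\<^sup>+y. g y \<partial>\<kappa>' q i x))"
      by (simp only: c)
    also have "\<dots> = (\<Sum>j. (\<lambda>(q, i). c q i x * (\<integral>\<^sup>+y. g y \<partial>\<kappa>' q i x)) (prod_decode j))"
      by (rule suminf_ennreal_2dimen[symmetric]) simp
    finally show ?thesis by (simp add: case_prod_beta)
  qed
  show ?thesis
    unfolding s_finite_kernel_def
  proof (intro conjI ballI exI allI)
    show "sets (k x) = sets L" if "x \<in> space M" for x using s that .
    show "(\<lambda>x. c (fst (prod_decode j)) (snd (prod_decode j)) x) \<in> borel_measurable M" for j
      unfolding c_def by measurable
    show "\<kappa>' (fst (prod_decode j)) (snd (prod_decode j)) \<in> M \<rightarrow>\<^sub>M subprob_algebra L" for j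
      by (rule \<kappa>')
  qed (use eq in \<open>simp add: case_prod_beta\<close>)
qed

lemma subprob_kernel_s_finite:
  assumes [measurable]: "k \<in> M \<rightarrow>\<^sub>M subprob_algebra L"
  shows "s_finite_kernel M L k"
  unfolding s_finite_kernel_def
proof (intro conjI ballI exI allI)
  show "sets (k x) = sets L" if "x \<in> space M" for x
    using measurable_space[OF assms that] by (simp add: space_subprob_algebra)
  show "(\<lambda>i::nat. \<lambda>x. of_bool (i = 0)) i \<in> borel_measurable M" for i by simp
  show "(\<lambda>i. k) i \<in> M \<rightarrow>\<^sub>M subprob_algebra L" for i :: nat by simp
  show "(\<integral>\<^sup>+y. g y \<partial>k x) = (\<Sum>i::nat. of_bool (i = 0) * (\<integral>\<^sup>+y. g y \<partial>k x))" for x g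
    by (subst suminf_finite[of "{0}"]) auto
qed


section \<open>Integration against kernel measures and products of kernels\<close>

abbreviation kernel_functional ::
    "('y \<Rightarrow> 'x measure) \<Rightarrow> 'y measure \<Rightarrow> ('x \<times> 'y \<Rightarrow> ennreal) \<Rightarrow> ennreal" where
  "kernel_functional k M \<phi> \<equiv> \<integral>\<^sup>+y. \<integral>\<^sup>+x. \<phi> (x, y) \<partial>k y \<partial>M"

text \<open>Measurability of the inner integral is a hypothesis here, rather than
  \<open>s_finite_kernel\<close>, because two kernels obtain it in other ways:
  \<open>conditional_law\<close> from a case distinction on the ties, and the kernel inside
  \<open>joint_measure\<close> from a finite product.\<close>

lemma kernel_measure_functional:
  assumes s: "\<And>y. y \<in> space M \<Longrightarrow> sets (k y) = sets L"
    and m: "\<And>G. (\<lambda>(y, x). G y x) \<in> borel_measurable (M \<Otimes>\<^sub>M L) \<Longrightarrow>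
       (\<lambda>y. \<integral>\<^sup>+x. G y x \<partial>k y) \<in> borel_measurable M"
  shows "positive_functional (L \<Otimes>\<^sub>M M) (kernel_functional k M)"
    and "kernel_measure L k M = positive_functional.functional_measure (L \<Otimes>\<^sub>M M) (kernel_functional k M)"
proof -
  let ?\<Phi> = "kernel_functional k M"
  have [measurable]: "(\<lambda>y. \<integral>\<^sup>+x. f (x, y) \<partial>k y) \<in> borel_measurable M"
    if [measurable]: "f \<in> borel_measurable (L \<Otimes>\<^sub>M M)" for f
    by (rule m) measurable
  have [measurable]: "(\<lambda>x. f (x, y)) \<in> borel_measurable (k y)"
    if [measurable]: "f \<in> borel_measurable (L \<Otimes>\<^sub>M M)" and y [measurable]: "y \<in> space M" for f y
    unfolding measurable_cong_sets[OF s[OF y] refl] by measurable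
  note sp = sets_eq_imp_space_eq[OF s]
  show pf: "positive_functional (L \<Otimes>\<^sub>M M) ?\<Phi>"
  proof
    show "?\<Phi> f = ?\<Phi> g" if "\<And>x. x \<in> space (L \<Otimes>\<^sub>M M) \<Longrightarrow> f x = g x" for f g
      using that by (intro nn_integral_cong) (auto simp: space_pair_measure sp)
    show "?\<Phi> (\<lambda>x. f x + g x) = ?\<Phi> f + ?\<Phi> g"
      if [measurable]: "f \<in> borel_measurable (L \<Otimes>\<^sub>M M)" "g \<in> borel_measurable (L \<Otimes>\<^sub>M M)" for f g
    proof -
      have "?\<Phi> (\<lambda>x. f x + g x) = (\<integral>\<^sup>+y. (\<integral>\<^sup>+x. f (x, y) \<partial>k y) + (\<integral>\<^sup>+x. g (x, y) \<partial>k y) \<partial>M)"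
        by (intro nn_integral_cong nn_integral_add) auto
      also have "\<dots> = ?\<Phi> f + ?\<Phi> g" by (intro nn_integral_add) auto
      finally show ?thesis .
    qed
    show "?\<Phi> (\<lambda>x. c * f x) = c * ?\<Phi> f"
      if [measurable]: "f \<in> borel_measurable (L \<Otimes>\<^sub>M M)" for f c
    proof -
      have "?\<Phi> (\<lambda>x. c * f x) = (\<integral>\<^sup>+y. c * (\<integral>\<^sup>+x. f (x, y) \<partial>k y) \<partial>M)"
        by (intro nn_integral_cong nn_integral_cmult) auto
      also have "\<dots> = c * ?\<Phi> f" by (intro nn_integral_cmult) auto
      finally show ?thesis .
    qed
    fix F :: "nat \<Rightarrow> _ \<Rightarrow> ennreal" assume F [measurable]: "\<And>i. F i \<in> borel_measurable (L \<Otimes>\<^sub>M M)" and inc: "incseq F"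
    have "?\<Phi> (\<lambda>x. SUP i. F i x) = (\<integral>\<^sup>+y. (SUP i. \<integral>\<^sup>+x. F i (x, y) \<partial>k y) \<partial>M)"
      using inc
      by (intro nn_integral_cong nn_integral_monotone_convergence_SUP) (auto simp: incseq_def le_fun_def)
    also have "\<dots> = (SUP i. ?\<Phi> (F i))"
      using inc
      by (intro nn_integral_monotone_convergence_SUP)
         (auto simp: incseq_def le_fun_def intro!: nn_integral_mono)
    finally show "?\<Phi> (\<lambda>x. SUP i. F i x) = (SUP i. ?\<Phi> (F i))" .
  qed
  interpret positive_functional "L \<Otimes>\<^sub>M M" ?\<Phi> by (rule pf)
  show "kernel_measure L k M = functional_measure"
    unfolding kernel_measure_def functional_measure_def
  proof (rule measure_of_eq)
    fix A assume "A \<in> sigma_sets (space (L \<Otimes>\<^sub>M M)) (sets (L \<Otimes>\<^sub>M M))"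
    then have A [measurable]: "A \<in> sets (L \<Otimes>\<^sub>M M)" by (simp add: sets.sigma_sets_eq)
    show "(\<integral>\<^sup>+y. emeasure (k y) ((\<lambda>x. (x, y)) -` A) \<partial>M) = ?\<Phi> (indicator A)"
    proof (intro nn_integral_cong)
      fix y assume y: "y \<in> space M"
      have "(\<lambda>x. (x, y)) -` A = (\<lambda>x. (x, y)) -` A \<inter> space L"
        using sets.sets_into_space[OF A] by (auto simp: space_pair_measure)
      also have "\<dots> \<in> sets L"
        using y by (intro measurable_sets[where A="L \<Otimes>\<^sub>M M"]) auto
      finally have "(\<lambda>x. (x, y)) -` A \<in> sets (k y)" using s[OF y] by simp
      then have "emeasure (k y) ((\<lambda>x. (x, y)) -` A) = (\<integral>\<^sup>+x. indicator ((\<lambda>x. (x, y)) -` A) x \<partial>k y)"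
        by simp
      also have "\<dots> = (\<integral>\<^sup>+x. indicator A (x, y) \<partial>k y)"
        by (intro nn_integral_cong) (simp add: indicator_def)
      finally show "emeasure (k y) ((\<lambda>x. (x, y)) -` A) = (\<integral>\<^sup>+x. indicator A (x, y) \<partial>k y)" .
    qed
  qed (rule sets.space_closed)
qed

lemma sets_kernel_measure [simp]: "sets (kernel_measure L k M) = sets (L \<Otimes>\<^sub>M M)"
  by (simp add: kernel_measure_def sets.sets_measure_of_eq)

lemma nn_integral_kernel_measure:
  assumes "\<And>y. y \<in> space M \<Longrightarrow> sets (k y) = sets L"
    and "\<And>G. (\<lambda>(y, x). G y x) \<in> borel_measurable (M \<Otimes>\<^sub>M L) \<Longrightarrow>
       (\<lambda>y. \<integral>\<^sup>+x. G y x \<partial>k y) \<in> borel_measurable M"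
    and "f \<in> borel_measurable (L \<Otimes>\<^sub>M M)"
  shows "(\<integral>\<^sup>+z. f z \<partial>kernel_measure L k M) = (\<integral>\<^sup>+y. \<integral>\<^sup>+x. f (x, y) \<partial>k y \<partial>M)"
  using kernel_measure_functional[OF assms(1,2)]
    positive_functional.nn_integral_functional_measure[OF kernel_measure_functional(1)[OF assms(1,2)] assms(3)]
  by simp

lemma nn_integral_kernel_measure_s_finite:
  assumes "s_finite_kernel M L k" "f \<in> borel_measurable (L \<Otimes>\<^sub>M M)"
  shows "(\<integral>\<^sup>+z. f z \<partial>kernel_measure L k M) = (\<integral>\<^sup>+y. \<integral>\<^sup>+x. f (x, y) \<partial>k y \<partial>M)"
  using assms s_finite_kernel_nn_integral[OF assms(1) measurable_ident_sets[OF refl]]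
  by (intro nn_integral_kernel_measure) (auto simp: s_finite_kernel_sets)

text \<open>Induction on the index set: integrating the new coordinate first leaves an integrand
  that is jointly measurable in the parameter and the remaining coordinates, by the case of one
  kernel.\<close>

lemma nn_integral_PiM_kernel:
  fixes k :: "'i \<Rightarrow> 'x \<Rightarrow> 'b measure"
  assumes "finite I"
    and "\<And>i. i \<in> I \<Longrightarrow> s_finite_kernel M L (k i)"
    and "\<And>i x. x \<in> space M \<Longrightarrow> i \<in> I \<Longrightarrow> sigma_finite_measure (k i x)"
    and "(\<lambda>(x, s). G x s) \<in> borel_measurable (M \<Otimes>\<^sub>M (\<Pi>\<^sub>M i\<in>I. L))"
  shows "(\<lambda>x. \<integral>\<^sup>+s. G x s \<partial>(\<Pi>\<^sub>M i\<in>I. k i x)) \<in> borel_measurable M"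
  using assms
proof (induction I arbitrary: G rule: finite_induct)
  case empty
  have "(\<lambda>x. G x (\<lambda>_. undefined)) \<in> borel_measurable M"
    using measurable_compose[OF _ empty.prems(3), of "\<lambda>x. (x, \<lambda>_. undefined)" M]
    by (auto simp: space_PiM)
  then show ?case by (simp add: PiM_empty nn_integral_count_space_finite)
next
  case (insert i I)
  note [measurable] = insert.prems(3)
  \<comment> \<open>Outside the index set the kernel is replaced by the null measure, since
    \<open>product_sigma_finite\<close> asks for a \<sigma>-finite measure at every index.\<close>
  define k' where "k' j x = (if j \<in> insert i I then k j x else null_measure L)" for j x
  have eq: "(\<integral>\<^sup>+s. G x s \<partial>(\<Pi>\<^sub>M i\<in>insert i I. k i x)) = (\<integral>\<^sup>+s. (\<integral>\<^sup>+y. G x (s(i := y)) \<partial>k i x) \<partial>(\<Pi>\<^sub>M i\<in>I. k i x))"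
    if x: "x \<in> space M" for x
  proof -
    have "sigma_finite_measure (null_measure L)"
      by (intro finite_measure.axioms(1) finite_measureI) simp
    then interpret product_sigma_finite "\<lambda>j. k' j x"
      using insert.prems(2)[OF x] by (intro product_sigma_finite.intro) (simp add: k'_def)
    have sets: "sets (PiM (insert i I) (\<lambda>j. k' j x)) = sets (PiM (insert i I) (\<lambda>_. L))"
      using s_finite_kernel_sets[OF insert.prems(1) x] by (intro sets_PiM_cong) (simp_all add: k'_def)
    have "PiM J (\<lambda>j. k' j x) = PiM J (\<lambda>j. k j x)" if "J \<subseteq> insert i I" for J
      using that by (intro PiM_cong) (auto simp: k'_def)
    moreover have "(\<lambda>s. G x s) \<in> borel_measurable (PiM (insert i I) (\<lambda>j. k' j x))"
      unfolding measurable_cong_sets[OF sets refl] using x by measurable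
    ultimately show ?thesis
      using product_nn_integral_insert[OF insert.hyps(1,2), of "G x"]
      by (simp add: subset_insertI k'_def)
  qed
  have "(\<lambda>(x, s). \<integral>\<^sup>+y. G x (s(i := y)) \<partial>k i x) \<in> borel_measurable (M \<Otimes>\<^sub>M (\<Pi>\<^sub>M i\<in>I. L))"
    unfolding case_prod_beta
  proof (rule s_finite_kernel_nn_integral[where X=fst])
    show "s_finite_kernel M L (k i)" using insert.prems(1) by simp
    show "(\<lambda>(z, y). G (fst z) ((snd z)(i := y))) \<in> borel_measurable ((M \<Otimes>\<^sub>M (\<Pi>\<^sub>M i\<in>I. L)) \<Otimes>\<^sub>M L)"
      by measurable
  qed simp
  from insert.IH[OF _ _ this]
  have "(\<lambda>x. \<integral>\<^sup>+s. (\<integral>\<^sup>+y. G x (s(i := y)) \<partial>k i x) \<partial>(\<Pi>\<^sub>M i\<in>I. k i x)) \<in> borel_measurable M"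
    using insert.prems(1,2) by blast
  then show ?case using eq by (simp cong: measurable_cong)
qed


section \<open>The space of boundedly finite measures\<close>

lemma space_measure_algebra: "space (measure_algebra M) = {L. sets L = sets M}"
  by (auto simp: measure_algebra_def space_Sup_eq_UN)

lemma measurable_emeasure_measure_algebra [measurable]:
  "A \<in> sets M \<Longrightarrow> (\<lambda>L. emeasure L A) \<in> borel_measurable (measure_algebra M)"
  by (auto intro!: measurable_Sup1 measurable_vimage_algebra1 simp: measure_algebra_def)

lemma measurable_measure_algebraI:
  assumes "\<And>x. x \<in> space N \<Longrightarrow> sets (k x) = sets M"
    and "\<And>A. A \<in> sets M \<Longrightarrow> (\<lambda>x. emeasure (k x) A) \<in> borel_measurable N"
  shows "k \<in> N \<rightarrow>\<^sub>M measure_algebra M"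
  using assms by (auto intro!: measurable_Sup2 measurable_vimage_algebra2 simp: measure_algebra_def)

lemma nn_integral_measurable_measure_algebra [measurable]:
  assumes f: "f \<in> borel_measurable N"
  shows "(\<lambda>M. \<integral>\<^sup>+x. f x \<partial>M) \<in> borel_measurable (measure_algebra N)" (is "_ \<in> ?B")
  using f
proof (induction rule: borel_measurable_induct)
  case (cong f g)
  moreover have "(\<lambda>M. \<integral>\<^sup>+x. f x \<partial>M) \<in> ?B \<longleftrightarrow> (\<lambda>M. \<integral>\<^sup>+x. g x \<partial>M) \<in> ?B"
    by (intro measurable_cong nn_integral_cong cong)
       (auto simp: space_measure_algebra dest!: sets_eq_imp_space_eq)
  ultimately show ?case by simp
next
  case (set B)
  then have "(\<lambda>M. \<integral>\<^sup>+x. indicator B x \<partial>M) \<in> ?B \<longleftrightarrow> (\<lambda>M. emeasure M B) \<in> ?B"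
    by (intro measurable_cong nn_integral_indicator) (simp add: space_measure_algebra)
  with set show ?case by (simp add: measurable_emeasure_measure_algebra)
next
  case (mult f c)
  then have "(\<lambda>M. \<integral>\<^sup>+x. c * f x \<partial>M) \<in> ?B \<longleftrightarrow> (\<lambda>M. c * (\<integral>\<^sup>+x. f x \<partial>M)) \<in> ?B"
    by (intro measurable_cong nn_integral_cmult) (auto simp: space_measure_algebra)
  with mult show ?case by simp
next
  case (add f g)
  then have "(\<lambda>M. \<integral>\<^sup>+x. f x + g x \<partial>M) \<in> ?B \<longleftrightarrow> (\<lambda>M. (\<integral>\<^sup>+x. f x \<partial>M) + (\<integral>\<^sup>+x. g x \<partial>M)) \<in> ?B"
    by (intro measurable_cong nn_integral_add) (auto simp: space_measure_algebra)
  with add show ?case by (simp add: ac_simps)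
next
  case (seq F)
  then have "(\<lambda>M. \<integral>\<^sup>+x. (SUP i. F i) x \<partial>M) \<in> ?B \<longleftrightarrow> (\<lambda>M. SUP i. \<integral>\<^sup>+x. F i x \<partial>M) \<in> ?B"
    unfolding SUP_apply
    by (intro measurable_cong nn_integral_monotone_convergence_SUP) (auto simp: space_measure_algebra)
  with seq show ?case by (simp add: ac_simps)
qed

lemma UN_ball_nat: "(\<Union>i::nat. ball x (real i)) = UNIV"
  by (auto intro: reals_Archimedean2)

text \<open>Every bounded set lies in a ball of natural radius about one fixed centre, for which
  \<open>undefined\<close> serves as an arbitrary point. This leaves countably many conditions, so
  that \<open>boundedly_finite\<close> is a measurable set and finiteness can be checked almost
  surely one ball at a time.\<close>

lemma boundedly_finite_iff:
  "(L :: 'y::polish_space measure) \<in> boundedly_finite \<longleftrightarrow>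
     sets L = sets borel \<and> (\<forall>i::nat. emeasure L (ball undefined (real i)) < \<infinity>)"
proof -
  have *: "emeasure L B < \<infinity>" if "sets L = sets borel" "\<forall>i::nat. emeasure L (ball undefined (real i)) < \<infinity>"
    "B \<in> sets borel" "bounded B" for B
  proof -
    obtain e where "B \<subseteq> ball undefined e" using bounded_subset_ballD[OF \<open>bounded B\<close>, of undefined] by auto
    moreover obtain i :: nat where "e < real i" using reals_Archimedean2 by blast
    ultimately have "B \<subseteq> ball undefined (real i)" by (meson less_imp_le order_trans subset_ball)
    then have "emeasure L B \<le> emeasure L (ball undefined (real i))"
      using that by (intro emeasure_mono) auto
    then show ?thesis using that(2) by (auto intro: le_less_trans)
  qed
  have "emeasure L (ball undefined (real i)) < \<infinity>" if "L \<in> boundedly_finite" for i :: nat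
    using that by (simp add: boundedly_finite_def)
  then show ?thesis using * unfolding boundedly_finite_def mem_Collect_eq by blast
qed

lemma boundedly_finite_sets: "L \<in> boundedly_finite \<Longrightarrow> sets L = sets borel"
  by (simp add: boundedly_finite_def)

lemma boundedly_finite_space: "L \<in> boundedly_finite \<Longrightarrow> space L = UNIV"
  using sets_eq_imp_space_eq[OF boundedly_finite_sets, of L] by simp

lemma boundedly_finite_measurable: "boundedly_finite \<in> sets (measure_algebra borel)"
proof -
  have "(\<lambda>L. emeasure L (ball undefined (real i))) -` {..<\<infinity>} \<inter> space (measure_algebra borel)
      \<in> sets (measure_algebra (borel :: 'a measure))" for i
    by (rule measurable_sets[OF measurable_emeasure_measure_algebra]) auto
  then have "{L\<in>space (measure_algebra borel). emeasure L (ball undefined (real i)) < \<infinity>}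
      \<in> sets (measure_algebra (borel :: 'a measure))" for i
    by (simp add: vimage_def Int_def conj_commute)
  then have "{L\<in>space (measure_algebra (borel :: 'a measure)).
      \<forall>i::nat. emeasure L (ball undefined (real i)) < \<infinity>} \<in> sets (measure_algebra borel)"
    by (rule sets.sets_Collect_countable_All)
  also have "{L\<in>space (measure_algebra (borel :: 'a measure)).
      \<forall>i::nat. emeasure L (ball undefined (real i)) < \<infinity>} = boundedly_finite"
    unfolding set_eq_iff boundedly_finite_iff space_measure_algebra by simp
  finally show ?thesis .
qed

lemma space_boundedly_finite_algebra [simp]: "space boundedly_finite_algebra = boundedly_finite"
  by (auto simp: boundedly_finite_algebra_def space_restrict_space space_measure_algebra
      dest: boundedly_finite_sets)

lemma measurable_boundedly_finite_algebraI:
  assumes "\<And>x. x \<in> space N \<Longrightarrow> k x \<in> boundedly_finite"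
    and "\<And>A. A \<in> sets borel \<Longrightarrow> (\<lambda>x. emeasure (k x) A) \<in> borel_measurable N"
  shows "k \<in> N \<rightarrow>\<^sub>M boundedly_finite_algebra"
  unfolding boundedly_finite_algebra_def
  using assms by (intro measurable_restrict_space2 measurable_measure_algebraI boundedly_finite_sets) auto

lemma emeasure_measurable_bfa [measurable]:
  "A \<in> sets borel \<Longrightarrow> (\<lambda>\<mu>. emeasure \<mu> A) \<in> borel_measurable boundedly_finite_algebra"
  unfolding boundedly_finite_algebra_def 
  by (intro measurable_restrict_space1 measurable_emeasure_measure_algebra)

text \<open>Here the measure is its own kernel. The same sequence of balls has finite mass under
  every boundedly finite measure, so a single piece of the parameter space suffices. This gives
  joint measurability of integrals against \<mu> in \<mu> and further parameters.\<close>

lemma s_finite_kernel_bfa: "s_finite_kernel boundedly_finite_algebra borel (\<lambda>\<mu>. \<mu>)"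
  apply (rule s_finite_kernelI[where E="\<lambda>_. boundedly_finite" and C="\<lambda>_ i. ball undefined (real i)"])
  subgoal by (simp add: boundedly_finite_sets)
  subgoal by (rule emeasure_measurable_bfa)
  subgoal using sets.top[of "boundedly_finite_algebra"] by simp
  subgoal by simp
  subgoal by simp
  subgoal by (simp add: UN_ball_nat)
  subgoal by (simp add: boundedly_finite_iff)
  subgoal by simp
  done

lemma nn_integral_measurable_bfa [measurable]:
  assumes "g \<in> borel_measurable borel"
  shows "(\<lambda>\<mu>. \<integral>\<^sup>+y. g y \<partial>\<mu>) \<in> borel_measurable boundedly_finite_algebra"
  unfolding boundedly_finite_algebra_def
  by (intro measurable_restrict_space1 nn_integral_measurable_measure_algebra assms)

lemma sigma_finite_boundedly_finite: 
  assumes "\<mu> \<in> boundedly_finite" shows "sigma_finite_measure \<mu>"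
proof
  show "\<exists>A. countable A \<and> A \<subseteq> sets \<mu> \<and> \<Union> A = space \<mu> \<and> (\<forall>a\<in>A. emeasure \<mu> a \<noteq> \<infinity>)"
    using assms
    by (intro exI[of _ "range (\<lambda>i::nat. ball undefined (real i))"] conjI)
       (auto simp: boundedly_finite_space boundedly_finite_sets UN_ball_nat simp flip: less_top
         dest: boundedly_finite_iff[THEN iffD1])
qed

section \<open>Laplace transforms determine laws of random measures\<close>

text \<open>Uniqueness in the Hausdorff moment problem: Weierstrass approximation on [0, 1] extends
  equality of moments to bounded continuous functions, and continuous ramps decreasing to the
  indicator of a half-line then give equal distribution functions.\<close>

lemma finite_borel_measure_eq_moments:
  assumes M: "finite_borel_measure M1" "finite_borel_measure M2"
    and ae: "AE x in M1. x \<in> {0..1}" "AE x in M2. x \<in> {0..1}"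
    and mom: "\<And>k. (\<integral>x. x ^ k \<partial>M1) = (\<integral>x. x ^ k \<partial>M2)"
  shows "M1 = M2"
proof (rule cdf_unique'[OF M])
  interpret M1: finite_borel_measure M1 by fact
  interpret M2: finite_borel_measure M2 by fact
  note [measurable_cong] = M1.M_is_borel M2.M_is_borel
  have int: "integrable M (\<lambda>x. x ^ k)"
    if M: "finite_borel_measure M" "AE x in M. x \<in> {0..1}" for M and k :: nat
  proof -
    interpret finite_borel_measure M by fact
    note [measurable_cong] = M_is_borel
    show ?thesis
    proof (rule integrable_const_bound[where B=1])
      show "AE x in M. norm (x ^ k) \<le> 1"
        using M(2) by eventually_elim (auto intro!: power_le_one)
    qed measurable
  qed
  \<comment> \<open>Total mass of both measures: replacing f by a polynomial within e changes the
    two integrals by at most e m together.\<close>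
  define m where "m = measure M1 UNIV + measure M2 UNIV"
  have m: "m \<ge> 0" by (simp add: m_def)
  have cts: "(\<integral>x. f x \<partial>M1) = (\<integral>x. f x \<partial>M2)"
    if f: "continuous_on UNIV f" "\<And>x. \<bar>f x\<bar> \<le> 1" for f :: "real \<Rightarrow> real"
  proof -
    have [measurable]: "f \<in> borel_measurable borel" using f(1) by (rule borel_measurable_continuous_onI)
    have le: "\<bar>(\<integral>x. f x \<partial>M1) - (\<integral>x. f x \<partial>M2)\<bar> \<le> e * m" if e: "e > 0" for e
    proof -
      obtain g where g: "real_polynomial_function g" "\<And>x. x \<in> {0..1} \<Longrightarrow> \<bar>f x - g x\<bar> < e"
        using Stone_Weierstrass_real_polynomial_function[of "{0..1}" f e] e continuous_on_subset[OF f(1)] by auto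
      obtain a n where ga: "g = (\<lambda>x. \<Sum>i\<le>n. a i * x ^ i)"
        using g(1) by (auto simp: real_polynomial_function_iff_sum)
      have *: "integrable M g \<and> (\<integral>x. g x \<partial>M) = (\<Sum>i\<le>n. a i * (\<integral>x. x ^ i \<partial>M)) \<and>
         \<bar>(\<integral>x. f x \<partial>M) - (\<integral>x. g x \<partial>M)\<bar> \<le> e * measure M UNIV"
        if M: "finite_borel_measure M" "AE x in M. x \<in> {0..1}" for M
      proof -
        interpret finite_borel_measure M by fact
        note [measurable_cong] = M_is_borel
        have gi: "integrable M g" unfolding ga by (intro Bochner_Integration.integrable_sum integrable_mult_right int M)
        have fi: "integrable M f" using f(2) by (intro integrable_const_bound[where B=1]) auto
        have "\<bar>(\<integral>x. f x \<partial>M) - (\<integral>x. g x \<partial>M)\<bar> = \<bar>\<integral>x. f x - g x \<partial>M\<bar>"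
          using fi gi by simp
        also have "\<dots> \<le> (\<integral>x. \<bar>f x - g x\<bar> \<partial>M)" by (rule integral_abs_bound)
        also have "\<dots> \<le> (\<integral>x. e \<partial>M)"
        proof (rule integral_mono_AE)
          show "AE x in M. \<bar>f x - g x\<bar> \<le> e" using M(2) by eventually_elim (use g(2) in force)
        qed (use fi gi in auto)
        also have "\<dots> = e * measure M UNIV" using sets_eq_imp_space_eq[OF M_is_borel] by simp
        finally have "\<bar>(\<integral>x. f x \<partial>M) - (\<integral>x. g x \<partial>M)\<bar> \<le> e * measure M UNIV" .
        moreover have "(\<integral>x. g x \<partial>M) = (\<Sum>i\<le>n. a i * (\<integral>x. x ^ i \<partial>M))"
          unfolding ga by (subst Bochner_Integration.integral_sum) (auto intro: int M)
        ultimately show ?thesis using gi by simp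
      qed
      show ?thesis using *[OF M(1) ae(1)] *[OF M(2) ae(2)] mom
        by (simp add: m_def distrib_left) linarith
    qed
    show ?thesis
    proof (rule ccontr)
      assume "\<not> ?thesis"
      then have d: "\<bar>(\<integral>x. f x \<partial>M1) - (\<integral>x. f x \<partial>M2)\<bar> > 0" by simp
      \<comment> \<open>The denominator m + 1 makes e m strictly smaller than the supposed gap, also
        for m = 0.\<close>
      define e where "e = \<bar>(\<integral>x. f x \<partial>M1) - (\<integral>x. f x \<partial>M2)\<bar> / (m + 1)"
      have "e > 0" using d m by (simp add: e_def)
      moreover have "e * m < \<bar>(\<integral>x. f x \<partial>M1) - (\<integral>x. f x \<partial>M2)\<bar>"
        using d m by (simp add: e_def field_simps)
      ultimately show False using le[of e] by simp
    qed
  qed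
  have step01: "0 \<le> cts_step a b x \<and> cts_step a b x \<le> 1" if "a < b" for a b x
    using that by (auto simp: cts_step_def divide_simps)
  show "cdf M1 = cdf M2"
  proof
    fix a :: real
    \<comment> \<open>The ramp equals 1 up to a and vanishes from a + 1 / (n + 1) on, so it
      converges to the indicator of the closed half-line.\<close>
    have lim: "(\<lambda>n. \<integral>x. cts_step a (a + 1 / Suc n) x \<partial>M) \<longlonglongrightarrow> cdf M a"
      if M: "finite_borel_measure M" for M
    proof -
      interpret finite_borel_measure M by fact
      note [measurable_cong] = M_is_borel
      have "(\<lambda>n. \<integral>x. cts_step a (a + 1 / Suc n) x \<partial>M) \<longlonglongrightarrow> (\<integral>x. indicator {..a} x \<partial>M)"
      proof (rule integral_dominated_convergence[where w="\<lambda>_. 1"])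
        show "AE x in M. (\<lambda>n. cts_step a (a + 1 / Suc n) x) \<longlonglongrightarrow> indicator {..a} x"
        proof (intro AE_I2)
          fix x
          show "(\<lambda>n. cts_step a (a + 1 / Suc n) x) \<longlonglongrightarrow> indicator {..a} x"
          proof (cases "x \<le> a")
            case False
            have "(\<lambda>n. 1 / real (Suc n)) \<longlonglongrightarrow> 0" by real_asymp
            then have "eventually (\<lambda>n. 1 / real (Suc n) < x - a) sequentially"
              using False by (intro order_tendstoD) auto
            then have "eventually (\<lambda>n. cts_step a (a + 1 / Suc n) x = indicator {..a} x) sequentially"
              by eventually_elim (use False in \<open>auto simp: cts_step_def\<close>)
            then show ?thesis by (rule tendsto_eventually)
          qed (simp add: cts_step_def)
        qed
        show "AE x in M. norm (cts_step a (a + 1 / Suc n) x) \<le> 1" for n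
          using step01[of a "a + 1 / Suc n"] by auto
      qed (auto simp: cts_step_def[abs_def])
      then show ?thesis by (simp add: cdf_def)
    qed
    have "(\<integral>x. cts_step a (a + 1 / Suc n) x \<partial>M1) = (\<integral>x. cts_step a (a + 1 / Suc n) x \<partial>M2)" for n
    proof (rule cts)
      show "continuous_on UNIV (cts_step a (a + 1 / Suc n))"
        by (rule uniformly_continuous_imp_continuous[OF cts_step_uniformly_continuous]) simp
    qed (use step01[of a "a + 1 / Suc n"] in auto)
    then show "cdf M1 a = cdf M2 a"
      using lim[OF M(1)] lim[OF M(2)] by (simp add: LIMSEQ_unique)
  qed
qed

text \<open>The map x -> exp (-x) identifies [0, \<infinity>] with [0, 1] and turns the transform at
  a natural number k into the k-th moment. A mass at \<infinity> is carried to 0; k = 0 agrees there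
  as well, since \<open>0 * \<infinity> = 0\<close> and \<open>0 ^ 0 = 1\<close>.\<close>

lemma finite_measure_eq_laplace:
  fixes M1 M2 :: "ennreal measure"
  assumes fin: "finite_measure M1" "finite_measure M2"
    and sets: "sets M1 = sets borel" "sets M2 = sets borel"
    and eq: "\<And>k::nat. (\<integral>\<^sup>+x. exp_neg (of_nat k * x) \<partial>M1) = (\<integral>\<^sup>+x. exp_neg (of_nat k * x) \<partial>M2)"
  shows "M1 = M2"
proof -
  define T where "T x = enn2real (exp_neg x)" for x
  have [measurable]: "T \<in> borel_measurable borel" unfolding T_def by measurable
  have eT: "ennreal (T x) = exp_neg x" for x by (simp add: T_def)
  have T01: "T x \<in> {0..1}" for x
    using enn2real_mono[of "exp_neg x" 1] by (auto simp: T_def)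
  have pull: "M = distr (distr M borel T) borel (\<lambda>r. nln (ennreal r))"
    if s: "sets M = sets borel" for M
  proof -
    note [measurable_cong] = s
    have "distr (distr M borel T) borel (\<lambda>r. nln (ennreal r)) = distr M borel (\<lambda>x. x)"
      by (subst distr_distr) (auto simp: comp_def eT intro!: distr_cong)
    then show ?thesis using s by (simp add: distr_id2)
  qed
  have mom: "(\<integral>x. x ^ k \<partial>distr M borel T) = enn2real (\<integral>\<^sup>+x. exp_neg (of_nat k * x) \<partial>M)"
    if s: "sets M = sets borel" for M and k :: nat
  proof -
    note [measurable_cong] = s
    have pw: "exp_neg (of_nat k * x) = ennreal (T x ^ k)" for x
      by (induction k) (use T01 in \<open>auto simp: exp_neg_add distrib_right ennreal_mult eT\<close>)
    show ?thesis
      using T01 by (subst integral_distr) (auto simp: pw intro!: integral_eq_nn_integral)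
  qed
  have fb: "finite_borel_measure (distr M borel T)" if "finite_measure M" "sets M = sets borel" for M
  proof -
    interpret finite_measure M by fact
    note [measurable_cong] = that(2)
    show ?thesis by (intro finite_borel_measure.intro finite_measure_distr finite_borel_measure_axioms.intro) auto
  qed
  have "distr M1 borel T = distr M2 borel T"
  proof (rule finite_borel_measure_eq_moments)
    note [measurable_cong] = sets
    show "AE x in distr M1 borel T. x \<in> {0..1}" "AE x in distr M2 borel T. x \<in> {0..1}"
      using T01 by (auto simp: AE_distr_iff)
  qed (auto intro!: fb fin sets simp: mom sets eq)
  then show ?thesis using pull[OF sets(1)] pull[OF sets(2)] by simp
qed


text \<open>Joint laws of finitely many evaluations are handled one set at a time. The statement
  \<open>cyl\<close> mixes indicators of some evaluations with the exponential of an arbitrary g,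
  and it is this free g that lets the one-dimensional uniqueness result exchange one more
  exponential for an indicator. Cylinder events in the space of all evaluations then determine the
  law.\<close>

lemma boundedly_finite_measure_eq_laplace:
  fixes Q1 Q2 :: "'y::polish_space measure measure"
  assumes fin: "finite_measure Q1" "finite_measure Q2"
    and sets: "sets Q1 = sets boundedly_finite_algebra" "sets Q2 = sets boundedly_finite_algebra"
    and eq: "\<And>g. g \<in> borel_measurable borel \<Longrightarrow>
      (\<integral>\<^sup>+\<mu>. exp_neg (\<integral>\<^sup>+y. g y \<partial>\<mu>) \<partial>Q1) = (\<integral>\<^sup>+\<mu>. exp_neg (\<integral>\<^sup>+y. g y \<partial>\<mu>) \<partial>Q2)"
  shows "Q1 = Q2"
proof -
  let ?B = "boundedly_finite_algebra :: 'y measure measure"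
  define ev where "ev A \<mu> = emeasure \<mu> A" for A and \<mu> :: "'y measure"
  define li where "li g \<mu> = exp_neg (\<integral>\<^sup>+y. g y \<partial>\<mu>)" for g and \<mu> :: "'y measure"
  have ev [measurable]: "ev A \<in> borel_measurable ?B" if "A \<in> sets borel" for A
    unfolding ev_def[abs_def] using that by (rule emeasure_measurable_bfa)
  have li [measurable]: "li g \<in> borel_measurable ?B" if "g \<in> borel_measurable borel" for g
    unfolding li_def[abs_def]
    by (rule measurable_compose[OF nn_integral_measurable_bfa[OF that] exp_neg_measurable])
  have sp: "space Q1 = boundedly_finite" "space Q2 = boundedly_finite"
    using sets_eq_imp_space_eq[OF sets(1)] sets_eq_imp_space_eq[OF sets(2)] by simp_all
  have cyl: "(\<integral>\<^sup>+\<mu>. (\<Prod>A\<in>J. indicator (S A) (ev A \<mu>)) * li g \<mu> \<partial>Q1)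
      = (\<integral>\<^sup>+\<mu>. (\<Prod>A\<in>J. indicator (S A) (ev A \<mu>)) * li g \<mu> \<partial>Q2)"
    if "finite J" "J \<subseteq> sets borel" "\<And>A. A \<in> J \<Longrightarrow> S A \<in> sets borel" "g \<in> borel_measurable borel" for J S g
    using that
  proof (induction J arbitrary: g rule: finite_induct)
    case empty
    then show ?case using eq[of g] by (simp add: li_def)
  next
    case (insert A J)
    have A: "A \<in> sets borel" and SA: "S A \<in> sets borel" using insert.prems by auto
    note [measurable] = insert.prems(3) A SA
    have SJ: "S B \<in> sets borel" "B \<in> sets borel" if "B \<in> J" for B using insert.prems that by auto
    define w where "w \<mu> = (\<Prod>B\<in>J. indicator (S B) (ev B \<mu>)) * li g \<mu>" for \<mu>
    have [measurable]: "w \<in> borel_measurable ?B"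
      unfolding w_def using SJ by measurable
    have w1: "w \<mu> \<le> 1" for \<mu>
    proof -
      have "(\<Prod>B\<in>J. indicator (S B) (ev B \<mu>)) \<le> (1 :: ennreal)"
        by (rule prod_le_1) (auto split: split_indicator)
      then show ?thesis unfolding w_def li_def using mult_mono[OF _ exp_neg_le_1] by fastforce
    qed
    \<comment> \<open>The law of the evaluation at A under the weight collected so far. It is a
      finite measure on [0, \<infinity>] because the weight is at most 1.\<close>
    define R where "R Q = distr (density Q w) borel (ev A)" for Q
    have R: "finite_measure (R Q)" "sets (R Q) = sets borel"
      "h \<in> borel_measurable borel \<Longrightarrow> (\<integral>\<^sup>+x. h x \<partial>R Q) = (\<integral>\<^sup>+\<mu>. w \<mu> * h (ev A \<mu>) \<partial>Q)"
      if Q: "finite_measure Q" "sets Q = sets ?B" for Q h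
    proof -
      interpret finite_measure Q by fact
      note [measurable_cong] = Q(2)
      have "emeasure (density Q w) (space (density Q w)) = (\<integral>\<^sup>+\<mu>. w \<mu> \<partial>Q)"
        by (subst emeasure_density) (auto intro!: nn_integral_cong split: split_indicator)
      also have "\<dots> \<le> (\<integral>\<^sup>+\<mu>. 1 \<partial>Q)" using w1 by (intro nn_integral_mono)
      also have "\<dots> < \<infinity>" by (simp add: less_top[symmetric])
      finally have "finite_measure (density Q w)" by (intro finite_measureI) simp
      then show "finite_measure (R Q)"
        unfolding R_def by (rule finite_measure.finite_measure_distr) measurable
      show "sets (R Q) = sets borel" by (simp add: R_def)
      show "(\<integral>\<^sup>+x. h x \<partial>R Q) = (\<integral>\<^sup>+\<mu>. w \<mu> * h (ev A \<mu>) \<partial>Q)" if [measurable]: "h \<in> borel_measurable borel"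
        unfolding R_def by (subst nn_integral_distr) (auto simp: nn_integral_density)
    qed
    \<comment> \<open>A multiple of the evaluation at A is absorbed into g as
      \<open>g y + of_nat k * indicator A y\<close>, which is the form covered by the induction
      hypothesis.\<close>
    have lap: "(\<integral>\<^sup>+x. exp_neg (of_nat k * x) \<partial>R Q)
        = (\<integral>\<^sup>+\<mu>. (\<Prod>A\<in>J. indicator (S A) (ev A \<mu>)) * li (\<lambda>y. g y + of_nat k * indicator A y) \<mu> \<partial>Q)"
      if Q: "finite_measure Q" "sets Q = sets ?B" for Q and k :: nat
    proof -
      have "(\<lambda>x. exp_neg (of_nat k * x)) \<in> borel_measurable borel" by measurable
      from R(3)[OF Q this]
      have "(\<integral>\<^sup>+x. exp_neg (of_nat k * x) \<partial>R Q) = (\<integral>\<^sup>+\<mu>. w \<mu> * exp_neg (of_nat k * ev A \<mu>) \<partial>Q)" .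
      also have "\<dots> = (\<integral>\<^sup>+\<mu>. (\<Prod>A\<in>J. indicator (S A) (ev A \<mu>)) * li (\<lambda>y. g y + of_nat k * indicator A y) \<mu> \<partial>Q)"
    proof (intro nn_integral_cong)
      fix \<mu> assume "\<mu> \<in> space Q"
      then have "\<mu> \<in> boundedly_finite" using sets_eq_imp_space_eq[OF Q(2)] by simp
      then have s: "sets \<mu> = sets borel" by (rule boundedly_finite_sets)
      note [measurable_cong] = s
      have "(\<integral>\<^sup>+y. g y + of_nat k * indicator A y \<partial>\<mu>) = (\<integral>\<^sup>+y. g y \<partial>\<mu>) + of_nat k * emeasure \<mu> A"
        using A s by (subst nn_integral_add) (auto simp: nn_integral_cmult_indicator)
      then show "w \<mu> * exp_neg (of_nat k * ev A \<mu>) =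
          (\<Prod>A\<in>J. indicator (S A) (ev A \<mu>)) * li (\<lambda>y. g y + of_nat k * indicator A y) \<mu>"
        by (simp add: w_def li_def ev_def exp_neg_add mult.assoc)
    qed
      finally show ?thesis .
    qed
    have "R Q1 = R Q2"
    proof (rule finite_measure_eq_laplace)
      fix k :: nat
      have "(\<lambda>y. g y + of_nat k * indicator A y) \<in> borel_measurable borel" by measurable
      from insert.IH[OF _ _ this] insert.prems
      show "(\<integral>\<^sup>+x. exp_neg (of_nat k * x) \<partial>R Q1) = (\<integral>\<^sup>+x. exp_neg (of_nat k * x) \<partial>R Q2)"
        unfolding lap[OF fin(1) sets(1)] lap[OF fin(2) sets(2)] by simp
    qed (use fin sets in \<open>simp_all add: R\<close>)
    then have "(\<integral>\<^sup>+x. indicator (S A) x \<partial>R Q1) = (\<integral>\<^sup>+x. indicator (S A) x \<partial>R Q2)" by simp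
    then have "(\<integral>\<^sup>+\<mu>. w \<mu> * indicator (S A) (ev A \<mu>) \<partial>Q1) = (\<integral>\<^sup>+\<mu>. w \<mu> * indicator (S A) (ev A \<mu>) \<partial>Q2)"
      using SA by (simp only: R(3)[OF fin(1) sets(1)] R(3)[OF fin(2) sets(2)] borel_measurable_indicator)
    then show ?case
      using insert.hyps by (simp add: w_def mult_ac)
  qed
  let ?P = "\<Pi>\<^sub>M A\<in>(sets borel :: 'y set set). (borel :: ennreal measure)"
  define \<Phi> where "\<Phi> \<mu> = (\<lambda>A\<in>sets borel. ev A \<mu>)" for \<mu>
  have \<Phi> [measurable]: "\<Phi> \<in> ?B \<rightarrow>\<^sub>M ?P"
    unfolding \<Phi>_def[abs_def] by (rule measurable_restrict) (rule ev)
  have "distr Q1 ?P \<Phi> = distr Q2 ?P \<Phi>"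
  proof (rule measure_eqI_PiM_infinite)
    note [measurable_cong] = sets
    interpret Q1: finite_measure Q1 by fact
    show "finite_measure (distr Q1 ?P \<Phi>)" by (rule Q1.finite_measure_distr) measurable
    fix S :: "'y set \<Rightarrow> ennreal set" and J
    assume J: "finite J" "J \<subseteq> sets borel" "\<And>A. A \<in> J \<Longrightarrow> S A \<in> sets borel"
    let ?X = "prod_emb (sets borel) (\<lambda>_. borel) J (Pi\<^sub>E J S)"
    have X: "?X \<in> sets ?P" using J by (intro sets_PiM_I) auto
    have "emeasure (distr Q ?P \<Phi>) ?X = (\<integral>\<^sup>+\<mu>. (\<Prod>A\<in>J. indicator (S A) (ev A \<mu>)) * li (\<lambda>_. 0) \<mu> \<partial>Q)"
      if Q: "sets Q = sets ?B" for Q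
    proof -
      note [measurable_cong] = Q
      have "emeasure (distr Q ?P \<Phi>) ?X = (\<integral>\<^sup>+\<mu>. indicator ?X (\<Phi> \<mu>) \<partial>Q)"
        using X by (simp flip: nn_integral_indicator add: nn_integral_distr)
      also have "\<dots> = (\<integral>\<^sup>+\<mu>. (\<Prod>A\<in>J. indicator (S A) (ev A \<mu>)) * li (\<lambda>_. 0) \<mu> \<partial>Q)"
      proof (intro nn_integral_cong)
        fix \<mu>
        have "\<Phi> \<mu> \<in> ?X \<longleftrightarrow> (\<forall>A\<in>J. ev A \<mu> \<in> S A)"
          using J(2) by (auto simp: prod_emb_def \<Phi>_def PiE_iff subset_iff)
        then show "indicator ?X (\<Phi> \<mu>) = (\<Prod>A\<in>J. indicator (S A) (ev A \<mu>)) * li (\<lambda>_. 0) \<mu>"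
          using J(1) by (auto simp: li_def indicator_def prod_zero_iff)
      qed
      finally show ?thesis .
    qed
    then show "emeasure (distr Q1 ?P \<Phi>) ?X = emeasure (distr Q2 ?P \<Phi>) ?X"
      using cyl[OF J] sets by simp
  qed simp_all
  \<comment> \<open>The \<sigma>-algebra on the measures is pulled back along \<open>\<Phi>\<close>,
    so equality of the image measures suffices.\<close>
  moreover have "\<exists>X'\<in>sets ?P. X = \<Phi> -` X' \<inter> boundedly_finite" if X: "X \<in> sets ?B" for X
  proof -
    let ?V = "vimage_algebra boundedly_finite \<Phi> ?P"
    have \<Phi>_V: "\<Phi> \<in> ?V \<rightarrow>\<^sub>M ?P"
      by (rule measurable_vimage_algebra1) (auto simp: \<Phi>_def space_PiM)
    have "(\<lambda>\<mu>. \<mu>) \<in> ?V \<rightarrow>\<^sub>M ?B"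
    proof (rule measurable_boundedly_finite_algebraI)
      fix A :: "'y set" assume A: "A \<in> sets borel"
      have "(\<lambda>\<mu>. \<Phi> \<mu> A) \<in> borel_measurable ?V"
        using measurable_compose[OF \<Phi>_V measurable_component_singleton[OF A]] .
      then show "(\<lambda>\<mu>. emeasure \<mu> A) \<in> borel_measurable ?V"
        using A by (simp add: \<Phi>_def ev_def)
    qed simp
    from measurable_sets[OF this X] have "X \<inter> boundedly_finite \<in> sets ?V" by simp
    moreover have "X \<inter> boundedly_finite = X" using sets.sets_into_space[OF X] by auto
    ultimately show ?thesis by (auto simp: sets_vimage_algebra2 \<Phi>_def space_PiM)
  qed
  ultimately show ?thesis
  proof (intro measure_eqI)
    fix X assume "X \<in> sets Q1" 
    then obtain X' where X': "X' \<in> sets ?P" "X = \<Phi> -` X' \<inter> boundedly_finite"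
      using \<open>\<And>X. X \<in> sets ?B \<Longrightarrow> \<exists>X'\<in>sets ?P. X = \<Phi> -` X' \<inter> boundedly_finite\<close> sets by blast
    note [measurable_cong] = sets
    have "emeasure Q1 X = emeasure (distr Q1 ?P \<Phi>) X'"
      using X' by (subst emeasure_distr) (auto simp: sp)
    also have "\<dots> = emeasure (distr Q2 ?P \<Phi>) X'"
      using \<open>distr Q1 ?P \<Phi> = distr Q2 ?P \<Phi>\<close> by simp
    also have "\<dots> = emeasure Q2 X"
      using X' by (subst emeasure_distr) (auto simp: sp)
    finally show "emeasure Q1 X = emeasure Q2 X" .
  qed (use sets in simp)
qed

section \<open>Laplace functionals of Poisson random measures\<close>

text \<open>The measure L and the function g are left free, so that the same level sets serve for
  the random measure, with g the identity, and for its intensity, with g(x) = 1 - exp (-x). The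
  values are enumerated by natural numbers to match the sequences in the independence
  condition.\<close>

lemma nn_integral_simple_function_compose:
  fixes s :: "'a \<Rightarrow> ennreal" and g :: "ennreal \<Rightarrow> ennreal"
  assumes e: "bij_betw e {..<m::nat} (s ` space M)" and sets: "sets L = sets M"
    and s: "simple_function M s"
  shows "(\<integral>\<^sup>+z. g (s z) \<partial>L) = (\<Sum>i<m. g (e i) * emeasure L (s -` {e i} \<inter> space M))"
proof -
  have sp: "space L = space M" using sets by (rule sets_eq_imp_space_eq)
  have [measurable]: "s -` {e i} \<inter> space M \<in> sets L" if "i < m" for i
    using simple_functionD(2)[OF s] sets by simp
  have "(\<integral>\<^sup>+z. g (s z) \<partial>L) = (\<integral>\<^sup>+z. (\<Sum>i<m. g (e i) * indicator (s -` {e i} \<inter> space M) z) \<partial>L)"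
  proof (intro nn_integral_cong)
    fix z assume z: "z \<in> space L"
    then obtain j where j: "j < m" "s z = e j"
      using e sp by (auto simp: bij_betw_def image_iff) (metis (no_types, opaque_lifting) imageE image_eqI lessThan_iff)
    have "(\<Sum>i<m. g (e i) * indicator (s -` {e i} \<inter> space M) z) = (\<Sum>i<m. if i = j then g (e j) else 0)"
    proof (intro sum.cong refl)
      fix i assume "i \<in> {..<m}"
      then have "e i = e j \<longleftrightarrow> i = j" using e j by (auto simp: bij_betw_def inj_on_def)
      then show "g (e i) * indicator (s -` {e i} \<inter> space M) z = (if i = j then g (e j) else 0)"
        using z j by (auto simp: indicator_def sp)
    qed
    also have "\<dots> = g (s z)" using j by (subst sum.delta) auto
    finally show "g (s z) = (\<Sum>i<m. g (e i) * indicator (s -` {e i} \<inter> space M) z)" ..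
  qed
  also have "\<dots> = (\<Sum>i<m. g (e i) * emeasure L (s -` {e i} \<inter> space M))"
    by (subst nn_integral_sum) (auto simp: nn_integral_cmult_indicator)
  finally show ?thesis .
qed

lemma one_minus_exp_neg_SUP:
  assumes "I \<noteq> {}"
  shows "1 - exp_neg (SUP k\<in>I. f k) = (SUP k\<in>I. 1 - exp_neg (f k))"
  using assms by (simp add: exp_neg_SUP ennreal_INF_const_minus)

text \<open>For finite intensity mass l this is the generating function of a Poisson variable: the
  terms (exp (-a) l)^k / k! are summed and multiplied by exp (-l). For infinite mass the count is
  almost surely infinite and both sides vanish, unless a = 0, where both are 1.\<close>

lemma poisson_laplace_transform:
  assumes p: "poisson_random_measure \<Omega> N \<nu>" and A: "A \<in> sets \<nu>" and a: "a < \<infinity>"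
  shows "(\<integral>\<^sup>+\<omega>. exp_neg (a * emeasure (N \<omega>) A) \<partial>\<Omega>) = exp_neg ((1 - exp_neg a) * emeasure \<nu> A)"
proof -
  interpret prob_space \<Omega> using p by (simp add: poisson_random_measure_def)
  have N: "N \<in> \<Omega> \<rightarrow>\<^sub>M measure_algebra \<nu>" using p by (simp add: poisson_random_measure_def)
  define X where "X \<omega> = emeasure (N \<omega>) A" for \<omega>
  have [measurable]: "X \<in> borel_measurable \<Omega>"
    unfolding X_def[abs_def] by (rule measurable_compose[OF N measurable_emeasure_measure_algebra[OF A]])
  show ?thesis
  proof (cases "emeasure \<nu> A = \<infinity>")
    case True
    then have ae: "AE \<omega> in \<Omega>. X \<omega> = \<infinity>"
      using p A by (simp add: poisson_random_measure_def X_def)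
    show ?thesis
    proof (cases "a = 0")
      case False
      have "1 - exp_neg a \<noteq> 0"
        using False a by (cases a) (auto simp: exp_neg_ennreal ennreal_minus ennreal_1[symmetric] ennreal_eq_0_iff simp del: ennreal_1)
      then have "exp_neg ((1 - exp_neg a) * emeasure \<nu> A) = 0"
        using True by (simp add: ennreal_mult_top)
      moreover have "(\<integral>\<^sup>+\<omega>. exp_neg (a * X \<omega>) \<partial>\<Omega>) = (\<integral>\<^sup>+\<omega>. 0 \<partial>\<Omega>)"
      proof (intro nn_integral_cong_AE, use ae in eventually_elim)
        show "exp_neg (a * X \<omega>) = 0" if "X \<omega> = \<infinity>" for \<omega>
          using that False by (simp add: ennreal_mult_top)
      qed
      ultimately show ?thesis by (simp add: X_def)
    qed (simp add: emeasure_space_1)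
  next
    case False
    define l where "l = measure \<nu> A"
    have l: "emeasure \<nu> A = ennreal l" "0 \<le> l"
      using False by (simp_all add: l_def emeasure_eq_ennreal_measure)
    obtain r where r: "a = ennreal r" "0 \<le> r" using a by (cases a) auto
    define E where "E k = {\<omega>\<in>space \<Omega>. X \<omega> = of_nat k}" for k :: nat
    have [measurable]: "E k \<in> sets \<Omega>" for k unfolding E_def by measurable
    have pE: "prob (E k) = l ^ k / fact k * exp (- l)" for k
      using p A False by (auto simp: poisson_random_measure_def E_def X_def l_def less_top)
    have sums: "(\<lambda>k. c ^ k / fact k * exp (- l)) sums (exp c * exp (- l))" for c :: real
      using sums_mult2[OF exp_converges[of c], of "exp (- l)"] by (simp add: divide_inverse mult_ac)
    have disj: "disjoint_family E" by (auto simp: disjoint_family_on_def E_def)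
    \<comment> \<open>The point probabilities already sum to 1, so the count is almost surely a
      natural number and the expectation becomes a series over the events
      \<open>E k\<close>.\<close>
    have "prob (\<Union>k. E k) = (\<Sum>k. prob (E k))"
      using finite_measure_UNION[OF _ disj] by (simp add: image_subset_iff sums_iff)
    also have "\<dots> = 1"
      using sums[of l] by (simp add: pE sums_iff mult_exp_exp)
    finally have ae: "AE \<omega> in \<Omega>. \<omega> \<in> (\<Union>k. E k)"
      by (intro AE_prob_1) 
    have "(\<integral>\<^sup>+\<omega>. exp_neg (a * X \<omega>) \<partial>\<Omega>) = (\<integral>\<^sup>+\<omega>. (\<Sum>k. exp_neg (a * of_nat k) * indicator (E k) \<omega>) \<partial>\<Omega>)"
    proof (intro nn_integral_cong_AE, use ae in eventually_elim)
      fix \<omega> assume "\<omega> \<in> (\<Union>k. E k)"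
      then obtain j where j: "\<omega> \<in> E j" by auto
      have "(\<Sum>k. exp_neg (a * of_nat k) * indicator (E k) \<omega>) = (\<Sum>k\<in>{j}. exp_neg (a * of_nat k) * indicator (E k) \<omega>)"
        using j disj by (intro suminf_finite) (auto simp: disjoint_family_on_def indicator_def)
      also have "\<dots> = exp_neg (a * of_nat j)" using j by simp
      also have "of_nat j = X \<omega>" using j by (simp add: E_def)
      finally show "exp_neg (a * X \<omega>) = (\<Sum>k. exp_neg (a * of_nat k) * indicator (E k) \<omega>)" ..
    qed
    also have "\<dots> = (\<Sum>k. exp_neg (a * of_nat k) * emeasure \<Omega> (E k))"
      by (subst nn_integral_suminf) (auto simp: nn_integral_cmult_indicator)
    also have "\<dots> = (\<Sum>k. ennreal ((exp (- r) * l) ^ k / fact k * exp (- l)))"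
    proof (intro suminf_cong)
      fix k
      have "exp_neg (a * of_nat k) = ennreal (exp (- r) ^ k)"
        using r by (simp add: ennreal_of_nat_eq_real_of_nat exp_neg_ennreal flip: ennreal_mult exp_of_nat_mult)
      then show "exp_neg (a * of_nat k) * emeasure \<Omega> (E k) = ennreal ((exp (- r) * l) ^ k / fact k * exp (- l))"
        using l by (simp add: emeasure_eq_measure pE power_mult_distrib flip: ennreal_mult)
    qed
    also have "\<dots> = ennreal (exp (exp (- r) * l) * exp (- l))"
      using l by (intro suminf_ennreal_eq sums) auto
    also have "\<dots> = exp_neg ((1 - exp_neg a) * emeasure \<nu> A)"
    proof -
      have "(1 - exp_neg a) * emeasure \<nu> A = ennreal ((1 - exp (- r)) * l)"
        using r l by (simp add: exp_neg_ennreal ennreal_minus ennreal_mult ennreal_1[symmetric] del: ennreal_1)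
      moreover have "0 \<le> (1 - exp (- r)) * l" using r l by simp
      ultimately show ?thesis
        by (simp add: exp_neg_ennreal mult_exp_exp algebra_simps)
    qed
    finally show ?thesis by (simp add: X_def)
  qed
qed

text \<open>For a simple function the level sets are disjoint, so the exponentials are independent
  and the expectation factors. General functions are reached by increasing simple ones: the
  exponentials decrease, and the infimum may be taken outside the expectation because they are
  bounded by 1.\<close>

lemma poisson_laplace_functional:
  fixes \<phi> :: "'a \<Rightarrow> ennreal"
  assumes p: "poisson_random_measure \<Omega> N \<nu>" and \<phi>: "\<phi> \<in> borel_measurable \<nu>"
  shows "(\<integral>\<^sup>+\<omega>. exp_neg (\<integral>\<^sup>+z. \<phi> z \<partial>N \<omega>) \<partial>\<Omega>) = exp_neg (\<integral>\<^sup>+z. 1 - exp_neg (\<phi> z) \<partial>\<nu>)"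
proof -
  interpret prob_space \<Omega> using p by (simp add: poisson_random_measure_def)
  have N: "N \<in> \<Omega> \<rightarrow>\<^sub>M measure_algebra \<nu>" using p by (simp add: poisson_random_measure_def)
  have sN: "sets (N \<omega>) = sets \<nu>" if "\<omega> \<in> space \<Omega>" for \<omega>
    using measurable_space[OF N that] by (simp add: space_measure_algebra)
  have meas: "(\<lambda>\<omega>. exp_neg (\<integral>\<^sup>+z. f z \<partial>N \<omega>)) \<in> borel_measurable \<Omega>" if "f \<in> borel_measurable \<nu>" for f
    by (rule measurable_compose[OF measurable_compose[OF N nn_integral_measurable_measure_algebra[OF that]] exp_neg_measurable])
  have simple: "(\<integral>\<^sup>+\<omega>. exp_neg (\<integral>\<^sup>+z. s z \<partial>N \<omega>) \<partial>\<Omega>) = exp_neg (\<integral>\<^sup>+z. 1 - exp_neg (s z) \<partial>\<nu>)"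
    if s: "simple_function \<nu> s" "\<And>x. s x < top" for s
  proof -
    obtain e where e: "bij_betw e {..<card (s ` space \<nu>)} (s ` space \<nu>)"
      using ex_bij_betw_nat_finite[OF simple_functionD(1)[OF s(1)]] by (auto simp: atLeast0LessThan)
    define m where "m = card (s ` space \<nu>)"
    \<comment> \<open>Independence is postulated for whole sequences of disjoint sets, hence the
      padding with empty sets beyond the last value.\<close>
    define A where "A i = (if i < m then s -` {e i} \<inter> space \<nu> else {})" for i
    have A: "A i \<in> sets \<nu>" for i using simple_functionD(2)[OF s(1)] by (simp add: A_def)
    have disj: "disjoint_family A"
      using e by (auto simp: disjoint_family_on_def A_def bij_betw_def inj_on_def m_def)
    have "range A \<subseteq> sets \<nu>" using A by auto
    with disj have "indep_vars (\<lambda>_. borel) (\<lambda>i \<omega>. emeasure (N \<omega>) (A i)) UNIV"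
      using p unfolding poisson_random_measure_def by blast
    then have "indep_vars (\<lambda>_. borel) (\<lambda>i \<omega>. emeasure (N \<omega>) (A i)) {..<m}"
      by (rule indep_vars_subset) simp
    then have ind: "indep_vars (\<lambda>_. borel) (\<lambda>i \<omega>. exp_neg (e i * emeasure (N \<omega>) (A i))) {..<m}"
      by (rule indep_vars_compose2) measurable
    have int: "(\<integral>\<^sup>+z. g (s z) \<partial>L) = (\<Sum>i<m. g (e i) * emeasure L (A i))" if "sets L = sets \<nu>" for g L
      using nn_integral_simple_function_compose[OF e that s(1), of g] by (simp add: m_def A_def)
    have ei: "e i < \<infinity>" if "i < m" for i
      using e that s(2) by (auto simp: bij_betw_def m_def) (metis imageI image_iff lessThan_iff)
    have "(\<integral>\<^sup>+\<omega>. exp_neg (\<integral>\<^sup>+z. s z \<partial>N \<omega>) \<partial>\<Omega>) = (\<integral>\<^sup>+\<omega>. (\<Prod>i<m. exp_neg (e i * emeasure (N \<omega>) (A i))) \<partial>\<Omega>)"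
      using int[of _ "\<lambda>x. x"] sN by (intro nn_integral_cong) (simp add: exp_neg_sum)
    also have "\<dots> = (\<Prod>i<m. \<integral>\<^sup>+\<omega>. exp_neg (e i * emeasure (N \<omega>) (A i)) \<partial>\<Omega>)"
      by (rule indep_vars_nn_integral[OF _ ind]) auto
    also have "\<dots> = (\<Prod>i<m. exp_neg ((1 - exp_neg (e i)) * emeasure \<nu> (A i)))"
      using ei by (intro prod.cong poisson_laplace_transform[OF p A]) auto
    also have "\<dots> = exp_neg (\<integral>\<^sup>+z. 1 - exp_neg (s z) \<partial>\<nu>)"
      by (simp add: int[of \<nu> "\<lambda>x. 1 - exp_neg x"] exp_neg_sum)
    finally show ?thesis .
  qed
  obtain F where F: "\<And>i. simple_function \<nu> (F i)" "incseq F" "\<And>i x. F i x < top" "\<And>x. (SUP i. F i x) = \<phi> x"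
    by (rule borel_measurable_implies_simple_function_sequence'[OF \<phi>]) blast
  have Fm: "F i \<in> borel_measurable \<nu>" for i using F(1) by (rule borel_measurable_simple_function)
  have F_mono: "F i x \<le> F j x" if "i \<le> j" for i j x using F(2) that by (auto simp: incseq_def le_fun_def)
  have "(\<integral>\<^sup>+\<omega>. exp_neg (\<integral>\<^sup>+z. \<phi> z \<partial>N \<omega>) \<partial>\<Omega>) = (\<integral>\<^sup>+\<omega>. (INF i. exp_neg (\<integral>\<^sup>+z. F i z \<partial>N \<omega>)) \<partial>\<Omega>)"
  proof (intro nn_integral_cong)
    fix \<omega> assume "\<omega> \<in> space \<Omega>"
    then have s: "sets (N \<omega>) = sets \<nu>" by (rule sN)
    have "(\<integral>\<^sup>+z. \<phi> z \<partial>N \<omega>) = (\<integral>\<^sup>+z. (SUP i. F i z) \<partial>N \<omega>)" by (simp add: F(4))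
    also have "\<dots> = (SUP i. \<integral>\<^sup>+z. F i z \<partial>N \<omega>)"
      using F(2) Fm by (intro nn_integral_monotone_convergence_SUP) (simp_all add: measurable_cong_sets[OF s refl])
    finally show "exp_neg (\<integral>\<^sup>+z. \<phi> z \<partial>N \<omega>) = (INF i. exp_neg (\<integral>\<^sup>+z. F i z \<partial>N \<omega>))"
      by (simp add: exp_neg_SUP)
  qed
  also have "\<dots> = (INF i. \<integral>\<^sup>+\<omega>. exp_neg (\<integral>\<^sup>+z. F i z \<partial>N \<omega>) \<partial>\<Omega>)"
  proof (rule nn_integral_monotone_convergence_INF_decseq)
    show "decseq (\<lambda>i \<omega>. exp_neg (\<integral>\<^sup>+z. F i z \<partial>N \<omega>))"
      by (intro monotoneI) (auto simp: le_fun_def exp_neg_le_iff intro!: nn_integral_mono F_mono)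
    show "(\<lambda>\<omega>. exp_neg (\<integral>\<^sup>+z. F i z \<partial>N \<omega>)) \<in> borel_measurable \<Omega>" for i by (rule meas[OF Fm])
    have "(\<integral>\<^sup>+\<omega>. exp_neg (\<integral>\<^sup>+z. F i z \<partial>N \<omega>) \<partial>\<Omega>) \<le> (\<integral>\<^sup>+\<omega>. 1 \<partial>\<Omega>)" for i
      by (intro nn_integral_mono) simp
    then show "(\<integral>\<^sup>+\<omega>. exp_neg (\<integral>\<^sup>+z. F 0 z \<partial>N \<omega>) \<partial>\<Omega>) < \<infinity>"
      by (rule le_less_trans) (simp add: emeasure_space_1)
  qed
  also have "\<dots> = (INF i. exp_neg (\<integral>\<^sup>+z. 1 - exp_neg (F i z) \<partial>\<nu>))"
    using simple[OF F(1,3)] by simp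
  also have "\<dots> = exp_neg (SUP i. \<integral>\<^sup>+z. 1 - exp_neg (F i z) \<partial>\<nu>)"
    by (simp add: exp_neg_SUP)
  also have "(SUP i. \<integral>\<^sup>+z. 1 - exp_neg (F i z) \<partial>\<nu>) = (\<integral>\<^sup>+z. (SUP i. 1 - exp_neg (F i z)) \<partial>\<nu>)"
    using Fm by (intro nn_integral_monotone_convergence_SUP[symmetric])
      (auto simp: incseq_def le_fun_def intro!: one_minus_exp_neg_mono F_mono)
  also have "\<dots> = (\<integral>\<^sup>+z. 1 - exp_neg (\<phi> z) \<partial>\<nu>)"
    by (simp add: F(4) flip: one_minus_exp_neg_SUP)
  finally show ?thesis .
qed

section \<open>The law of the random measure driven by a Poisson random measure\<close>

text \<open>Both facts come from identifying \<open>weighted_marginal\<close> with the image, under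
  the second projection, of the measure with density h(s) against L.\<close>

lemma
  fixes h :: "'s::polish_space \<Rightarrow> real" and L :: "('s \<times> 'y::polish_space) measure"
  assumes h: "h \<in> borel_measurable borel" and L: "sets L = sets (borel \<Otimes>\<^sub>M borel)"
  shows sets_weighted_marginal: "sets (weighted_marginal h L) = sets borel"
    and nn_integral_weighted_marginal: "g \<in> borel_measurable borel \<Longrightarrow>
      (\<integral>\<^sup>+y. g y \<partial>weighted_marginal h L) = (\<integral>\<^sup>+z. g (snd z) * ennreal (h (fst z)) \<partial>L)"
proof -
  define w where "w z = ennreal (h (fst z))" for z :: "'s \<times> 'y"
  have w: "w \<in> borel_measurable L"
    unfolding measurable_cong_sets[OF L refl] w_def[abs_def] using h by measurable
  have snd: "snd \<in> density L w \<rightarrow>\<^sub>M (borel :: 'y measure)"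
    by (simp add: measurable_cong_sets[OF L refl])
  define R where "R = distr (density L w) (borel :: 'y measure) snd"
  have int: "(\<integral>\<^sup>+y. g y \<partial>R) = (\<integral>\<^sup>+z. w z * g (snd z) \<partial>L)" if "g \<in> borel_measurable borel" for g
  proof -
    have "(\<lambda>z. g (snd z)) \<in> borel_measurable L"
      unfolding measurable_cong_sets[OF L refl] using that by measurable
    then show ?thesis
      unfolding R_def using nn_integral_distr[OF snd, of g] that nn_integral_density[OF w] by simp
  qed
  have "weighted_marginal h L = measure_of (space R) (sets R) (emeasure R)"
    unfolding weighted_marginal_def R_def space_distr sets_distr space_borel
  proof (rule measure_of_eq)
    fix B :: "'y set" assume "B \<in> sigma_sets UNIV (sets borel)"
    then have B: "B \<in> sets borel" using sets.sigma_sets_eq[of "borel :: 'y measure"] by simp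
    then have "emeasure R B = (\<integral>\<^sup>+z. w z * indicator B (snd z) \<partial>L)"
      using int[of "indicator B"] by (simp add: R_def)
    then show "(\<integral>\<^sup>+z. ennreal (h (fst z)) * indicator B (snd z) \<partial>L) = emeasure (distr (density L w) borel snd) B"
      by (simp add: w_def R_def)
  qed simp
  then have *: "weighted_marginal h L = R" by (simp only: measure_of_of_measure)
  show "sets (weighted_marginal h L) = sets borel" by (simp add: * R_def)
  show "(\<integral>\<^sup>+y. g y \<partial>weighted_marginal h L) = (\<integral>\<^sup>+z. g (snd z) * ennreal (h (fst z)) \<partial>L)"
    if "g \<in> borel_measurable borel"
    using int[OF that] by (simp add: * w_def mult.commute)
qed

text \<open>The Levy-Khintchine exponent of a driftless completely random measure with jump sizes
  h(s).\<close>

definition laplace_exponent ::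
    "('s \<Rightarrow> real) \<Rightarrow> ('y \<Rightarrow> 's measure) \<Rightarrow> 'y measure \<Rightarrow> ('y \<Rightarrow> ennreal) \<Rightarrow> ennreal" where
  "laplace_exponent h \<rho> \<eta> g = (\<integral>\<^sup>+y. \<integral>\<^sup>+s. 1 - exp_neg (g y * ennreal (h s)) \<partial>\<rho> y \<partial>\<eta>)"

text \<open>This is all that later arguments know about the law; it hides the Poisson random measure
  and its probability space.\<close>

definition has_laplace_exponent :: "'y::polish_space measure measure \<Rightarrow> (('y \<Rightarrow> ennreal) \<Rightarrow> ennreal) \<Rightarrow> bool" where
  "has_laplace_exponent P \<Lambda> \<longleftrightarrow> prob_space P \<and> sets P = sets boundedly_finite_algebra \<and>
     (\<forall>g\<in>borel_measurable borel. (\<integral>\<^sup>+\<mu>. exp_neg (\<integral>\<^sup>+y. g y \<partial>\<mu>) \<partial>P) = exp_neg (\<Lambda> g))"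

text \<open>The transform itself is the Poisson Laplace functional at g(y) h(s). The substantial
  part is that the restriction in \<open>random_measure_law\<close> loses no mass, i.e. that bounded
  sets have finite measure almost surely.\<close>

lemma random_measure_law_laplace:
  fixes h :: "'s::polish_space \<Rightarrow> real" and \<rho> :: "'y::polish_space \<Rightarrow> 's measure"
  assumes \<eta>: "sets \<eta> = sets borel" and \<rho>: "s_finite_kernel borel borel \<rho>"
    and h [measurable]: "h \<in> borel_measurable borel" and h_pos: "\<And>s. 0 < h s"
    and integrability: "\<And>B. B \<in> sets borel \<Longrightarrow> bounded B \<Longrightarrow>
          (\<integral>\<^sup>+y\<in>B. (\<integral>\<^sup>+s. ennreal (min (h s) 1) \<partial>\<rho> y) \<partial>\<eta>) < \<infinity>"
    and p: "poisson_random_measure \<Omega> N (kernel_measure borel \<rho> \<eta>)"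
  shows "has_laplace_exponent (random_measure_law \<Omega> N h) (laplace_exponent h \<rho> \<eta>)"
proof -
  let ?\<nu> = "kernel_measure borel \<rho> \<eta>"
  let ?M = "measure_algebra borel :: 'y measure measure"
  interpret prob_space \<Omega> using p by (simp add: poisson_random_measure_def)
  note [measurable_cong] = \<eta>
  have \<rho>\<eta>: "s_finite_kernel \<eta> borel \<rho>"
    using s_finite_kernel_compose[OF \<rho> measurable_ident_sets[OF \<eta>]] .
  have s\<nu> [measurable_cong]: "sets ?\<nu> = sets (borel \<Otimes>\<^sub>M borel)"
    using \<eta> by (simp cong: sets_pair_measure_cong)
  have int\<nu>: "(\<integral>\<^sup>+z. f z \<partial>?\<nu>) = (\<integral>\<^sup>+y. \<integral>\<^sup>+s. f (s, y) \<partial>\<rho> y \<partial>\<eta>)" if "f \<in> borel_measurable (borel \<Otimes>\<^sub>M borel)" for f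
    using that s\<nu> by (intro nn_integral_kernel_measure_s_finite[OF \<rho>\<eta>]) (simp cong: measurable_cong_sets sets_pair_measure_cong add: \<eta>)
  have N: "N \<in> \<Omega> \<rightarrow>\<^sub>M measure_algebra ?\<nu>" using p by (simp add: poisson_random_measure_def)
  have sN: "sets (N \<omega>) = sets (borel \<Otimes>\<^sub>M borel)" if "\<omega> \<in> space \<Omega>" for \<omega>
    using measurable_space[OF N that] s\<nu> by (simp add: space_measure_algebra)
  define W where "W \<omega> = weighted_marginal h (N \<omega>)" for \<omega>
  have intW: "(\<integral>\<^sup>+y. g y \<partial>W \<omega>) = (\<integral>\<^sup>+z. g (snd z) * ennreal (h (fst z)) \<partial>N \<omega>)"
    if "\<omega> \<in> space \<Omega>" "g \<in> borel_measurable borel" for \<omega> g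
    unfolding W_def using nn_integral_weighted_marginal[OF h sN that(2)] that(1) .
  have sW: "sets (W \<omega>) = sets borel" if "\<omega> \<in> space \<Omega>" for \<omega>
    unfolding W_def by (rule sets_weighted_marginal[OF h sN[OF that]])
  have W: "W \<in> \<Omega> \<rightarrow>\<^sub>M ?M"
  proof (rule measurable_measure_algebraI)
    fix A :: "'y set" assume [measurable]: "A \<in> sets borel"
    have "(\<lambda>\<omega>. \<integral>\<^sup>+z. indicator A (snd z) * ennreal (h (fst z)) \<partial>N \<omega>) \<in> borel_measurable \<Omega>"
      by (rule measurable_compose[OF N nn_integral_measurable_measure_algebra]) measurable
    moreover have "emeasure (W \<omega>) A = (\<integral>\<^sup>+z. indicator A (snd z) * ennreal (h (fst z)) \<partial>N \<omega>)"
      if "\<omega> \<in> space \<Omega>" for \<omega>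
      using intW[OF that, of "indicator A"] sW[OF that] by simp
    ultimately show "(\<lambda>\<omega>. emeasure (W \<omega>) A) \<in> borel_measurable \<Omega>" by (simp cong: measurable_cong)
  qed (rule sW)
  define Q where "Q = distr \<Omega> ?M W"
  interpret Q: prob_space Q unfolding Q_def using W by (rule prob_space_distr)
  have sQ: "sets Q = sets ?M" by (simp add: Q_def)
  define E where "E g \<mu> = exp_neg (\<integral>\<^sup>+y. g y \<partial>\<mu>)" for g :: "'y \<Rightarrow> ennreal" and \<mu>
  have E [measurable]: "E g \<in> borel_measurable ?M" if "g \<in> borel_measurable borel" for g
    unfolding E_def[abs_def]
    by (rule measurable_compose[OF nn_integral_measurable_measure_algebra[OF that] exp_neg_measurable])
  have lap_\<nu>: "laplace_exponent h \<rho> \<eta> g = (\<integral>\<^sup>+z. 1 - exp_neg (g (snd z) * ennreal (h (fst z))) \<partial>?\<nu>)"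
    if [measurable]: "g \<in> borel_measurable borel" for g
  proof -
    have "(\<lambda>z. 1 - exp_neg (g (snd z) * ennreal (h (fst z)))) \<in> borel_measurable (borel \<Otimes>\<^sub>M borel)"
      by measurable
    from int\<nu>[OF this] show ?thesis by (simp add: laplace_exponent_def)
  qed
  have lap: "(\<integral>\<^sup>+\<mu>. E g \<mu> \<partial>Q) = exp_neg (laplace_exponent h \<rho> \<eta> g)"
    if g [measurable]: "g \<in> borel_measurable borel" for g
  proof -
    have "(\<integral>\<^sup>+\<mu>. E g \<mu> \<partial>Q) = (\<integral>\<^sup>+\<omega>. E g (W \<omega>) \<partial>\<Omega>)"
      unfolding Q_def by (rule nn_integral_distr[OF W]) (simp add: E)
    also have "\<dots> = (\<integral>\<^sup>+\<omega>. exp_neg (\<integral>\<^sup>+z. g (snd z) * ennreal (h (fst z)) \<partial>N \<omega>) \<partial>\<Omega>)"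
      by (intro nn_integral_cong) (simp add: E_def intW)
    also have "\<dots> = exp_neg (laplace_exponent h \<rho> \<eta> g)"
      unfolding lap_\<nu>[OF g] by (rule poisson_laplace_functional[OF p]) measurable
    finally show ?thesis .
  qed
  have fin: "AE \<mu> in Q. emeasure \<mu> B < \<infinity>" if B: "B \<in> sets borel" "bounded B" for B
  proof -
    note [measurable] = B(1)
    \<comment> \<open>Arbitrarily small multiples of the indicator of B. Where \<mu>(B) is infinite,
      every multiple gives the exponential the value 0, so the probability of that event is at most
      1 - exp (-exponent), and the exponent tends to 0 as k grows.\<close>
    define g :: "nat \<Rightarrow> 'y \<Rightarrow> ennreal" where "g k y = ennreal ((1 / 2) ^ k) * indicator B y" for k y
    have g [measurable]: "g k \<in> borel_measurable borel" for k unfolding g_def by measurable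
    let ?S = "{\<mu>\<in>space Q. emeasure \<mu> B = \<infinity>}"
    have em: "(\<lambda>\<mu>. emeasure \<mu> B) \<in> borel_measurable Q"
      unfolding measurable_cong_sets[OF sQ refl] by (rule measurable_emeasure_measure_algebra) fact
    have S: "?S \<in> sets Q"
      using measurable_sets[OF em, of "{\<infinity>}"] by (simp add: vimage_def Int_def conj_commute)
    have le: "emeasure Q ?S \<le> laplace_exponent h \<rho> \<eta> (g k)" for k
    proof -
      have Eg: "E (g k) \<mu> + indicator ?S \<mu> \<le> 1" if "\<mu> \<in> space Q" for \<mu>
      proof -
        have s: "sets \<mu> = sets borel" using that sets_eq_imp_space_eq[OF sQ] by (simp add: space_measure_algebra)
        have "(\<integral>\<^sup>+y. g k y \<partial>\<mu>) = ennreal ((1 / 2) ^ k) * emeasure \<mu> B"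
          unfolding g_def using s by (intro nn_integral_cmult_indicator) simp
        then show ?thesis by (auto simp: E_def indicator_def ennreal_mult_top)
      qed
      have "exp_neg (laplace_exponent h \<rho> \<eta> (g k)) + emeasure Q ?S = (\<integral>\<^sup>+\<mu>. E (g k) \<mu> + indicator ?S \<mu> \<partial>Q)"
      proof -
        have "E (g k) \<in> borel_measurable Q"
          unfolding measurable_cong_sets[OF sQ refl] by (rule E[OF g])
        from nn_integral_add[OF this borel_measurable_indicator[OF S]] show ?thesis
          using lap[OF g] nn_integral_indicator[OF S] by simp
      qed
      also have "\<dots> \<le> (\<integral>\<^sup>+\<mu>. 1 \<partial>Q)" by (intro nn_integral_mono Eg)
      finally have "emeasure Q ?S \<le> 1 - exp_neg (laplace_exponent h \<rho> \<eta> (g k))"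
        by (simp add: Q.emeasure_space_1 ennreal_le_minus_iff add.commute)
      also have "\<dots> \<le> laplace_exponent h \<rho> \<eta> (g k)" by (rule one_minus_exp_neg_le)
      finally show ?thesis .
    qed
    have "(\<lambda>k. laplace_exponent h \<rho> \<eta> (g k)) \<longlonglongrightarrow> (\<integral>\<^sup>+z. 0 \<partial>?\<nu>)"
      unfolding lap_\<nu>[OF g]
    \<comment> \<open>The dominating function is the integrand of the assumption on bounded sets: 1
      - exp (-x) is at most 1 and at most x, and the multiples of the indicator do not exceed
      it.\<close>
    proof (rule nn_integral_dominated_convergence[where w = "\<lambda>z. ennreal (min (h (fst z)) 1) * indicator B (snd z)"])
      show "AE z in ?\<nu>. 1 - exp_neg (g k (snd z) * ennreal (h (fst z))) \<le> ennreal (min (h (fst z)) 1) * indicator B (snd z)" for k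
      proof (intro AE_I2)
        fix z :: "'s \<times> 'y"
        have "1 - exp_neg (ennreal ((1 / 2) ^ k) * ennreal (h (fst z))) \<le> ennreal (h (fst z))"
        proof -
          have "1 - exp_neg (ennreal ((1 / 2) ^ k) * ennreal (h (fst z))) \<le> ennreal ((1 / 2) ^ k) * ennreal (h (fst z))"
            by (rule one_minus_exp_neg_le)
          also have "\<dots> \<le> 1 * ennreal (h (fst z))"
            by (intro mult_right_mono) (auto simp: power_le_one)
          finally show ?thesis by simp
        qed
        then show "1 - exp_neg (g k (snd z) * ennreal (h (fst z))) \<le> ennreal (min (h (fst z)) 1) * indicator B (snd z)"
          by (auto simp: g_def indicator_def min_def)
      qed
      have "(\<integral>\<^sup>+z. ennreal (min (h (fst z)) 1) * indicator B (snd z) \<partial>?\<nu>)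
          = (\<integral>\<^sup>+y\<in>B. (\<integral>\<^sup>+s. ennreal (min (h s) 1) \<partial>\<rho> y) \<partial>\<eta>)"
      proof -
        have "(\<lambda>z. ennreal (min (h (fst z)) 1) * indicator B (snd z)) \<in> borel_measurable (borel \<Otimes>\<^sub>M borel)"
          by measurable
        from int\<nu>[OF this] show ?thesis
          by (auto intro!: nn_integral_cong split: split_indicator)
      qed
      then show "(\<integral>\<^sup>+z. ennreal (min (h (fst z)) 1) * indicator B (snd z) \<partial>?\<nu>) < \<infinity>"
        using integrability[OF B] by simp
      show "AE z in ?\<nu>. (\<lambda>k. 1 - exp_neg (g k (snd z) * ennreal (h (fst z)))) \<longlonglongrightarrow> 0"
      proof (intro AE_I2)
        fix z :: "'s \<times> 'y"
        have "(\<lambda>k. ennreal ((1 / 2) ^ k * h (fst z))) \<longlonglongrightarrow> ennreal 0"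
          by (intro tendsto_ennrealI) real_asymp
        moreover have "1 - exp_neg (g k (snd z) * ennreal (h (fst z))) \<le> ennreal ((1 / 2) ^ k * h (fst z))" for k
        proof -
          have "g k (snd z) * ennreal (h (fst z)) \<le> ennreal ((1 / 2) ^ k * h (fst z))"
            using h_pos[of "fst z"] by (auto simp: g_def indicator_def ennreal_mult)
          then show ?thesis using one_minus_exp_neg_le order_trans by blast
        qed
        ultimately show "(\<lambda>k. 1 - exp_neg (g k (snd z) * ennreal (h (fst z)))) \<longlonglongrightarrow> 0"
          using tendsto_sandwich[OF always_eventually always_eventually tendsto_const]
          by (metis (no_types, lifting) ennreal_0 zero_le)
      qed
    qed measurable
    then have "(\<lambda>k. laplace_exponent h \<rho> \<eta> (g k)) \<longlonglongrightarrow> 0" by simp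
    then have "emeasure Q ?S \<le> 0" using le by (intro LIMSEQ_le_const) auto
    then have "emeasure Q ?S = 0" by simp
    then show ?thesis using S by (intro AE_I[where N="?S"]) (auto simp: not_less top_unique)
  qed
  have bf: "AE \<mu> in Q. \<mu> \<in> boundedly_finite"
  proof -
    have "AE \<mu> in Q. emeasure \<mu> (ball undefined (real i)) < \<infinity>" for i :: nat
      by (rule fin[OF borel_open[OF open_ball] bounded_ball])
    then have "AE \<mu> in Q. \<forall>i::nat. emeasure \<mu> (ball undefined (real i)) < \<infinity>"
      unfolding AE_all_countable ..
    moreover have "AE \<mu> in Q. sets \<mu> = sets borel"
      using sets_eq_imp_space_eq[OF sQ] by (intro AE_I2) (simp add: space_measure_algebra)
    ultimately show ?thesis by eventually_elim (simp add: boundedly_finite_iff)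
  qed
  have P: "random_measure_law \<Omega> N h = restrict_space Q boundedly_finite"
    by (simp add: random_measure_law_def Q_def W_def[abs_def])
  have bfs: "boundedly_finite \<inter> space Q \<in> sets Q"
    using boundedly_finite_measurable sQ by auto
  have restr: "(\<integral>\<^sup>+\<mu>. f \<mu> \<partial>restrict_space Q boundedly_finite) = (\<integral>\<^sup>+\<mu>. f \<mu> \<partial>Q)" for f
    unfolding nn_integral_restrict_space[OF bfs]
    by (intro nn_integral_cong_AE eventually_mono[OF bf]) simp
  show ?thesis
    unfolding has_laplace_exponent_def P
  proof (intro conjI ballI)
    show "prob_space (restrict_space Q boundedly_finite)"
    proof (rule prob_spaceI)
      have "emeasure (restrict_space Q boundedly_finite) (space (restrict_space Q boundedly_finite))
          = (\<integral>\<^sup>+\<mu>. 1 \<partial>restrict_space Q boundedly_finite)"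
        unfolding nn_integral_const by (simp only: mult_1)
      also have "\<dots> = (\<integral>\<^sup>+\<mu>. 1 \<partial>Q)" by (rule restr)
      also have "\<dots> = 1" by (simp add: Q.emeasure_space_1)
      finally show "emeasure (restrict_space Q boundedly_finite) (space (restrict_space Q boundedly_finite)) = 1" .
    qed
    show "sets (restrict_space Q boundedly_finite) = sets boundedly_finite_algebra"
      unfolding boundedly_finite_algebra_def by (rule sets_restrict_space_cong) (rule sQ)
    show "(\<integral>\<^sup>+\<mu>. exp_neg (\<integral>\<^sup>+y. g y \<partial>\<mu>) \<partial>restrict_space Q boundedly_finite) = exp_neg (laplace_exponent h \<rho> \<eta> g)"
      if "g \<in> borel_measurable borel" for g
      using lap[OF that] by (simp add: restr E_def)
  qed
qed

section \<open>Tilting\<close>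

text \<open>\<open>tilted\<close> uses the real value of f(y), which represents f(y) only where it
  is finite. Rewriting the density through \<open>exp_neg\<close> brings it into the form that
  occurs in the Laplace exponent.\<close>

lemma nn_integral_tilted:
  assumes "h \<in> borel_measurable borel" "sets (\<rho> y) = sets borel" "f y < \<infinity>" "\<And>s. 0 < h s"
    and "g \<in> borel_measurable borel"
  shows "(\<integral>\<^sup>+s. g s \<partial>tilted f h \<rho> y) = (\<integral>\<^sup>+s. exp_neg (f y * ennreal (h s)) * g s \<partial>\<rho> y)"
proof -
  have "ennreal (exp (- (enn2real (f y) * h s))) = exp_neg (f y * ennreal (h s))" for s
  proof -
    have "f y * ennreal (h s) = ennreal (enn2real (f y) * h s)"
      using assms(3) assms(4)[of s] by (simp add: ennreal_mult)
    then show ?thesis using assms(4)[of s] by (simp add: exp_neg_ennreal)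
  qed
  moreover have "h \<in> borel_measurable (\<rho> y)" "g \<in> borel_measurable (\<rho> y)"
    using assms(1,5) by (simp_all add: measurable_cong_sets[OF assms(2) refl])
  ultimately show ?thesis
    unfolding tilted_def by (simp add: nn_integral_density)
qed

lemma kappa_tilted:
  assumes "h \<in> borel_measurable borel" "sets (\<rho> y) = sets borel" "f y < \<infinity>" "\<And>s. 0 < h s"
  shows "kappa h m (tilted f h \<rho>) y = (\<integral>\<^sup>+s. exp_neg (f y * ennreal (h s)) * ennreal (h s ^ m) \<partial>\<rho> y)"
proof -
  have "(\<lambda>s. ennreal (h s ^ m)) \<in> borel_measurable borel" using assms(1) by measurable
  then show ?thesis unfolding kappa_def by (rule nn_integral_tilted[where h=h and f=f and \<rho>=\<rho> and y=y, OF assms])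
qed

lemma emeasure_le_nn_integral:
  assumes "A \<in> sets M" "\<And>x. x \<in> A \<Longrightarrow> 1 \<le> g x"
  shows "emeasure M A \<le> (\<integral>\<^sup>+x. g x \<partial>M)"
proof -
  have "emeasure M A = (\<integral>\<^sup>+x. indicator A x \<partial>M)" using assms(1) by simp
  also have "\<dots> \<le> (\<integral>\<^sup>+x. g x \<partial>M)"
    using assms(2) by (intro nn_integral_mono) (auto simp: indicator_def)
  finally show ?thesis .
qed

text \<open>A finite first cumulant bounds the mass of sets on which its integrand stays away from
  0. For \<rho> itself the integrand is exp (-f h) h, and the sets depend on an upper bound q for
  f(y); this is the reason for cutting the parameter space into sublevel sets of f. For the tilted
  kernel the integrand is h alone, and the same sets serve for all y.\<close>

lemma s_finite_kernel_of_tilted: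
  fixes h :: "'s::polish_space \<Rightarrow> real" and \<rho> :: "'y::polish_space \<Rightarrow> 's measure"
  assumes \<rho>: "measurable_kernel borel borel \<rho>"
    and h: "h \<in> borel_measurable borel" "\<And>s. 0 < h s"
    and f: "f \<in> borel_measurable borel" "\<And>v. f v < \<infinity>"
    and kappa: "\<And>y. kappa h 1 (tilted f h \<rho>) y < \<infinity>"
  shows "s_finite_kernel borel borel \<rho>" "s_finite_kernel borel borel (tilted f h \<rho>)"
proof -
  note [measurable] = h(1) f(1)
  have s: "sets (\<rho> y) = sets borel" for y using \<rho> by (simp add: measurable_kernel_def)
  have k1: "(\<integral>\<^sup>+s. exp_neg (f y * ennreal (h s)) * ennreal (h s) \<partial>\<rho> y) < \<infinity>" for y
    using kappa[of y] kappa_tilted[where m=1 and h=h and \<rho>=\<rho> and f=f, OF h(1) s f(2) h(2)] by simp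
  \<comment> \<open>For f(y) < q the function exp (-f(y) h) h is at least exp (-q h) h, hence at
    least 1 / (i + 1) on \<open>C q i\<close>. By Markov's inequality the mass of this set is at
    most i + 1 times the first tilted cumulant.\<close>
  define C where "C q i = {s. 1 \<le> of_nat (Suc i) * (exp_neg (of_nat q * ennreal (h s)) * ennreal (h s))}" for q i :: nat
  show \<rho>s: "s_finite_kernel borel borel \<rho>"
  proof (rule s_finite_kernelI[where E="\<lambda>q. {y. f y < of_nat q}" and C=C])
    show "sets (\<rho> y) = sets borel" for y by (rule s)
    show "(\<lambda>y. emeasure (\<rho> y) A) \<in> borel_measurable borel" if "A \<in> sets borel" for A
      using \<rho> that by (simp add: measurable_kernel_def)
    show "{y. f y < of_nat q} \<in> sets borel" for q by measurable
    show "C q i \<in> sets borel" for q i unfolding C_def by measurable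
    show "space borel \<subseteq> (\<Union>q. {y. f y < of_nat q})"
      using ennreal_Ex_less_of_nat[OF f(2)[unfolded infinity_ennreal_def]] by auto
    show "space borel \<subseteq> (\<Union>i. C q i)" for q
    proof
      fix s :: 's
      have "exp_neg (of_nat q * ennreal (h s)) * ennreal (h s) = ennreal (exp (- (real q * h s)) * h s)"
        using h(2)[of s]
        by (simp add: ennreal_of_nat_eq_real_of_nat exp_neg_ennreal flip: ennreal_mult)
      moreover obtain i where "1 < real i * (exp (- (real q * h s)) * h s)"
        using reals_Archimedean3[of "exp (- (real q * h s)) * h s"] h(2)[of s] by auto
      moreover have "real i * (exp (- (real q * h s)) * h s) \<le> real (Suc i) * (exp (- (real q * h s)) * h s)"
        using h(2)[of s] by (intro mult_right_mono) auto
      moreover from calculation(2,3) have "1 \<le> real (Suc i) * (exp (- (real q * h s)) * h s)" by linarith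
      ultimately have "s \<in> C q i"
        using h(2)[of s] unfolding C_def mem_Collect_eq ennreal_of_nat_eq_real_of_nat
        by (simp add: ennreal_ge_1 del: of_nat_Suc flip: ennreal_mult)
      then show "s \<in> (\<Union>i. C q i)" by auto
    qed
    show "emeasure (\<rho> y) (C q i) < \<infinity>" if y: "y \<in> {y. f y < of_nat q}" for y q i
    proof -
      have "emeasure (\<rho> y) (C q i) \<le> (\<integral>\<^sup>+s. of_nat (Suc i) * (exp_neg (f y * ennreal (h s)) * ennreal (h s)) \<partial>\<rho> y)"
      proof (rule emeasure_le_nn_integral)
        show "C q i \<in> sets (\<rho> y)" unfolding s C_def by measurable
        fix x assume "x \<in> C q i"
        then have "1 \<le> of_nat (Suc i) * (exp_neg (of_nat q * ennreal (h x)) * ennreal (h x))" by (simp add: C_def)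
        also have "\<dots> \<le> of_nat (Suc i) * (exp_neg (f y * ennreal (h x)) * ennreal (h x))"
          using y by (intro mult_left_mono mult_right_mono) (auto simp: exp_neg_le_iff intro!: mult_right_mono)
        finally show "1 \<le> of_nat (Suc i) * (exp_neg (f y * ennreal (h x)) * ennreal (h x))" .
      qed
      also have "\<dots> = of_nat (Suc i) * (\<integral>\<^sup>+s. exp_neg (f y * ennreal (h s)) * ennreal (h s) \<partial>\<rho> y)"
        by (rule nn_integral_cmult) (simp add: measurable_cong_sets[OF s refl])
      also have "\<dots> < \<infinity>" using k1 by (simp add: ennreal_mult_less_top of_nat_less_top del: of_nat_Suc)
      finally show ?thesis .
    qed
  qed simp
  have s': "sets (tilted f h \<rho> y) = sets borel" for y by (simp add: tilted_def s)
  define D where "D i = {s. 1 \<le> of_nat (Suc i) * ennreal (h s)}" for i :: nat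
  show "s_finite_kernel borel borel (tilted f h \<rho>)"
  proof (rule s_finite_kernelI[where E="\<lambda>_. UNIV" and C="\<lambda>_. D"])
    show "sets (tilted f h \<rho> y) = sets borel" for y by (rule s')
    show "(\<lambda>y. emeasure (tilted f h \<rho> y) A) \<in> borel_measurable borel" if [measurable]: "A \<in> sets borel" for A
    proof -
      have "(\<lambda>y. \<integral>\<^sup>+s. exp_neg (f y * ennreal (h s)) * indicator A s \<partial>\<rho> y) \<in> borel_measurable borel"
        by (rule s_finite_kernel_nn_integral[OF \<rho>s]) measurable
      moreover have "emeasure (tilted f h \<rho> y) A = (\<integral>\<^sup>+s. exp_neg (f y * ennreal (h s)) * indicator A s \<partial>\<rho> y)" for y
        using nn_integral_tilted[where g="indicator A" and h=h and \<rho>=\<rho> and f=f, OF h(1) s f(2) h(2)] that by (simp add: s')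
      ultimately show ?thesis by simp
    qed
    show "D i \<in> sets borel" for i unfolding D_def by measurable
    show "space borel \<subseteq> (\<Union>i. D i)"
    proof
      fix s :: 's
      obtain i where "1 < real i * h s" using reals_Archimedean3[of "h s"] h(2)[of s] by auto
      moreover have "real i * h s \<le> real (Suc i) * h s" using h(2)[of s] by (intro mult_right_mono) auto
      moreover from calculation have "1 \<le> real (Suc i) * h s" by linarith
      ultimately have "s \<in> D i"
        using h(2)[of s] unfolding D_def mem_Collect_eq ennreal_of_nat_eq_real_of_nat
        by (simp add: ennreal_ge_1 del: of_nat_Suc flip: ennreal_mult)
      then show "s \<in> (\<Union>i. D i)" by auto
    qed
    show "emeasure (tilted f h \<rho> y) (D i) < \<infinity>" for y i
    proof -
      have "emeasure (tilted f h \<rho> y) (D i) \<le> (\<integral>\<^sup>+s. of_nat (Suc i) * ennreal (h s) \<partial>tilted f h \<rho> y)"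
        by (rule emeasure_le_nn_integral) (auto simp: s' D_def)
      also have "\<dots> = of_nat (Suc i) * kappa h 1 (tilted f h \<rho>) y"
        unfolding kappa_def power_one_right
        by (rule nn_integral_cmult) (simp add: measurable_cong_sets[OF s' refl])
      also have "\<dots> < \<infinity>" using kappa by (simp add: ennreal_mult_less_top of_nat_less_top del: of_nat_Suc)
      finally show ?thesis .
    qed
  qed simp_all
qed

text \<open>The integrated form of \<open>one_minus_exp_neg_add\<close>: the factor exp (-f(y) h(s))
  in front of its second summand is the tilting density. All terms are nonnegative, so infinite
  exponents are allowed.\<close>

lemma laplace_exponent_tilted:
  fixes h :: "'s::polish_space \<Rightarrow> real" and \<rho> :: "'y::polish_space \<Rightarrow> 's measure"
  assumes \<eta>: "sets \<eta> = sets borel" and \<rho>: "s_finite_kernel borel borel \<rho>"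
    and h: "h \<in> borel_measurable borel" "\<And>s. 0 < h s"
    and f: "f \<in> borel_measurable borel" "\<And>v. f v < \<infinity>"
    and g: "g \<in> borel_measurable borel"
  shows "laplace_exponent h \<rho> \<eta> (\<lambda>y. f y + g y) =
    laplace_exponent h \<rho> \<eta> f + laplace_exponent h (tilted f h \<rho>) \<eta> g"
proof -
  note [measurable] = h(1) f(1) g
  have s: "sets (\<rho> y) = sets borel" for y using s_finite_kernel_sets[OF \<rho>] by simp
  have m: "(\<lambda>y. \<integral>\<^sup>+s. G y s \<partial>\<rho> y) \<in> borel_measurable \<eta>"
    if [measurable]: "(\<lambda>(y, s). G y s) \<in> borel_measurable (borel \<Otimes>\<^sub>M borel)" for G
    unfolding measurable_cong_sets[OF \<eta> refl] by (rule s_finite_kernel_nn_integral[OF \<rho>]) measurable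
  have "laplace_exponent h \<rho> \<eta> (\<lambda>y. f y + g y) =
      (\<integral>\<^sup>+y. (\<integral>\<^sup>+s. 1 - exp_neg (f y * ennreal (h s)) \<partial>\<rho> y) +
             (\<integral>\<^sup>+s. exp_neg (f y * ennreal (h s)) * (1 - exp_neg (g y * ennreal (h s))) \<partial>\<rho> y) \<partial>\<eta>)"
    unfolding laplace_exponent_def distrib_right one_minus_exp_neg_add
    by (intro nn_integral_cong nn_integral_add) (simp_all add: measurable_cong_sets[OF s refl])
  also have "\<dots> = laplace_exponent h \<rho> \<eta> f +
      (\<integral>\<^sup>+y. (\<integral>\<^sup>+s. exp_neg (f y * ennreal (h s)) * (1 - exp_neg (g y * ennreal (h s))) \<partial>\<rho> y) \<partial>\<eta>)"
    unfolding laplace_exponent_def by (intro nn_integral_add m) measurable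
  also have "(\<integral>\<^sup>+y. (\<integral>\<^sup>+s. exp_neg (f y * ennreal (h s)) * (1 - exp_neg (g y * ennreal (h s))) \<partial>\<rho> y) \<partial>\<eta>)
      = laplace_exponent h (tilted f h \<rho>) \<eta> g"
    unfolding laplace_exponent_def
    by (intro nn_integral_cong nn_integral_tilted[where h=h and \<rho>=\<rho> and f=f, OF h(1) s f(2) h(2), symmetric]) measurable
  finally show ?thesis .
qed

lemma has_laplace_exponent_sets: "has_laplace_exponent P \<Lambda> \<Longrightarrow> sets P = sets boundedly_finite_algebra"
  and has_laplace_exponent_prob: "has_laplace_exponent P \<Lambda> \<Longrightarrow> prob_space P"
  and has_laplace_exponentD: "has_laplace_exponent P \<Lambda> \<Longrightarrow> g \<in> borel_measurable borel \<Longrightarrow>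
     (\<integral>\<^sup>+\<mu>. exp_neg (\<integral>\<^sup>+y. g y \<partial>\<mu>) \<partial>P) = exp_neg (\<Lambda> g)"
  by (auto simp: has_laplace_exponent_def)

lemma has_laplace_exponent_space: "has_laplace_exponent P \<Lambda> \<Longrightarrow> space P = boundedly_finite"
  using sets_eq_imp_space_eq[OF has_laplace_exponent_sets, of P \<Lambda>] by simp

lemma exp_neg_nn_integral_measurable_bfa [measurable]:
  "g \<in> borel_measurable borel \<Longrightarrow>
    (\<lambda>\<mu>. exp_neg (\<integral>\<^sup>+y. g y \<partial>\<mu>)) \<in> borel_measurable boundedly_finite_algebra"
  by (rule measurable_compose[OF nn_integral_measurable_bfa exp_neg_measurable])

text \<open>The measure with density exp (-\<mu>(f)) against \<open>P\<close> and the scaled law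
  \<open>P'\<close> have the same Laplace functional, by additivity of the exponent. If the exponent
  of f is infinite, both are the zero measure.\<close>

lemma nn_integral_exponential_tilting:
  fixes P P' :: "'y::polish_space measure measure"
  assumes P: "has_laplace_exponent P \<Lambda>" and P': "has_laplace_exponent P' \<Lambda>'"
    and add: "\<And>g. g \<in> borel_measurable borel \<Longrightarrow> \<Lambda> (\<lambda>y. f y + g y) = \<Lambda> f + \<Lambda>' g"
    and f: "f \<in> borel_measurable borel"
    and F: "F \<in> borel_measurable boundedly_finite_algebra"
  shows "(\<integral>\<^sup>+\<mu>. exp_neg (\<integral>\<^sup>+y. f y \<partial>\<mu>) * F \<mu> \<partial>P) = exp_neg (\<Lambda> f) * (\<integral>\<^sup>+\<mu>. F \<mu> \<partial>P')"
proof -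
  let ?w = "\<lambda>\<mu>. exp_neg (\<integral>\<^sup>+y. f y \<partial>\<mu>)"
  note sP = has_laplace_exponent_sets[OF P] and sP' = has_laplace_exponent_sets[OF P']
  interpret P: prob_space P using P by (rule has_laplace_exponent_prob)
  interpret P': prob_space P' using P' by (rule has_laplace_exponent_prob)
  have w: "?w \<in> borel_measurable P"
    unfolding measurable_cong_sets[OF sP refl] by (rule exp_neg_nn_integral_measurable_bfa[OF f])
  have "density P ?w = scale_measure (exp_neg (\<Lambda> f)) P'"
  proof (rule boundedly_finite_measure_eq_laplace)
    have "emeasure (density P ?w) (space (density P ?w)) = (\<integral>\<^sup>+\<mu>. ?w \<mu> \<partial>P)"
      unfolding space_density using w by (subst emeasure_density) (auto intro!: nn_integral_cong)
    also have "\<dots> = exp_neg (\<Lambda> f)" by (rule has_laplace_exponentD[OF P f])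
    finally show "finite_measure (density P ?w)" by (intro finite_measureI) simp
    show "finite_measure (scale_measure (exp_neg (\<Lambda> f)) P')"
      by (intro finite_measureI) (simp add: P'.emeasure_space_1 space_scale_measure)
    show "sets (density P ?w) = sets boundedly_finite_algebra" by (simp add: sP)
    show "sets (scale_measure (exp_neg (\<Lambda> f)) P') = sets boundedly_finite_algebra" by (simp add: sP')
    fix g :: "'y \<Rightarrow> ennreal" assume g: "g \<in> borel_measurable borel"
    let ?e = "\<lambda>\<mu>. exp_neg (\<integral>\<^sup>+y. g y \<partial>\<mu>)"
    have e: "?e \<in> borel_measurable P" "?e \<in> borel_measurable P'"
      unfolding measurable_cong_sets[OF sP refl] measurable_cong_sets[OF sP' refl]
      by (rule exp_neg_nn_integral_measurable_bfa[OF g])+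
    have "(\<integral>\<^sup>+\<mu>. ?e \<mu> \<partial>density P ?w) = (\<integral>\<^sup>+\<mu>. ?w \<mu> * ?e \<mu> \<partial>P)"
      by (rule nn_integral_density[OF w e(1)])
    also have "\<dots> = (\<integral>\<^sup>+\<mu>. exp_neg (\<integral>\<^sup>+y. f y + g y \<partial>\<mu>) \<partial>P)"
    proof (intro nn_integral_cong)
      fix \<mu> assume "\<mu> \<in> space P"
      then have s: "sets \<mu> = sets borel"
        using has_laplace_exponent_space[OF P] boundedly_finite_sets by auto
      show "?w \<mu> * ?e \<mu> = exp_neg (\<integral>\<^sup>+y. f y + g y \<partial>\<mu>)"
        using f g by (subst nn_integral_add) (simp_all add: measurable_cong_sets[OF s refl] exp_neg_add)
    qed
    also have "\<dots> = exp_neg (\<Lambda> f + \<Lambda>' g)"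
      using f g has_laplace_exponentD[OF P, of "\<lambda>y. f y + g y"] by (simp add: add)
    also have "\<dots> = (\<integral>\<^sup>+\<mu>. ?e \<mu> \<partial>scale_measure (exp_neg (\<Lambda> f)) P')"
      using has_laplace_exponentD[OF P' g] e(2) by (simp add: exp_neg_add nn_integral_scale_measure)
    finally show "(\<integral>\<^sup>+\<mu>. ?e \<mu> \<partial>density P ?w) = (\<integral>\<^sup>+\<mu>. ?e \<mu> \<partial>scale_measure (exp_neg (\<Lambda> f)) P')" .
  qed
  moreover have "F \<in> borel_measurable P" "F \<in> borel_measurable P'"
    unfolding measurable_cong_sets[OF sP refl] measurable_cong_sets[OF sP' refl] by (rule F)+
  ultimately show ?thesis
    using nn_integral_density[OF w, of F] by (simp add: nn_integral_scale_measure)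
qed

section \<open>Adding atoms to a measure\<close>

text \<open>The shape of \<open>add_jumps\<close>, but with arbitrary index set, weights and
  locations, so that \<open>add_jumps\<close> and the single point of the Mecke formula are both
  instances.\<close>

definition add_atoms :: "'i set \<Rightarrow> ('i \<Rightarrow> ennreal) \<Rightarrow> ('i \<Rightarrow> 'y::polish_space) \<Rightarrow> 'y measure \<Rightarrow> 'y measure" where
  "add_atoms I w v \<mu> =
     measure_of UNIV (sets borel) (\<lambda>B. emeasure \<mu> B + (\<Sum>i\<in>I. w i * indicator B (v i)))"

lemma sets_add_atoms [simp]: "sets (add_atoms I w v \<mu>) = sets borel"
  unfolding add_atoms_def using sets.sets_measure_of_eq[of borel] by simp

lemma SUP_add_sum_ennreal:
  fixes a :: "nat \<Rightarrow> ennreal" and b :: "'i \<Rightarrow> nat \<Rightarrow> ennreal"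
  assumes "incseq a" "\<And>i. i \<in> I \<Longrightarrow> incseq (b i)"
  shows "(SUP n. a n + (\<Sum>i\<in>I. b i n)) = (SUP n. a n) + (\<Sum>i\<in>I. SUP n. b i n)"
proof -
  have "incseq (\<lambda>n. \<Sum>i\<in>I. b i n)"
    using assms(2) by (auto simp: incseq_def intro!: sum_mono)
  then show ?thesis
    using assms by (simp add: ennreal_SUP_add ennreal_SUP_sum)
qed

lemma
  fixes \<mu> :: "'y::polish_space measure"
  assumes \<mu>: "sets \<mu> = sets borel" and I: "finite I"
  shows emeasure_add_atoms: "B \<in> sets borel \<Longrightarrow>
      emeasure (add_atoms I w v \<mu>) B = emeasure \<mu> B + (\<Sum>i\<in>I. w i * indicator B (v i))"
    and nn_integral_add_atoms: "g \<in> borel_measurable borel \<Longrightarrow>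
      (\<integral>\<^sup>+y. g y \<partial>add_atoms I w v \<mu>) = (\<integral>\<^sup>+y. g y \<partial>\<mu>) + (\<Sum>i\<in>I. w i * g (v i))"
proof -
  let ?\<Phi> = "\<lambda>g. (\<integral>\<^sup>+y. g y \<partial>\<mu>) + (\<Sum>i\<in>I. w i * g (v i))"
  have sp: "space \<mu> = UNIV" using sets_eq_imp_space_eq[OF \<mu>] by simp
  interpret positive_functional borel ?\<Phi>
  proof
    show "?\<Phi> f = ?\<Phi> g" if "\<And>x. x \<in> space borel \<Longrightarrow> f x = g x" for f g
      using that by simp
    show "?\<Phi> (\<lambda>x. f x + g x) = ?\<Phi> f + ?\<Phi> g" if "f \<in> borel_measurable borel" "g \<in> borel_measurable borel" for f g
      using that
      by (simp add: nn_integral_add measurable_cong_sets[OF \<mu> refl] distrib_left sum.distrib add_ac)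
    show "?\<Phi> (\<lambda>x. c * f x) = c * ?\<Phi> f" if "f \<in> borel_measurable borel" for f c
      using that
      by (simp add: nn_integral_cmult measurable_cong_sets[OF \<mu> refl] distrib_left sum_distrib_left mult_ac)
    fix F :: "nat \<Rightarrow> 'y \<Rightarrow> ennreal" assume F: "\<And>i. F i \<in> borel_measurable borel" and inc: "incseq F"
    have mono: "F i x \<le> F j x" if "i \<le> j" for i j x using inc that by (auto simp: incseq_def le_fun_def)
    have "(\<integral>\<^sup>+y. (SUP n. F n y) \<partial>\<mu>) = (SUP n. \<integral>\<^sup>+y. F n y \<partial>\<mu>)"
      using F by (intro nn_integral_monotone_convergence_SUP inc) (simp add: measurable_cong_sets[OF \<mu> refl])
    moreover have "(\<Sum>i\<in>I. w i * (SUP n. F n (v i))) = (\<Sum>i\<in>I. SUP n. w i * F n (v i))"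
      by (simp add: SUP_mult_left_ennreal)
    ultimately show "?\<Phi> (\<lambda>x. SUP i. F i x) = (SUP i. ?\<Phi> (F i))"
      by (subst SUP_add_sum_ennreal) (auto simp: incseq_def intro!: nn_integral_mono mult_left_mono mono)
  qed
  have "functional_measure = add_atoms I w v \<mu>"
    unfolding functional_measure_def add_atoms_def space_borel
  proof (rule measure_of_eq)
    fix B :: "'y set" assume "B \<in> sigma_sets UNIV (sets borel)"
    then have B: "B \<in> sets borel" using sets.sigma_sets_eq[of "borel :: 'y measure"] by simp
    then show "?\<Phi> (indicator B) = emeasure \<mu> B + (\<Sum>i\<in>I. w i * indicator B (v i))"
      by (simp add: \<mu>)
  qed simp
  then show "emeasure (add_atoms I w v \<mu>) B = emeasure \<mu> B + (\<Sum>i\<in>I. w i * indicator B (v i))"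
    if "B \<in> sets borel"
    using emeasure_functional_measure[OF that] that by (simp add: \<mu>)
  show "(\<integral>\<^sup>+y. g y \<partial>add_atoms I w v \<mu>) = (\<integral>\<^sup>+y. g y \<partial>\<mu>) + (\<Sum>i\<in>I. w i * g (v i))"
    if "g \<in> borel_measurable borel"
    using nn_integral_functional_measure[OF that] \<open>functional_measure = add_atoms I w v \<mu>\<close> by simp
qed

lemma add_atoms_boundedly_finite:
  fixes \<mu> :: "'y::polish_space measure"
  assumes \<mu>: "\<mu> \<in> boundedly_finite" and I: "finite I" and w: "\<And>i. i \<in> I \<Longrightarrow> w i < \<infinity>"
  shows "add_atoms I w v \<mu> \<in> boundedly_finite"
  unfolding boundedly_finite_def
proof (intro CollectI conjI ballI impI)
  fix B :: "'y set" assume B: "B \<in> sets borel" "bounded B"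
  have "emeasure \<mu> B < \<infinity>" using \<mu> B by (simp add: boundedly_finite_def)
  moreover have "(\<Sum>i\<in>I. w i * indicator B (v i)) < \<infinity>"
    using w I by (auto simp: indicator_def less_top[symmetric] ennreal_sum_less_top)
  ultimately show "emeasure (add_atoms I w v \<mu>) B < \<infinity>"
    using emeasure_add_atoms[OF boundedly_finite_sets[OF \<mu>] I B(1)] by simp
qed simp

lemma measurable_add_atoms [measurable (raw)]:
  fixes m :: "'a \<Rightarrow> 'y::polish_space measure"
  assumes I: "finite I" and m: "m \<in> M \<rightarrow>\<^sub>M boundedly_finite_algebra"
    and w: "\<And>i. i \<in> I \<Longrightarrow> w i \<in> borel_measurable M" "\<And>i x. x \<in> space M \<Longrightarrow> i \<in> I \<Longrightarrow> w i x < \<infinity>"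
    and v: "\<And>i. i \<in> I \<Longrightarrow> v i \<in> borel_measurable M"
  shows "(\<lambda>x. add_atoms I (\<lambda>i. w i x) (\<lambda>i. v i x) (m x)) \<in> M \<rightarrow>\<^sub>M boundedly_finite_algebra"
proof (rule measurable_boundedly_finite_algebraI)
  have bf: "m x \<in> boundedly_finite" if "x \<in> space M" for x
    using measurable_space[OF m that] by simp
  show "add_atoms I (\<lambda>i. w i x) (\<lambda>i. v i x) (m x) \<in> boundedly_finite" if "x \<in> space M" for x
    using that by (intro add_atoms_boundedly_finite bf I w(2))
  fix A :: "'y set" assume A [measurable]: "A \<in> sets borel"
  have "(\<lambda>x. emeasure (m x) A) \<in> borel_measurable M"
    by (rule measurable_compose[OF m emeasure_measurable_bfa[OF A]])
  moreover have "(\<lambda>x. \<Sum>i\<in>I. w i x * indicator A (v i x)) \<in> borel_measurable M"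
    by (intro borel_measurable_sum borel_measurable_times_ennreal w(1) measurable_compose[OF v] borel_measurable_indicator) auto
  ultimately have "(\<lambda>x. emeasure (m x) A + (\<Sum>i\<in>I. w i x * indicator A (v i x))) \<in> borel_measurable M"
    by (rule borel_measurable_add)
  moreover have "emeasure (add_atoms I (\<lambda>i. w i x) (\<lambda>i. v i x) (m x)) A
      = emeasure (m x) A + (\<Sum>i\<in>I. w i x * indicator A (v i x))" if "x \<in> space M" for x
    using emeasure_add_atoms[OF boundedly_finite_sets[OF bf[OF that]] I A] .
  ultimately show "(\<lambda>x. emeasure (add_atoms I (\<lambda>i. w i x) (\<lambda>i. v i x) (m x)) A) \<in> borel_measurable M"
    by (simp cong: measurable_cong)
qed

text \<open>The atom split off is carried by a one-element family with an arbitrary label u; the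
  Mecke formula produces it with the label \<open>()\<close>.\<close>

lemma add_atoms_insert:
  assumes "sets \<mu> = sets borel" "finite I" "i \<notin> I"
  shows "add_atoms (insert i I) w v \<mu> = add_atoms I w v (add_atoms {u} (\<lambda>_. w i) (\<lambda>_. v i) \<mu>)"
  using assms
  by (intro measure_eqI) (simp_all add: emeasure_add_atoms add_ac del: sum_mult_indicator)

text \<open>The slope increases both in k and in its argument, so the double supremum equals the one
  along the diagonal. It is needed because the perturbed exponent varies with the step as
  well.\<close>

lemma dyadic_slope_SUP_diagonal:
  assumes "incseq a"
  shows "(SUP k. dyadic_slope k (a k)) = (SUP k. a k)"
proof (rule antisym)
  have "dyadic_slope k x \<le> x" for k x
    using dyadic_slope_SUP[of x] by (metis SUP_upper UNIV_I)
  then show "(SUP k. dyadic_slope k (a k)) \<le> (SUP k. a k)"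
    by (intro SUP_mono) auto
  show "(SUP k. a k) \<le> (SUP k. dyadic_slope k (a k))"
  proof (rule SUP_least)
    fix j
    have "a j = (SUP k. dyadic_slope k (a j))" by (simp add: dyadic_slope_SUP)
    also have "\<dots> \<le> (SUP k. dyadic_slope k (a k))"
    proof (rule SUP_least)
      fix k
      have "dyadic_slope k (a j) \<le> dyadic_slope (max j k) (a j)"
        using incseq_dyadic_slope[of "a j"] by (auto simp: incseq_def)
      also have "\<dots> \<le> dyadic_slope (max j k) (a (max j k))"
        using assms by (intro dyadic_slope_mono) (auto simp: incseq_def)
      also have "\<dots> \<le> (SUP k. dyadic_slope k (a k))" by (rule SUP_upper) simp
      finally show "dyadic_slope k (a j) \<le> (SUP k. dyadic_slope k (a k))" .
    qed
    finally show "a j \<le> (SUP k. dyadic_slope k (a k))" .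
  qed
qed

section \<open>The Mecke formula\<close>

text \<open>For the posterior this is instantiated with the tilted kernel and its law, so \<rho> and
  \<open>P\<close> then stand for tilted objects. Cumulants are assumed finite from order 1 on only:
  order 0 is the total mass of the jump measure, which may be infinite.\<close>

locale crm =
  fixes h :: "'s::polish_space \<Rightarrow> real" and \<rho> :: "'y::polish_space \<Rightarrow> 's measure"
    and \<eta> :: "'y measure" and P :: "'y measure measure"
  assumes \<eta>: "sets \<eta> = sets borel" and \<eta>_sigma_finite: "sigma_finite_measure \<eta>"
    and \<rho>: "s_finite_kernel borel borel \<rho>"
    and h [measurable]: "h \<in> borel_measurable borel" and h_pos: "\<And>s. 0 < h s"
    and kappa_finite: "\<And>m y. 1 \<le> m \<Longrightarrow> kappa h m \<rho> y < \<infinity>"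
    and law: "has_laplace_exponent P (laplace_exponent h \<rho> \<eta>)"
begin

abbreviation "bfa \<equiv> (boundedly_finite_algebra :: 'y measure measure)"

sublocale P: prob_space P using law by (rule has_laplace_exponent_prob)

lemma sets_P: "sets P = sets bfa" using law by (rule has_laplace_exponent_sets)

lemma space_P: "space P = boundedly_finite" using law by (rule has_laplace_exponent_space)

lemma measurable_P: "borel_measurable P = borel_measurable bfa"
  by (rule measurable_cong_sets[OF sets_P refl])

lemma sets_\<rho>: "sets (\<rho> y) = sets borel"
  using s_finite_kernel_sets[OF \<rho>] by simp

lemma \<rho>\<eta>: "s_finite_kernel \<eta> borel \<rho>"
  using s_finite_kernel_compose[OF \<rho> measurable_ident_sets[OF \<eta>]] .

lemma measurable_\<rho>:
  "(\<lambda>(y, s). G y s) \<in> borel_measurable (borel \<Otimes>\<^sub>M borel) \<Longrightarrow>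
    (\<lambda>y. \<integral>\<^sup>+s. G y s \<partial>\<rho> y) \<in> borel_measurable borel"
  by (rule s_finite_kernel_nn_integral[OF \<rho> measurable_ident_sets[OF refl]])

lemma kappa_measurable [measurable]: "kappa h m \<rho> \<in> borel_measurable borel"
  unfolding kappa_def[abs_def] by (rule measurable_\<rho>) measurable

text \<open>The intensity of a point that has been hit m times: each hit contributes one factor
  h(s), the mass of its atom.\<close>

definition \<nu> :: "nat \<Rightarrow> ('s \<times> 'y) measure" where
  "\<nu> m = density (kernel_measure borel \<rho> \<eta>) (\<lambda>z. ennreal (h (fst z) ^ m))"

lemma sets_kernel: "sets (kernel_measure borel \<rho> \<eta>) = sets (borel \<Otimes>\<^sub>M borel)"
  using \<eta> by (simp cong: sets_pair_measure_cong)

lemma sets_\<nu>: "sets (\<nu> m) = sets (borel \<Otimes>\<^sub>M borel)"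
  by (simp add: \<nu>_def sets_kernel del: sets_kernel_measure)

lemma space_\<nu>: "space (\<nu> m) = UNIV"
  using sets_eq_imp_space_eq[OF sets_\<nu>] by (simp add: space_pair_measure)

lemma nn_integral_\<nu>:
  assumes [measurable]: "\<phi> \<in> borel_measurable (borel \<Otimes>\<^sub>M borel)"
  shows "(\<integral>\<^sup>+z. \<phi> z \<partial>\<nu> m) = (\<integral>\<^sup>+y. \<integral>\<^sup>+s. ennreal (h s ^ m) * \<phi> (s, y) \<partial>\<rho> y \<partial>\<eta>)"
proof -
  have m: "(\<lambda>z. ennreal (h (fst z) ^ m)) \<in> borel_measurable (kernel_measure borel \<rho> \<eta>)"
    "\<phi> \<in> borel_measurable (kernel_measure borel \<rho> \<eta>)"
    unfolding measurable_cong_sets[OF sets_kernel refl] by measurable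
  have "(\<integral>\<^sup>+z. \<phi> z \<partial>\<nu> m) = (\<integral>\<^sup>+z. ennreal (h (fst z) ^ m) * \<phi> z \<partial>kernel_measure borel \<rho> \<eta>)"
    unfolding \<nu>_def by (rule nn_integral_density[OF m])
  also have "\<dots> = (\<integral>\<^sup>+y. \<integral>\<^sup>+s. ennreal (h (fst (s, y)) ^ m) * \<phi> (s, y) \<partial>\<rho> y \<partial>\<eta>)"
  proof (rule nn_integral_kernel_measure_s_finite[OF \<rho>\<eta>])
    show "(\<lambda>z. ennreal (h (fst z) ^ m) * \<phi> z) \<in> borel_measurable (borel \<Otimes>\<^sub>M \<eta>)"
      unfolding measurable_cong_sets[OF sets_pair_measure_cong[OF refl \<eta>] refl] by measurable
  qed
  finally show ?thesis by simp
qed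

lemma nn_integral_\<nu>_snd:
  assumes [measurable]: "g \<in> borel_measurable borel"
  shows "(\<integral>\<^sup>+z. g (snd z) \<partial>\<nu> m) = (\<integral>\<^sup>+y. g y * kappa h m \<rho> y \<partial>\<eta>)"
proof -
  have "(\<lambda>z. g (snd z)) \<in> borel_measurable ((borel :: 's measure) \<Otimes>\<^sub>M borel)" by measurable
  from nn_integral_\<nu>[OF this, of m]
  have "(\<integral>\<^sup>+z. g (snd z) \<partial>\<nu> m) = (\<integral>\<^sup>+y. \<integral>\<^sup>+s. g y * ennreal (h s ^ m) \<partial>\<rho> y \<partial>\<eta>)"
    by (simp add: mult.commute)
  also have "\<dots> = (\<integral>\<^sup>+y. g y * kappa h m \<rho> y \<partial>\<eta>)"
    unfolding kappa_def
    by (intro nn_integral_cong nn_integral_cmult) (simp add: measurable_cong_sets[OF sets_\<rho> refl])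
  finally show ?thesis .
qed

lemma nn_integral_\<nu>_Suc:
  assumes [measurable]: "\<phi> \<in> borel_measurable (borel \<Otimes>\<^sub>M borel)"
  shows "(\<integral>\<^sup>+z. ennreal (h (fst z)) * \<phi> z \<partial>\<nu> m) = (\<integral>\<^sup>+z. \<phi> z \<partial>\<nu> (Suc m))"
proof -
  have "ennreal (h s ^ m) * (ennreal (h s) * a) = ennreal (h s ^ Suc m) * a" for s a
    using h_pos[of s] by (simp add: ennreal_mult mult_ac)
  then show ?thesis by (simp add: nn_integral_\<nu>)
qed

text \<open>The projection of \<open>\<nu> m\<close> to y has the cumulant of order m as density
  against \<eta>. Sets of finite \<eta>-measure, cut down to where this cumulant is at most k, have
  finite mass and exhaust the space. Cutting in y alone suits the Mecke formula, where \<mu> is a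
  measure in y.\<close>

lemma \<nu>_exhaustion:
  assumes "1 \<le> m"
  obtains B :: "nat \<Rightarrow> 'y set" where "incseq B" "(\<Union>k. B k) = UNIV" "\<And>k. B k \<in> sets borel"
    "\<And>k. (\<integral>\<^sup>+z. indicator (B k) (snd z) \<partial>\<nu> m) < \<infinity>"
proof -
  interpret sigma_finite_measure \<eta> by (rule \<eta>_sigma_finite)
  obtain F :: "nat \<Rightarrow> 'y set" where F: "range F \<subseteq> sets \<eta>" "(\<Union>k. F k) = space \<eta>"
    "\<And>i. emeasure \<eta> (F i) \<noteq> \<infinity>" "incseq F"
    using sigma_finite_incseq by blast
  have [measurable]: "F k \<in> sets borel" for k using F(1) \<eta> by auto
  define B where "B k = {y\<in>F k. kappa h m \<rho> y \<le> of_nat k}" for k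
  have [measurable]: "B k \<in> sets borel" for k
  proof -
    have "B k = F k \<inter> {y. kappa h m \<rho> y \<le> of_nat k}" by (auto simp: B_def)
    also have "\<dots> \<in> sets borel" by measurable
    finally show ?thesis .
  qed
  show ?thesis
  proof
    show "incseq B"
    proof (rule incseq_SucI)
      fix k show "B k \<le> B (Suc k)"
      proof
        fix y assume y: "y \<in> B k"
        then have "kappa h m \<rho> y \<le> of_nat k" by (simp add: B_def)
        also have "\<dots> \<le> of_nat (Suc k)" by (rule of_nat_mono) simp
        finally show "y \<in> B (Suc k)" using y incseq_SucD[OF F(4), of k] by (auto simp: B_def)
      qed
    qed
    show "(\<Union>k. B k) = UNIV"
    proof (intro equalityI subsetI UNIV_I)
      fix y :: 'y
      have "y \<in> (\<Union>k. F k)" using F(2) sets_eq_imp_space_eq[OF \<eta>] by simp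
      then obtain i where i: "y \<in> F i" by auto
      obtain j :: nat where j: "kappa h m \<rho> y < of_nat j"
        using ennreal_Ex_less_of_nat kappa_finite[OF assms] by (metis infinity_ennreal_def)
      have "y \<in> F (max i j)" using i incseqD[OF F(4), of i "max i j"] by auto
      moreover have "kappa h m \<rho> y \<le> of_nat (max i j)"
        using j by (meson less_imp_le max.cobounded2 of_nat_mono order_trans)
      ultimately have "y \<in> B (max i j)" by (simp add: B_def)
      then show "y \<in> (\<Union>k. B k)" by blast
    qed
    show "B k \<in> sets borel" for k by measurable
    show "(\<integral>\<^sup>+z. indicator (B k) (snd z) \<partial>\<nu> m) < \<infinity>" for k
    proof -
      have "(\<integral>\<^sup>+z. indicator (B k) (snd z) \<partial>\<nu> m) = (\<integral>\<^sup>+y. indicator (B k) y * kappa h m \<rho> y \<partial>\<eta>)"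
        by (rule nn_integral_\<nu>_snd) measurable
      also have "\<dots> \<le> (\<integral>\<^sup>+y. of_nat k * indicator (F k) y \<partial>\<eta>)"
        by (intro nn_integral_mono) (auto simp: B_def indicator_def)
      also have "\<dots> = of_nat k * emeasure \<eta> (F k)"
        using F(1) by (intro nn_integral_cmult_indicator) auto
      also have "\<dots> < \<infinity>" using F(3)[of k] by (simp add: ennreal_mult_less_top of_nat_less_top less_top)
      finally show ?thesis .
    qed
  qed
qed

lemma sigma_finite_\<nu>:
  assumes "1 \<le> m" shows "sigma_finite_measure (\<nu> m)"
proof -
  obtain B :: "nat \<Rightarrow> 'y set" where B: "incseq B" "(\<Union>k. B k) = UNIV" "\<And>k. B k \<in> sets borel"
    "\<And>k. (\<integral>\<^sup>+z. indicator (B k) (snd z) \<partial>\<nu> m) < \<infinity>"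
    using \<nu>_exhaustion[OF assms] by blast
  show ?thesis
  proof
    have s: "UNIV \<times> B k \<in> sets (\<nu> m)" for k
      using B(3) by (simp add: sets_\<nu>)
    have "emeasure (\<nu> m) (UNIV \<times> B k) = (\<integral>\<^sup>+z. indicator (B k) (snd z) \<partial>\<nu> m)" for k
    proof -
      have "emeasure (\<nu> m) (UNIV \<times> B k) = (\<integral>\<^sup>+z. indicator (UNIV \<times> B k) z \<partial>\<nu> m)" using s by simp
      also have "\<dots> = (\<integral>\<^sup>+z. indicator (B k) (snd z) \<partial>\<nu> m)"
        by (intro nn_integral_cong) (simp add: indicator_def mem_Times_iff)
      finally show ?thesis .
    qed
    then have "emeasure (\<nu> m) (UNIV \<times> B k) \<noteq> \<infinity>" for k using B(4)[of k] by simp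
    moreover have "(\<Union>k. UNIV \<times> B k) = space (\<nu> m)" using B(2) by (auto simp: space_\<nu>)
    ultimately show "\<exists>A. countable A \<and> A \<subseteq> sets (\<nu> m) \<and> \<Union> A = space (\<nu> m) \<and> (\<forall>a\<in>A. emeasure (\<nu> m) a \<noteq> \<infinity>)"
      using s by (intro exI[of _ "range (\<lambda>k. UNIV \<times> B k)"]) auto
  qed
qed

text \<open>The derivative at \<open>t = 0\<close> of the Laplace functional at \<open>g + t \<phi>\<close>, taken along the
  monotone dyadic difference quotients.\<close>

lemma mecke_exponential:
  assumes g [measurable]: "g \<in> borel_measurable borel" and \<phi> [measurable]: "\<phi> \<in> borel_measurable borel"
  shows "(\<integral>\<^sup>+\<mu>. exp_neg (\<integral>\<^sup>+y. g y \<partial>\<mu>) * (\<integral>\<^sup>+y. \<phi> y \<partial>\<mu>) \<partial>P) =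
    exp_neg (laplace_exponent h \<rho> \<eta> g) *
      (\<integral>\<^sup>+z. exp_neg (g (snd z) * ennreal (h (fst z))) * \<phi> (snd z) \<partial>\<nu> 1)"
proof -
  let ?\<Lambda> = "laplace_exponent h \<rho> \<eta>"
  define e where "e \<mu> = exp_neg (\<integral>\<^sup>+y. g y \<partial>\<mu>)" for \<mu> :: "'y measure"
  define L where "L \<mu> = (\<integral>\<^sup>+y. \<phi> y \<partial>\<mu>)" for \<mu> :: "'y measure"
  have e: "e \<in> borel_measurable P"
    unfolding measurable_P e_def[abs_def] by (rule exp_neg_nn_integral_measurable_bfa[OF g])
  have L: "L \<in> borel_measurable P"
    unfolding measurable_P L_def[abs_def] by (rule nn_integral_measurable_bfa[OF \<phi>])
  note [measurable] = e L
  define q where "q y s = exp_neg (g y * ennreal (h s))" for y s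
  have [measurable]: "(\<lambda>(y, s). q y s) \<in> borel_measurable (borel \<Otimes>\<^sub>M borel)"
    unfolding q_def by measurable
  \<comment> \<open>The difference quotient of the exponent for the step \<open>1 / 2 ^ k\<close>,
    written with \<open>dyadic_slope\<close> so that no subtraction of possibly infinite exponents
    is involved.\<close>
  define a where "a k = (\<integral>\<^sup>+y. \<integral>\<^sup>+s. q y s * dyadic_slope k (\<phi> y * ennreal (h s)) \<partial>\<rho> y \<partial>\<eta>)" for k
  have split: "?\<Lambda> (\<lambda>y. g y + \<phi> y / 2 ^ k) = ?\<Lambda> g + a k / 2 ^ k" for k
  proof -
    have pt: "1 - exp_neg ((g y + \<phi> y / 2 ^ k) * ennreal (h s)) =
        (1 - exp_neg (g y * ennreal (h s))) + (q y s * dyadic_slope k (\<phi> y * ennreal (h s))) * inverse (2 ^ k)" for y s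
    proof -
      have "dyadic_slope k x * inverse (2 ^ k) = 1 - exp_neg (x / 2 ^ k)" for x
      proof -
        have "(2 :: ennreal) ^ k * inverse (2 ^ k) = 1"
          using ennreal_divide_self[of "2 ^ k"] power_eq_top_ennreal[of 2 k]
          by (simp add: divide_ennreal_def less_top[symmetric])
        then show ?thesis unfolding dyadic_slope_def by (metis mult.assoc mult.commute mult.right_neutral)
      qed
      moreover have "(g y + \<phi> y / 2 ^ k) * ennreal (h s) = g y * ennreal (h s) + (\<phi> y * ennreal (h s)) / 2 ^ k"
        by (simp add: distrib_left divide_ennreal_def mult_ac)
      ultimately show ?thesis by (simp add: one_minus_exp_neg_add q_def mult.assoc)
    qed
    have "?\<Lambda> (\<lambda>y. g y + \<phi> y / 2 ^ k) = (\<integral>\<^sup>+y. (\<integral>\<^sup>+s. 1 - exp_neg (g y * ennreal (h s)) \<partial>\<rho> y)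
       + (\<integral>\<^sup>+s. q y s * dyadic_slope k (\<phi> y * ennreal (h s)) \<partial>\<rho> y) * inverse (2 ^ k) \<partial>\<eta>)"
      unfolding laplace_exponent_def pt
    proof (intro nn_integral_cong)
      fix y
      have [measurable_cong]: "sets (\<rho> y) = sets borel" by (rule sets_\<rho>)
      have "(\<lambda>s. q y s * dyadic_slope k (\<phi> y * ennreal (h s))) \<in> borel_measurable (\<rho> y)" by measurable
      then show "(\<integral>\<^sup>+s. (1 - exp_neg (g y * ennreal (h s))) + (q y s * dyadic_slope k (\<phi> y * ennreal (h s))) * inverse (2 ^ k) \<partial>\<rho> y)
        = (\<integral>\<^sup>+s. 1 - exp_neg (g y * ennreal (h s)) \<partial>\<rho> y) +
          (\<integral>\<^sup>+s. q y s * dyadic_slope k (\<phi> y * ennreal (h s)) \<partial>\<rho> y) * inverse (2 ^ k)"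
        by (subst nn_integral_add) (auto simp: nn_integral_multc)
    qed
    also have "\<dots> = ?\<Lambda> g + a k * inverse (2 ^ k)"
    proof -
      have m: "(\<lambda>y. \<integral>\<^sup>+s. 1 - exp_neg (g y * ennreal (h s)) \<partial>\<rho> y) \<in> borel_measurable \<eta>"
        "(\<lambda>y. \<integral>\<^sup>+s. q y s * dyadic_slope k (\<phi> y * ennreal (h s)) \<partial>\<rho> y) \<in> borel_measurable \<eta>"
        unfolding measurable_cong_sets[OF \<eta> refl] by (rule measurable_\<rho>, measurable)+
      then show ?thesis
        unfolding laplace_exponent_def a_def by (subst nn_integral_add) (simp_all add: nn_integral_multc)
    qed
    finally show ?thesis by (simp add: divide_ennreal_def)
  qed
  \<comment> \<open>The Laplace functionals at g and at g + \<phi> / 2^k are compared on both sides.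
    Subtraction is replaced by cancelling a finite summand, so truncation cannot interfere.\<close>
  have step: "(\<integral>\<^sup>+\<mu>. e \<mu> * dyadic_slope k (L \<mu>) \<partial>P) = exp_neg (?\<Lambda> g) * dyadic_slope k (a k)" for k
  proof -
    define u where "u \<mu> = exp_neg (L \<mu> / 2 ^ k)" for \<mu>
    have u [measurable]: "u \<in> borel_measurable P" unfolding u_def by measurable
    have eu: "(\<integral>\<^sup>+\<mu>. e \<mu> * u \<mu> \<partial>P) = exp_neg (?\<Lambda> g) * exp_neg (a k / 2 ^ k)"
    proof -
      have "(\<integral>\<^sup>+\<mu>. e \<mu> * u \<mu> \<partial>P) = (\<integral>\<^sup>+\<mu>. exp_neg (\<integral>\<^sup>+y. g y + \<phi> y / 2 ^ k \<partial>\<mu>) \<partial>P)"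
      proof (intro nn_integral_cong)
        fix \<mu> assume "\<mu> \<in> space P"
        then have s: "sets \<mu> = sets borel" using space_P boundedly_finite_sets by auto
        show "e \<mu> * u \<mu> = exp_neg (\<integral>\<^sup>+y. g y + \<phi> y / 2 ^ k \<partial>\<mu>)"
          using g \<phi> unfolding e_def u_def L_def
          by (subst nn_integral_add)
             (simp_all add: measurable_cong_sets[OF s refl] exp_neg_add nn_integral_divide)
      qed
      also have "\<dots> = exp_neg (?\<Lambda> (\<lambda>y. g y + \<phi> y / 2 ^ k))"
        by (rule has_laplace_exponentD[OF law]) measurable
      finally show ?thesis by (simp add: split exp_neg_add)
    qed
    have e1: "(\<integral>\<^sup>+\<mu>. e \<mu> \<partial>P) = exp_neg (?\<Lambda> g)"
      unfolding e_def by (rule has_laplace_exponentD[OF law g])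
    have *: "c * (1 - exp_neg x) + c * exp_neg x = c" for c :: ennreal and x
      by (simp add: distrib_left[symmetric] diff_add_cancel_ennreal)
    have "(\<integral>\<^sup>+\<mu>. e \<mu> * (1 - u \<mu>) \<partial>P) + (\<integral>\<^sup>+\<mu>. e \<mu> * u \<mu> \<partial>P) = (\<integral>\<^sup>+\<mu>. e \<mu> * (1 - u \<mu>) + e \<mu> * u \<mu> \<partial>P)"
      by (rule nn_integral_add[symmetric]) measurable
    also have "\<dots> = exp_neg (?\<Lambda> g)" by (simp add: u_def * e1)
    also have "\<dots> = exp_neg (?\<Lambda> g) * (1 - exp_neg (a k / 2 ^ k)) + exp_neg (?\<Lambda> g) * exp_neg (a k / 2 ^ k)"
      by (simp add: *)
    finally have main: "(\<integral>\<^sup>+\<mu>. e \<mu> * (1 - u \<mu>) \<partial>P) = exp_neg (?\<Lambda> g) * (1 - exp_neg (a k / 2 ^ k))"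
      unfolding eu by (simp add: ennreal_mult_eq_top_iff)
    have "(\<integral>\<^sup>+\<mu>. e \<mu> * dyadic_slope k (L \<mu>) \<partial>P) = (\<integral>\<^sup>+\<mu>. 2 ^ k * (e \<mu> * (1 - u \<mu>)) \<partial>P)"
      by (simp add: dyadic_slope_def u_def mult_ac)
    also have "\<dots> = 2 ^ k * (\<integral>\<^sup>+\<mu>. e \<mu> * (1 - u \<mu>) \<partial>P)" by (rule nn_integral_cmult) measurable
    finally show ?thesis by (simp add: main dyadic_slope_def mult_ac)
  qed
  have mono: "dyadic_slope i x \<le> dyadic_slope j x" if "i \<le> j" for i j x
    using incseq_dyadic_slope[of x] that by (auto simp: incseq_def)
  have inc_a: "incseq a"
    unfolding a_def incseq_def by (auto intro!: nn_integral_mono mult_left_mono mono)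
  have "(\<integral>\<^sup>+\<mu>. e \<mu> * L \<mu> \<partial>P) = (\<integral>\<^sup>+\<mu>. (SUP k. e \<mu> * dyadic_slope k (L \<mu>)) \<partial>P)"
    by (simp add: SUP_mult_left_ennreal[symmetric] dyadic_slope_SUP)
  also have "\<dots> = (SUP k. \<integral>\<^sup>+\<mu>. e \<mu> * dyadic_slope k (L \<mu>) \<partial>P)"
    by (intro nn_integral_monotone_convergence_SUP)
       (auto simp: incseq_def le_fun_def intro!: mult_left_mono mono)
  also have "\<dots> = exp_neg (?\<Lambda> g) * (SUP k. a k)"
    by (simp add: step SUP_mult_left_ennreal[symmetric] dyadic_slope_SUP_diagonal[OF inc_a])
  also have "(SUP k. a k) = (\<integral>\<^sup>+y. (SUP k. \<integral>\<^sup>+s. q y s * dyadic_slope k (\<phi> y * ennreal (h s)) \<partial>\<rho> y) \<partial>\<eta>)"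
  proof -
    have "(\<lambda>y. \<integral>\<^sup>+s. q y s * dyadic_slope k (\<phi> y * ennreal (h s)) \<partial>\<rho> y) \<in> borel_measurable \<eta>" for k
      unfolding measurable_cong_sets[OF \<eta> refl] by (rule measurable_\<rho>, measurable)
    then show ?thesis
      unfolding a_def
      by (intro nn_integral_monotone_convergence_SUP[symmetric])
         (auto simp: incseq_def le_fun_def intro!: nn_integral_mono mult_left_mono mono)
  qed
  also have "\<dots> = (\<integral>\<^sup>+y. (\<integral>\<^sup>+s. ennreal (h s ^ 1) * (q y s * \<phi> y) \<partial>\<rho> y) \<partial>\<eta>)"
  proof (intro nn_integral_cong)
    fix y
    have [measurable_cong]: "sets (\<rho> y) = sets borel" by (rule sets_\<rho>)
    have "(SUP k. \<integral>\<^sup>+s. q y s * dyadic_slope k (\<phi> y * ennreal (h s)) \<partial>\<rho> y) =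
        (\<integral>\<^sup>+s. (SUP k. q y s * dyadic_slope k (\<phi> y * ennreal (h s))) \<partial>\<rho> y)"
      by (intro nn_integral_monotone_convergence_SUP[symmetric])
         (auto simp: incseq_def le_fun_def intro!: mult_left_mono mono)
    then show "(SUP k. \<integral>\<^sup>+s. q y s * dyadic_slope k (\<phi> y * ennreal (h s)) \<partial>\<rho> y) =
        (\<integral>\<^sup>+s. ennreal (h s ^ 1) * (q y s * \<phi> y) \<partial>\<rho> y)"
      by (simp add: SUP_mult_left_ennreal[symmetric] dyadic_slope_SUP mult_ac)
  qed
  also have "\<dots> = (\<integral>\<^sup>+z. q (snd z) (fst z) * \<phi> (snd z) \<partial>\<nu> 1)"
    by (subst nn_integral_\<nu>) (simp_all add: q_def)
  finally show ?thesis by (simp add: e_def L_def q_def)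
qed

end

section \<open>Partitions of a set with one more element\<close>

lemma partition_on_part_unique:
  "partition_on A p \<Longrightarrow> C \<in> p \<Longrightarrow> D \<in> p \<Longrightarrow> x \<in> C \<Longrightarrow> x \<in> D \<Longrightarrow> C = D"
  unfolding partition_on_def disjoint_def by blast

lemma partition_on_notin: "partition_on A p \<Longrightarrow> a \<notin> A \<Longrightarrow> D \<in> p \<Longrightarrow> a \<notin> D"
  unfolding partition_on_def by blast

lemma partition_on_part_nonempty: "partition_on A p \<Longrightarrow> C \<in> p \<Longrightarrow> C \<noteq> {}"
  unfolding partition_on_def by blast

lemma partition_on_obtain_part:
  assumes "partition_on A p" "x \<in> A" obtains C where "C \<in> p" "x \<in> C"
  using assms unfolding partition_on_def by blast

lemma partition_onI':
  assumes "\<Union> p = A" "\<And>X Y x. X \<in> p \<Longrightarrow> Y \<in> p \<Longrightarrow> x \<in> X \<Longrightarrow> x \<in> Y \<Longrightarrow> X = Y" "{} \<notin> p"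
  shows "partition_on A p"
  unfolding partition_on_def
proof (intro conjI)
  show "disjoint p" using assms(2) by (intro disjointI) blast
qed (fact assms)+

lemma partition_on_insert_singleton:
  assumes p: "partition_on A p" "a \<notin> A"
  shows "partition_on (insert a A) (insert {a} p)" "{a} \<notin> p"
proof -
  note D = partition_on_notin[OF p]
  show "{a} \<notin> p" using D by blast
  show "partition_on (insert a A) (insert {a} p)"
  proof (rule partition_onI')
    show "\<Union> (insert {a} p) = insert a A" using p(1) by (simp add: partition_on_def)
    show "{} \<notin> insert {a} p" using partition_on_part_nonempty[OF p(1)] by blast
    show "X = Y" if "X \<in> insert {a} p" "Y \<in> insert {a} p" "x \<in> X" "x \<in> Y" for X Y x
      using that D partition_on_part_unique[OF p(1)] by (metis insertE singletonD)
  qed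
qed

lemma partition_on_insert_part:
  assumes p: "partition_on A p" "a \<notin> A" and C: "C \<in> p"
  shows "partition_on (insert a A) (insert (insert a C) (p - {C}))" "insert a C \<notin> p" "{a} \<noteq> insert a C"
proof -
  note D = partition_on_notin[OF p]
  show "insert a C \<notin> p" using D by blast
  show "{a} \<noteq> insert a C" using partition_on_part_nonempty[OF p(1) C] D[OF C] by blast
  show "partition_on (insert a A) (insert (insert a C) (p - {C}))"
  proof (rule partition_onI')
    have "\<Union> p = A" using p(1) by (simp add: partition_on_def)
    then show "\<Union> (insert (insert a C) (p - {C})) = insert a A" using C by blast
    show "{} \<notin> insert (insert a C) (p - {C})" using partition_on_part_nonempty[OF p(1)] by blast
    show "X = Y" if "X \<in> insert (insert a C) (p - {C})" "Y \<in> insert (insert a C) (p - {C})" "x \<in> X" "x \<in> Y"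
      for X Y x
      using that D partition_on_part_unique[OF p(1) _ C] partition_on_part_unique[OF p(1)]
      by (metis DiffD1 DiffD2 insertE insertI1)
  qed
qed

text \<open>A partition of the larger set either has the singleton of a as a block or arises, in
  exactly one way, by adding a to a block C of a partition of A. These are the two ways in which one
  more observation can fall.\<close>

lemma sum_partition_on_insert:
  fixes t :: "'a set set \<Rightarrow> 'b::comm_monoid_add"
  assumes A: "finite A" and a: "a \<notin> A"
  shows "(\<Sum>q | partition_on (insert a A) q. t q) =
    (\<Sum>p | partition_on A p. t (insert {a} p) + (\<Sum>C\<in>p. t (insert (insert a C) (p - {C}))))"
proof -
  have fin: "finite {q. partition_on B q}" if "finite B" for B :: "'a set"
    using that by (rule finitely_many_partition_on)
  have finp: "finite p" if "partition_on A p" for p using finite_elements[OF A that] .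
  let ?Q = "{q. partition_on (insert a A) q}"
  have Q1: "(\<Sum>q\<in>{q\<in>?Q. {a} \<in> q}. t q) = (\<Sum>p | partition_on A p. t (insert {a} p))"
  proof (rule sum.reindex_bij_witness[where i="insert {a}" and j="\<lambda>q. q - {{a}}"])
    fix q assume "q \<in> {q\<in>?Q. {a} \<in> q}"
    then have q: "partition_on (insert a A) q" "{a} \<in> q" by auto
    show "insert {a} (q - {{a}}) = q" using q by auto
    show "t (insert {a} (q - {{a}})) = t q" using q by (simp add: insert_absorb)
    have nD: "a \<notin> D" if "D \<in> q - {{a}}" for D
      using partition_on_part_unique[OF q(1) q(2), of D a] that by auto
    have Uq: "\<Union> q = insert a A" using q(1) by (simp add: partition_on_def)
    have U: "\<Union> (q - {{a}}) = A"
    proof (intro equalityI subsetI)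
      fix x assume "x \<in> \<Union> (q - {{a}})"
      then obtain D where D: "D \<in> q - {{a}}" "x \<in> D" by (rule UnionE)
      then have "x \<noteq> a" "x \<in> \<Union> q" using nD[OF D(1)] by auto
      then show "x \<in> A" using Uq by simp
    next
      fix x assume x: "x \<in> A"
      obtain D where D: "D \<in> q" "x \<in> D" by (rule partition_on_obtain_part[OF q(1) insertI2[OF x]])
      moreover have "x \<noteq> a" using x a by metis
      ultimately have "D \<in> q - {{a}}" by auto
      then show "x \<in> \<Union> (q - {{a}})" using D(2) by (rule UnionI)
    qed
    have "partition_on A (q - {{a}})"
    proof (rule partition_onI'[OF U])
      show "X = Y" if "X \<in> q - {{a}}" "Y \<in> q - {{a}}" "x \<in> X" "x \<in> Y" for X Y x
        using partition_on_part_unique[OF q(1)] that by blast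
      show "{} \<notin> q - {{a}}" using partition_on_part_nonempty[OF q(1)] by blast
    qed
    then show "q - {{a}} \<in> {p. partition_on A p}" by simp
  next
    fix p assume "p \<in> {p. partition_on A p}"
    then have p: "partition_on A p" by simp
    note * = partition_on_insert_singleton[OF p a]
    show "insert {a} p - {{a}} = p" using * by auto
    show "insert {a} p \<in> {q\<in>?Q. {a} \<in> q}" using * by auto
  qed
  have Q2: "(\<Sum>q\<in>{q\<in>?Q. {a} \<notin> q}. t q) =
    (\<Sum>(p, C)\<in>Sigma {p. partition_on A p} (\<lambda>p. p). t (insert (insert a C) (p - {C})))"
  proof (rule sum.reindex_bij_witness[where i="\<lambda>(p, C). insert (insert a C) (p - {C})"
        and j="\<lambda>q. (insert ((THE D. D \<in> q \<and> a \<in> D) - {a}) (q - {THE D. D \<in> q \<and> a \<in> D}),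
                    (THE D. D \<in> q \<and> a \<in> D) - {a})"])
    fix q assume "q \<in> {q\<in>?Q. {a} \<notin> q}"
    then have q: "partition_on (insert a A) q" "{a} \<notin> q" by auto
    obtain D where D: "D \<in> q" "a \<in> D" by (rule partition_on_obtain_part[OF q(1) insertI1])
    then have the: "(THE D. D \<in> q \<and> a \<in> D) = D"
      using partition_on_part_unique[OF q(1)] by (intro the_equality) auto
    have nD: "a \<notin> E" if "E \<in> q - {D}" for E
      using partition_on_part_unique[OF q(1), of E D a] D that by auto
    have disj: "E \<inter> D = {}" if "E \<in> q - {D}" for E
      using partition_on_part_unique[OF q(1), of E D] D that by auto
    have "D \<noteq> {a}" using q D by blast
    then have ne: "D - {a} \<noteq> {}" using D(2) by blast
    \<comment> \<open>Being nonempty and disjoint from the other blocks, the shortened block is none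
      of them; hence enlarging it again restores q.\<close>
    then have nq: "D - {a} \<notin> q - {D}" using disj[of "D - {a}"] by blast
    have eq: "insert (insert a (D - {a})) (insert (D - {a}) (q - {D}) - {D - {a}}) = q"
      using D nq by (auto simp: insert_absorb)
    show "(case (insert ((THE D. D \<in> q \<and> a \<in> D) - {a}) (q - {THE D. D \<in> q \<and> a \<in> D}),
                    (THE D. D \<in> q \<and> a \<in> D) - {a}) of (p, C) \<Rightarrow> insert (insert a C) (p - {C})) = q"
      unfolding the prod.case by (rule eq)
    show "(case (insert ((THE D. D \<in> q \<and> a \<in> D) - {a}) (q - {THE D. D \<in> q \<and> a \<in> D}),
                    (THE D. D \<in> q \<and> a \<in> D) - {a}) of (p, C) \<Rightarrow> t (insert (insert a C) (p - {C}))) = t q"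
      unfolding the prod.case by (simp only: eq)
    have "partition_on A (insert (D - {a}) (q - {D}))"
    proof (rule partition_onI')
      have Uq: "\<Union> q = insert a A" using q by (simp add: partition_on_def)
      show "\<Union> (insert (D - {a}) (q - {D})) = A"
      proof (intro equalityI subsetI)
        fix x assume "x \<in> \<Union> (insert (D - {a}) (q - {D}))"
        then obtain E where E: "E \<in> insert (D - {a}) (q - {D})" "x \<in> E" by (rule UnionE)
        then have "x \<noteq> a" "x \<in> \<Union> q" using nD[of E] D by auto
        then show "x \<in> A" using Uq by simp
      next
        fix x assume x: "x \<in> A"
        obtain E where E: "E \<in> q" "x \<in> E" by (rule partition_on_obtain_part[OF q(1) insertI2[OF x]])
        moreover have "x \<noteq> a" using x a by metis
        ultimately show "x \<in> \<Union> (insert (D - {a}) (q - {D}))" by (cases "E = D") auto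
      qed
      show "X = Y" if "X \<in> insert (D - {a}) (q - {D})" "Y \<in> insert (D - {a}) (q - {D})" "x \<in> X" "x \<in> Y" for X Y x
        using that disj partition_on_part_unique[OF q(1)] by blast
      show "{} \<notin> insert (D - {a}) (q - {D})"
        using ne partition_on_part_nonempty[OF q(1)] by blast
    qed
    then show "(insert ((THE D. D \<in> q \<and> a \<in> D) - {a}) (q - {THE D. D \<in> q \<and> a \<in> D}),
                    (THE D. D \<in> q \<and> a \<in> D) - {a}) \<in> Sigma {p. partition_on A p} (\<lambda>p. p)"
      unfolding the by simp
  next
    fix b assume "b \<in> Sigma {p. partition_on A p} (\<lambda>p. p)"
    then obtain p C where b: "b = (p, C)" and p: "partition_on A p" and C: "C \<in> p" by auto
    note * = partition_on_insert_part[OF p a C]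
    have D: "a \<notin> D" if "D \<in> p" for D using partition_on_notin[OF p a that] .
    have the: "(THE D. D \<in> insert (insert a C) (p - {C}) \<and> a \<in> D) = insert a C"
      using D by (intro the_equality) auto
    have 1: "insert a C - {a} = C" using D[OF C] by auto
    have 2: "insert (insert a C) (p - {C}) - {insert a C} = p - {C}" using *(2) by auto
    show "(insert ((THE D. D \<in> (case b of (p, C) \<Rightarrow> insert (insert a C) (p - {C})) \<and> a \<in> D) - {a})
           ((case b of (p, C) \<Rightarrow> insert (insert a C) (p - {C})) -
             {THE D. D \<in> (case b of (p, C) \<Rightarrow> insert (insert a C) (p - {C})) \<and> a \<in> D}),
          (THE D. D \<in> (case b of (p, C) \<Rightarrow> insert (insert a C) (p - {C})) \<and> a \<in> D) - {a}) = b"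
      unfolding b prod.case the 1 2 using C by auto
    show "(case b of (p, C) \<Rightarrow> insert (insert a C) (p - {C})) \<in> {q\<in>?Q. {a} \<notin> q}"
      using * D by (auto simp: b)
  qed
  have "(\<Sum>q\<in>?Q. t q) = (\<Sum>q\<in>{q\<in>?Q. {a} \<in> q}. t q) + (\<Sum>q\<in>{q\<in>?Q. {a} \<notin> q}. t q)"
    using fin[of "insert a A"] A
    by (subst sum.union_disjoint[symmetric]) (auto intro!: sum.cong)
  also have "\<dots> = (\<Sum>p | partition_on A p. t (insert {a} p)) +
      (\<Sum>p | partition_on A p. \<Sum>C\<in>p. t (insert (insert a C) (p - {C})))"
    unfolding Q1 Q2 using fin[OF A] finp by (subst sum.Sigma) auto
  finally show ?thesis by (simp add: sum.distrib)
qed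

section \<open>Vectors with prescribed ties\<close>

lemma expand_apply:
  assumes "partition_on {1..n} p" "C \<in> p" "i \<in> C"
  shows "expand n p z i = z C"
proof -
  have "(THE C. C \<in> p \<and> i \<in> C) = C"
    using assms partition_on_part_unique[OF assms(1)] by (intro the_equality) auto
  moreover have "i \<in> {1..n}" using assms by (auto simp: partition_on_def)
  ultimately show ?thesis by (simp add: expand_def)
qed

lemma expand_cong: "(\<And>C. C \<in> p \<Longrightarrow> z C = z' C) \<Longrightarrow> partition_on {1..n} p \<Longrightarrow> expand n p z = expand n p z'"
proof
  fix i assume eq: "\<And>C. C \<in> p \<Longrightarrow> z C = z' C" and p: "partition_on {1..n} p"
  show "expand n p z i = expand n p z' i"
  proof (cases "i \<in> {1..n}")
    case True
    then obtain C where "C \<in> p" "i \<in> C" using partition_on_obtain_part[OF p True] by metis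
    then show ?thesis using eq by (simp add: expand_apply[OF p])
  qed (simp only: expand_def restrict_apply if_False)
qed

lemma expandI:
  assumes p: "partition_on {1..n} p" and y: "\<And>i. i \<notin> {1..n} \<Longrightarrow> y i = undefined"
    and "\<And>C i. C \<in> p \<Longrightarrow> i \<in> C \<Longrightarrow> y i = z C"
  shows "expand n p z = y"
proof
  fix i
  show "expand n p z i = y i"
  proof (cases "i \<in> {1..n}")
    case True
    then obtain C where "C \<in> p" "i \<in> C" using partition_on_obtain_part[OF p True] by metis
    then show ?thesis using assms(3) by (simp add: expand_apply[OF p])
  next
    case False
    then show ?thesis using y[OF False] by (simp only: expand_def restrict_apply if_False)
  qed
qed

lemma expand_insert_singleton:
  assumes p: "partition_on {1..n} p"
  shows "expand (Suc n) (insert {Suc n} p) (z({Suc n} := v)) = (expand n p z)(Suc n := v)"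
proof (rule expandI)
  have s: "{1..Suc n} = insert (Suc n) {1..n}" by auto
  show "partition_on {1..Suc n} (insert {Suc n} p)"
    unfolding s by (rule partition_on_insert_singleton[OF p]) simp
  show "((expand n p z)(Suc n := v)) i = undefined" if "i \<notin> {1..Suc n}" for i
    using that by (auto simp: expand_def)
  fix C i assume C: "C \<in> insert {Suc n} p" "i \<in> C"
  have "Suc n \<notin> D" if "D \<in> p" for D using partition_on_notin[OF p _ that] by simp
  then show "((expand n p z)(Suc n := v)) i = (z({Suc n} := v)) C"
    using C by (auto simp: expand_apply[OF p])
qed

text \<open>The block changes its label from C to the enlarged set, so the value v is stored under
  different labels on the two sides; the new coordinate repeats it.\<close>

lemma expand_insert_part:
  assumes p: "partition_on {1..n} p" and C: "C \<in> p"
  shows "expand (Suc n) (insert (insert (Suc n) C) (p - {C})) (z(insert (Suc n) C := v))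
    = (expand n p (z(C := v)))(Suc n := v)"
proof (rule expandI)
  have s: "{1..Suc n} = insert (Suc n) {1..n}" by auto
  show "partition_on {1..Suc n} (insert (insert (Suc n) C) (p - {C}))"
    unfolding s by (rule partition_on_insert_part[OF p _ C]) simp
  show "((expand n p (z(C := v)))(Suc n := v)) i = undefined" if "i \<notin> {1..Suc n}" for i
    using that by (auto simp: expand_def)
  fix D i assume D: "D \<in> insert (insert (Suc n) C) (p - {C})" "i \<in> D"
  have *: "Suc n \<notin> D" if "D \<in> p" for D using partition_on_notin[OF p _ that] by simp
  show "((expand n p (z(C := v)))(Suc n := v)) i = (z(insert (Suc n) C := v)) D"
  proof (cases "D = insert (Suc n) C")
    case True
    then show ?thesis using D C by (auto simp: expand_apply[OF p C])
  next
    case False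
    then have "D \<in> p" "D \<noteq> C" "i \<noteq> Suc n" using D * by auto
    then show ?thesis using False D by (simp add: expand_apply[OF p, of D])
  qed
qed

lemma measurable_expand:
  assumes p: "partition_on {1..n} p" and g: "\<And>C. C \<in> p \<Longrightarrow> g C \<in> N \<rightarrow>\<^sub>M M"
  shows "(\<lambda>x. expand n p (\<lambda>C. g C x)) \<in> N \<rightarrow>\<^sub>M (\<Pi>\<^sub>M i\<in>{1..n}. M)"
  unfolding expand_def[abs_def]
proof (rule measurable_restrict)
  fix i assume "i \<in> {1..n}"
  then obtain C where C: "C \<in> p" "i \<in> C" using partition_on_obtain_part[OF p] by metis
  then have "(THE C. C \<in> p \<and> i \<in> C) = C"
    using partition_on_part_unique[OF p] by (intro the_equality) auto
  then show "(\<lambda>x. g (THE C. C \<in> p \<and> i \<in> C) x) \<in> N \<rightarrow>\<^sub>M M"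
    using g[OF C(1)] by simp
qed

section \<open>The Mecke formula for general integrands\<close>

context crm
begin

definition add_points :: "'i set \<Rightarrow> ('i \<Rightarrow> 's \<times> 'y) \<Rightarrow> 'y measure \<Rightarrow> 'y measure" where
  "add_points I z \<mu> = add_atoms I (\<lambda>i. ennreal (h (fst (z i)))) (\<lambda>i. snd (z i)) \<mu>"

lemma measurable_add_points:
  assumes I: "finite I" and m: "m \<in> M \<rightarrow>\<^sub>M bfa"
    and z: "\<And>i. i \<in> I \<Longrightarrow> (\<lambda>x. z x i) \<in> M \<rightarrow>\<^sub>M (borel \<Otimes>\<^sub>M borel)"
  shows "(\<lambda>x. add_points I (z x) (m x)) \<in> M \<rightarrow>\<^sub>M bfa"
  unfolding add_points_def
proof (rule measurable_add_atoms[OF I m])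
  note [measurable] = z
  show "(\<lambda>x. ennreal (h (fst (z x i)))) \<in> borel_measurable M" if "i \<in> I" for i
    by (rule measurable_compose[OF z[OF that]]) measurable
  show "(\<lambda>x. snd (z x i)) \<in> borel_measurable M" if "i \<in> I" for i
    by (rule measurable_compose[OF z[OF that]]) measurable
qed simp

lemma nn_integral_add_points:
  assumes "finite I" "\<mu> \<in> boundedly_finite" "g \<in> borel_measurable borel"
  shows "(\<integral>\<^sup>+y. g y \<partial>add_points I z \<mu>) = (\<integral>\<^sup>+y. g y \<partial>\<mu>) + (\<Sum>i\<in>I. ennreal (h (fst (z i))) * g (snd (z i)))"
  unfolding add_points_def using assms by (intro nn_integral_add_atoms boundedly_finite_sets)

text \<open>For fixed B both sides are integrals of G against finite measures: the law weighted by
  \<mu>(B), and the image of intensity times law under adding a point. By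
  \<open>mecke_exponential\<close> their Laplace functionals agree, so uniqueness applies.\<close>

lemma mecke_bounded:
  assumes B: "B \<in> sets borel" and fin: "(\<integral>\<^sup>+z. indicator B (snd z) \<partial>\<nu> 1) < \<infinity>"
    and G: "G \<in> borel_measurable bfa"
  shows "(\<integral>\<^sup>+\<mu>. emeasure \<mu> B * G \<mu> \<partial>P) =
    (\<integral>\<^sup>+z. indicator B (snd z) * (\<integral>\<^sup>+\<mu>. G (add_points {()} (\<lambda>_. z) \<mu>) \<partial>P) \<partial>\<nu> 1)"
proof -
  define b :: "'s \<times> 'y \<Rightarrow> ennreal" where "b z = indicator B (snd z)" for z
  have b: "b \<in> borel_measurable (\<nu> 1)"
    unfolding measurable_cong_sets[OF sets_\<nu> refl] b_def[abs_def] using B by measurable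
  define D where "D = density (\<nu> 1) b"
  have sD: "sets D = sets (borel \<Otimes>\<^sub>M borel)" by (simp add: D_def sets_\<nu>)
  define ev where "ev \<mu> = emeasure \<mu> B" for \<mu> :: "'y measure"
  have ev: "ev \<in> borel_measurable P"
    unfolding measurable_P ev_def[abs_def] by (rule emeasure_measurable_bfa[OF B])
  define pt where "pt = (\<lambda>(z, \<mu>). add_points {()} (\<lambda>_. z) \<mu>)"
  have pt: "pt \<in> D \<Otimes>\<^sub>M P \<rightarrow>\<^sub>M bfa"
    unfolding measurable_cong_sets[OF sets_pair_measure_cong[OF sD sets_P] refl] pt_def case_prod_beta
    by (rule measurable_add_points) auto
  define Q1 where "Q1 = density P ev"
  define Q2 where "Q2 = distr (D \<Otimes>\<^sub>M P) bfa pt"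
  have int1: "(\<integral>\<^sup>+\<mu>. F \<mu> \<partial>Q1) = (\<integral>\<^sup>+\<mu>. ev \<mu> * F \<mu> \<partial>P)" if "F \<in> borel_measurable bfa" for F
    unfolding Q1_def using that by (intro nn_integral_density ev) (simp add: measurable_P)
  have int2: "(\<integral>\<^sup>+\<mu>. F \<mu> \<partial>Q2) = (\<integral>\<^sup>+z. b z * (\<integral>\<^sup>+\<mu>. F (pt (z, \<mu>)) \<partial>P) \<partial>\<nu> 1)"
    if F: "F \<in> borel_measurable bfa" for F
  proof -
    have Fp: "(\<lambda>x. F (pt x)) \<in> borel_measurable (D \<Otimes>\<^sub>M P)" by (rule measurable_compose[OF pt F])
    have "(\<integral>\<^sup>+\<mu>. F \<mu> \<partial>Q2) = (\<integral>\<^sup>+x. F (pt x) \<partial>(D \<Otimes>\<^sub>M P))"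
      unfolding Q2_def by (rule nn_integral_distr[OF pt]) (simp add: F)
    also have "\<dots> = (\<integral>\<^sup>+z. (\<integral>\<^sup>+\<mu>. F (pt (z, \<mu>)) \<partial>P) \<partial>D)"
      using P.nn_integral_fst[OF Fp] by simp
    also have "\<dots> = (\<integral>\<^sup>+z. b z * (\<integral>\<^sup>+\<mu>. F (pt (z, \<mu>)) \<partial>P) \<partial>\<nu> 1)"
    proof -
      have "(\<lambda>z. \<integral>\<^sup>+\<mu>. F (pt (z, \<mu>)) \<partial>P) \<in> borel_measurable D"
        using P.borel_measurable_nn_integral_fst[OF Fp] by simp
      then show ?thesis
        unfolding D_def by (intro nn_integral_density b) simp
    qed
    finally show ?thesis .
  qed
  have mass2: "(\<integral>\<^sup>+\<mu>. 1 \<partial>Q2) < \<infinity>"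
    using fin by (subst int2) (simp_all add: P.emeasure_space_1 b_def)
  have lap: "(\<integral>\<^sup>+\<mu>. exp_neg (\<integral>\<^sup>+y. g y \<partial>\<mu>) \<partial>Q1) = (\<integral>\<^sup>+\<mu>. exp_neg (\<integral>\<^sup>+y. g y \<partial>\<mu>) \<partial>Q2)"
    if g: "g \<in> borel_measurable borel" for g
  proof -
    let ?e = "\<lambda>\<mu>. exp_neg (\<integral>\<^sup>+y. g y \<partial>\<mu>)"
    have e: "?e \<in> borel_measurable bfa" by (rule exp_neg_nn_integral_measurable_bfa[OF g])
    have "(\<integral>\<^sup>+\<mu>. ?e \<mu> \<partial>Q1) = (\<integral>\<^sup>+\<mu>. ?e \<mu> * (\<integral>\<^sup>+y. indicator B y \<partial>\<mu>) \<partial>P)"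
      unfolding int1[OF e]
    proof (intro nn_integral_cong)
      fix \<mu> assume "\<mu> \<in> space P"
      then have "sets \<mu> = sets borel" using space_P boundedly_finite_sets by auto
      then show "ev \<mu> * ?e \<mu> = ?e \<mu> * (\<integral>\<^sup>+y. indicator B y \<partial>\<mu>)"
        using B by (simp add: ev_def mult.commute)
    qed
    also have "\<dots> = exp_neg (laplace_exponent h \<rho> \<eta> g) *
        (\<integral>\<^sup>+z. exp_neg (g (snd z) * ennreal (h (fst z))) * indicator B (snd z) \<partial>\<nu> 1)"
      using B by (intro mecke_exponential g) simp
    also have "\<dots> = (\<integral>\<^sup>+z. exp_neg (laplace_exponent h \<rho> \<eta> g) *
         (exp_neg (g (snd z) * ennreal (h (fst z))) * indicator B (snd z)) \<partial>\<nu> 1)"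
      using B g by (intro nn_integral_cmult[symmetric]) (simp add: measurable_cong_sets[OF sets_\<nu> refl])
    also have "\<dots> = (\<integral>\<^sup>+z. b z * (\<integral>\<^sup>+\<mu>. ?e (pt (z, \<mu>)) \<partial>P) \<partial>\<nu> 1)"
    proof (intro nn_integral_cong)
      fix z
      have "(\<integral>\<^sup>+\<mu>. ?e (pt (z, \<mu>)) \<partial>P) = (\<integral>\<^sup>+\<mu>. exp_neg (g (snd z) * ennreal (h (fst z))) * ?e \<mu> \<partial>P)"
        by (intro nn_integral_cong)
           (simp add: pt_def space_P nn_integral_add_points g exp_neg_add mult.commute)
      also have "\<dots> = exp_neg (g (snd z) * ennreal (h (fst z))) * exp_neg (laplace_exponent h \<rho> \<eta> g)"
        using e by (subst nn_integral_cmult) (simp_all add: measurable_P has_laplace_exponentD[OF law g])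
      finally show "exp_neg (laplace_exponent h \<rho> \<eta> g) *
         (exp_neg (g (snd z) * ennreal (h (fst z))) * indicator B (snd z)) = b z * (\<integral>\<^sup>+\<mu>. ?e (pt (z, \<mu>)) \<partial>P)"
        by (simp add: b_def mult_ac)
    qed
    also have "\<dots> = (\<integral>\<^sup>+\<mu>. ?e \<mu> \<partial>Q2)" by (rule int2[OF e, symmetric])
    finally show ?thesis .
  qed
  have "Q1 = Q2"
  proof (rule boundedly_finite_measure_eq_laplace)
    have "(\<integral>\<^sup>+\<mu>. 1 \<partial>Q1) = (\<integral>\<^sup>+\<mu>. 1 \<partial>Q2)" using lap[of "\<lambda>_. 0"] by simp
    with mass2 show "finite_measure Q1" "finite_measure Q2"
      by (auto intro!: finite_measureI)
    show "sets Q1 = sets bfa" "sets Q2 = sets bfa" by (simp_all add: Q1_def Q2_def sets_P)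
  qed (rule lap)
  then show ?thesis
    using int1[OF G] int2[OF G] by (simp add: ev_def b_def pt_def)
qed

text \<open>Both sides are integrals against measures on pairs (y, \<mu>). They agree on rectangles,
  first for a base of finite intensity, then by exhaustion for any base. Rectangles form an
  intersection-stable generator, and the exhausting sets provide the cover by sets of finite measure
  that uniqueness requires.\<close>

theorem mecke:
  assumes F: "(\<lambda>(y, \<mu>). F y \<mu>) \<in> borel_measurable (borel \<Otimes>\<^sub>M bfa)"
  shows "(\<integral>\<^sup>+\<mu>. \<integral>\<^sup>+y. F y \<mu> \<partial>\<mu> \<partial>P) =
    (\<integral>\<^sup>+z. \<integral>\<^sup>+\<mu>. F (snd z) (add_points {()} (\<lambda>_. z) \<mu>) \<partial>P \<partial>\<nu> 1)"
proof -
  define pt where "pt = (\<lambda>(z, \<mu>). (snd z :: 'y, add_points {()} (\<lambda>_. z) \<mu>))"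
  have pt: "pt \<in> \<nu> 1 \<Otimes>\<^sub>M P \<rightarrow>\<^sub>M borel \<Otimes>\<^sub>M bfa"
    unfolding measurable_cong_sets[OF sets_pair_measure_cong[OF sets_\<nu> sets_P] refl] pt_def case_prod_beta
    by (intro measurable_Pair measurable_add_points) auto
  define M1 where "M1 = kernel_measure borel (\<lambda>\<mu>. \<mu>) P"
  define M2 where "M2 = distr (\<nu> 1 \<Otimes>\<^sub>M P) (borel \<Otimes>\<^sub>M bfa) pt"
  have s1: "sets M1 = sets (borel \<Otimes>\<^sub>M bfa)"
    unfolding M1_def sets_kernel_measure by (rule sets_pair_measure_cong[OF refl sets_P])
  have s2: "sets M2 = sets (borel \<Otimes>\<^sub>M bfa)" by (simp add: M2_def)
  have k: "s_finite_kernel P borel (\<lambda>\<mu>. \<mu>)"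
    using s_finite_kernel_compose[OF s_finite_kernel_bfa measurable_ident_sets[OF sets_P]] .
  have int1: "(\<integral>\<^sup>+x. G x \<partial>M1) = (\<integral>\<^sup>+\<mu>. \<integral>\<^sup>+y. G (y, \<mu>) \<partial>\<mu> \<partial>P)" if "G \<in> borel_measurable (borel \<Otimes>\<^sub>M bfa)" for G
    unfolding M1_def using that
    by (intro nn_integral_kernel_measure_s_finite[OF k]) (simp add: measurable_cong_sets[OF sets_pair_measure_cong[OF refl sets_P] refl])
  have int2: "(\<integral>\<^sup>+x. G x \<partial>M2) = (\<integral>\<^sup>+z. \<integral>\<^sup>+\<mu>. G (pt (z, \<mu>)) \<partial>P \<partial>\<nu> 1)"
    if G: "G \<in> borel_measurable (borel \<Otimes>\<^sub>M bfa)" for G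
  proof -
    have m: "(\<lambda>x. G (pt x)) \<in> borel_measurable (\<nu> 1 \<Otimes>\<^sub>M P)" by (rule measurable_compose[OF pt G])
    have "(\<integral>\<^sup>+x. G x \<partial>M2) = (\<integral>\<^sup>+x. G (pt x) \<partial>(\<nu> 1 \<Otimes>\<^sub>M P))"
      unfolding M2_def by (rule nn_integral_distr[OF pt]) (simp add: G)
    then show ?thesis using P.nn_integral_fst[OF m] by simp
  qed
  obtain B :: "nat \<Rightarrow> 'y set" where B: "incseq B" "(\<Union>k. B k) = UNIV" "\<And>k. B k \<in> sets borel"
    "\<And>k. (\<integral>\<^sup>+z. indicator (B k) (snd z) \<partial>\<nu> 1) < \<infinity>"
    using \<nu>_exhaustion[of 1] by auto
  have rect_fin: "emeasure M1 (C \<times> A) = emeasure M2 (C \<times> A)"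
    if C: "C \<in> sets borel" "(\<integral>\<^sup>+z. indicator C (snd z) \<partial>\<nu> 1) < \<infinity>" and A: "A \<in> sets bfa" for C A
  proof -
    have CA: "C \<times> A \<in> sets (borel \<Otimes>\<^sub>M bfa)" using C A by simp
    have "emeasure M1 (C \<times> A) = (\<integral>\<^sup>+x. indicator (C \<times> A) x \<partial>M1)" using CA s1 by simp
    also have "\<dots> = (\<integral>\<^sup>+\<mu>. \<integral>\<^sup>+y. indicator (C \<times> A) (y, \<mu>) \<partial>\<mu> \<partial>P)"
      by (rule int1) (rule borel_measurable_indicator[OF CA])
    also have "\<dots> = (\<integral>\<^sup>+\<mu>. emeasure \<mu> C * indicator A \<mu> \<partial>P)"
    proof (intro nn_integral_cong)
      fix \<mu> assume "\<mu> \<in> space P"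
      then have "sets \<mu> = sets borel" using space_P boundedly_finite_sets by auto
      then have "(\<integral>\<^sup>+y. indicator C y \<partial>\<mu>) = emeasure \<mu> C" using C by simp
      then show "(\<integral>\<^sup>+y. indicator (C \<times> A) (y, \<mu>) \<partial>\<mu>) = emeasure \<mu> C * indicator A \<mu>"
        by (cases "\<mu> \<in> A") (simp_all add: indicator_times)
    qed
    also have "\<dots> = (\<integral>\<^sup>+z. indicator C (snd z) * (\<integral>\<^sup>+\<mu>. indicator A (add_points {()} (\<lambda>_. z) \<mu>) \<partial>P) \<partial>\<nu> 1)"
      by (rule mecke_bounded[OF C borel_measurable_indicator[OF A]])
    also have "\<dots> = (\<integral>\<^sup>+z. \<integral>\<^sup>+\<mu>. indicator (C \<times> A) (pt (z, \<mu>)) \<partial>P \<partial>\<nu> 1)"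
    proof (intro nn_integral_cong)
      show "indicator C (snd z) * (\<integral>\<^sup>+\<mu>. indicator A (add_points {()} (\<lambda>_. z) \<mu>) \<partial>P) =
          (\<integral>\<^sup>+\<mu>. indicator (C \<times> A) (pt (z, \<mu>)) \<partial>P)" for z
        by (cases "snd z \<in> C") (simp_all add: indicator_times pt_def)
    qed
    also have "\<dots> = (\<integral>\<^sup>+x. indicator (C \<times> A) x \<partial>M2)"
      by (rule int2[symmetric]) (rule borel_measurable_indicator[OF CA])
    also have "\<dots> = emeasure M2 (C \<times> A)" using CA s2 by simp
    finally show ?thesis .
  qed
  have finB: "(\<integral>\<^sup>+z. indicator (C \<inter> B k) (snd z) \<partial>\<nu> 1) < \<infinity>" for C k
  proof (rule le_less_trans[OF _ B(4)])
    show "(\<integral>\<^sup>+z. indicator (C \<inter> B k) (snd z) \<partial>\<nu> 1) \<le> (\<integral>\<^sup>+z. indicator (B k) (snd z) \<partial>\<nu> 1)"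
      by (intro nn_integral_mono) (auto simp: indicator_def)
  qed
  have rect: "emeasure M1 (C \<times> A) = emeasure M2 (C \<times> A)" if C: "C \<in> sets borel" and A: "A \<in> sets bfa" for C A
  proof -
    have inc: "incseq (\<lambda>k. (C \<inter> B k) \<times> A)" using B(1) by (auto simp: incseq_def)
    have un: "(\<Union>k. (C \<inter> B k) \<times> A) = C \<times> A" using B(2) by auto
    have m: "range (\<lambda>k. (C \<inter> B k) \<times> A) \<subseteq> sets (borel \<Otimes>\<^sub>M bfa)" using B(3) C A by auto
    have "emeasure M1 (C \<times> A) = (SUP k. emeasure M1 ((C \<inter> B k) \<times> A))"
      using SUP_emeasure_incseq[OF _ inc, of M1] m s1 un by simp
    also have "\<dots> = (SUP k. emeasure M2 ((C \<inter> B k) \<times> A))"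
      using C A B(3) finB by (intro SUP_cong refl rect_fin) auto
    also have "\<dots> = emeasure M2 (C \<times> A)"
      using SUP_emeasure_incseq[OF _ inc, of M2] m s2 un by simp
    finally show ?thesis .
  qed
  have "M1 = M2"
  proof (rule measure_eqI_generator_eq[OF Int_stable_pair_measure_generator, where A="\<lambda>k. B k \<times> boundedly_finite"])
    let ?E = "{a \<times> b |a b. a \<in> sets (borel :: 'y measure) \<and> b \<in> sets bfa}"
    show "?E \<subseteq> Pow (UNIV \<times> boundedly_finite)"
      using sets.sets_into_space[of _ bfa] by auto
    show "emeasure M1 X = emeasure M2 X" if "X \<in> ?E" for X
      using that rect by auto
    show "sets M1 = sigma_sets (UNIV \<times> boundedly_finite) ?E" "sets M2 = sigma_sets (UNIV \<times> boundedly_finite) ?E"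
      using s1 s2 by (simp_all add: sets_pair_measure)
    have bf: "boundedly_finite \<in> sets bfa" using sets.top[of bfa] by simp
    then show "range (\<lambda>k. B k \<times> boundedly_finite) \<subseteq> ?E" using B(3) by blast
    show "(\<Union>k. B k \<times> boundedly_finite) = UNIV \<times> boundedly_finite" using B(2) by auto
    show "emeasure M1 (B k \<times> boundedly_finite) \<noteq> \<infinity>" for k
    proof -
      have "emeasure M1 (B k \<times> boundedly_finite) = emeasure M2 (B k \<times> boundedly_finite)"
        by (rule rect[OF B(3) bf])
      also have "\<dots> = (\<integral>\<^sup>+x. indicator (B k \<times> boundedly_finite) x \<partial>M2)"
        using B(3) bf s2 by simp
      also have "\<dots> = (\<integral>\<^sup>+z. \<integral>\<^sup>+\<mu>. indicator (B k \<times> boundedly_finite) (pt (z, \<mu>)) \<partial>P \<partial>\<nu> 1)"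
        using B(3) bf by (intro int2) simp
      also have "\<dots> \<le> (\<integral>\<^sup>+z. \<integral>\<^sup>+\<mu>. indicator (B k) (snd z) \<partial>P \<partial>\<nu> 1)"
        by (intro nn_integral_mono) (auto simp: pt_def indicator_def)
      also have "\<dots> < \<infinity>" using B(4)[of k] by (simp add: P.emeasure_space_1)
      finally show ?thesis by simp
    qed
  qed
  then show ?thesis
    using int1[OF F] int2[OF F] by (simp add: pt_def)
qed

end

section \<open>The iterated Mecke formula\<close>

context crm
begin

text \<open>The maximum only matters for empty or infinite \<open>C\<close>: every index of a product of
  \<open>\<sigma>\<close>-finite measures must carry a \<open>\<sigma>\<close>-finite measure, also those outside the partition.\<close>

definition block_intensity :: "nat set \<Rightarrow> ('s \<times> 'y) measure" where
  "block_intensity C = \<nu> (max 1 (card C))"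

sublocale blocks: product_sigma_finite block_intensity
  by (rule product_sigma_finite.intro) (simp add: block_intensity_def sigma_finite_\<nu>)

lemma sets_block_intensity: "sets (block_intensity C) = sets (borel \<Otimes>\<^sub>M borel)"
  by (simp add: block_intensity_def sets_\<nu>)

lemma sets_PiM_block_intensity: "sets (PiM p block_intensity) = sets (\<Pi>\<^sub>M C\<in>p. borel \<Otimes>\<^sub>M borel)"
  by (intro sets_PiM_cong refl sets_block_intensity)

text \<open>The contribution of the partition p to the n-fold integral: one marked point per block,
  weighted by the intensity for as many hits as the block has elements, with its atom added to
  \<mu>. It is an unnormalized Palm formula of higher order.\<close>

definition palm :: "nat \<Rightarrow> nat set set \<Rightarrow> ((nat \<Rightarrow> 'y) \<Rightarrow> 'y measure \<Rightarrow> ennreal) \<Rightarrow> ennreal" where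
  "palm n p F =
     (\<integral>\<^sup>+z. \<integral>\<^sup>+\<mu>. F (expand n p (\<lambda>C. snd (z C))) (add_points p z \<mu>) \<partial>P \<partial>PiM p block_intensity)"

lemma finite_partition: "partition_on {1..n::nat} p \<Longrightarrow> finite p"
  using finite_elements[of "{1..n}" p] by simp

lemma measurable_palm_integrand:
  assumes p: "partition_on {1..n} p"
    and z: "\<And>C. C \<in> p \<Longrightarrow> (\<lambda>x. z x C) \<in> M \<rightarrow>\<^sub>M (borel \<Otimes>\<^sub>M borel)" and m: "m \<in> M \<rightarrow>\<^sub>M bfa"
    and F: "(\<lambda>(y, \<mu>). F y \<mu>) \<in> borel_measurable ((\<Pi>\<^sub>M i\<in>{1..n}. borel) \<Otimes>\<^sub>M bfa)"
  shows "(\<lambda>x. F (expand n p (\<lambda>C. snd (z x C))) (add_points p (z x) (m x))) \<in> borel_measurable M"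
proof -
  have "(\<lambda>x. (expand n p (\<lambda>C. snd (z x C)), add_points p (z x) (m x))) \<in> M \<rightarrow>\<^sub>M (\<Pi>\<^sub>M i\<in>{1..n}. borel) \<Otimes>\<^sub>M bfa"
    using p z m
    by (intro measurable_Pair measurable_expand measurable_add_points finite_partition measurable_compose[OF z measurable_snd])
  from measurable_compose[OF this F] show ?thesis by simp
qed

lemma measurable_nn_integral_P:
  assumes "(\<lambda>(x, \<mu>). G x \<mu>) \<in> borel_measurable (M \<Otimes>\<^sub>M bfa)"
  shows "(\<lambda>x. \<integral>\<^sup>+\<mu>. G x \<mu> \<partial>P) \<in> borel_measurable M"
  using assms P.borel_measurable_nn_integral_fst[of "\<lambda>(x, \<mu>). G x \<mu>" M]
  by (simp add: measurable_cong_sets[OF sets_pair_measure_cong[OF refl sets_P] refl])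

lemma measurable_component_block:
  "C \<in> p \<Longrightarrow> (\<lambda>z. z C) \<in> (\<Pi>\<^sub>M C\<in>p. borel \<Otimes>\<^sub>M borel) \<rightarrow>\<^sub>M (borel \<Otimes>\<^sub>M borel)"
  by (rule measurable_component_singleton)

lemma measurable_nn_integral_bfa:
  assumes "(\<lambda>((x, \<mu>), v). G x \<mu> v) \<in> borel_measurable ((M \<Otimes>\<^sub>M bfa) \<Otimes>\<^sub>M borel)"
  shows "(\<lambda>(x, \<mu>). \<integral>\<^sup>+v. G x \<mu> v \<partial>\<mu>) \<in> borel_measurable (M \<Otimes>\<^sub>M bfa)"
  unfolding case_prod_beta
  using assms by (intro s_finite_kernel_nn_integral[OF s_finite_kernel_bfa]) (simp_all add: case_prod_beta')

text \<open>The observation that falls on none of the earlier atoms: the Mecke formula, applied with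
  the earlier points z fixed, adds one point with intensity \<open>\<nu> 1\<close>, and this is the
  block intensity of a singleton.\<close>

lemma palm_insert_singleton:
  assumes p: "partition_on {1..n} p"
    and F: "(\<lambda>(y, \<mu>). F y \<mu>) \<in> borel_measurable ((\<Pi>\<^sub>M i\<in>{1..Suc n}. borel) \<Otimes>\<^sub>M bfa)"
  shows "(\<integral>\<^sup>+z. \<integral>\<^sup>+\<mu>. \<integral>\<^sup>+v. F ((expand n p (\<lambda>C. snd (z C)))(Suc n := v)) (add_points p z \<mu>) \<partial>\<mu> \<partial>P \<partial>PiM p block_intensity)
    = palm (Suc n) (insert {Suc n} p) F"
proof -
  let ?q = "insert {Suc n} p"
  have s: "{1..Suc n} = insert (Suc n) {1..n}" by auto
  have q: "partition_on {1..Suc n} ?q" and new: "{Suc n} \<notin> p"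
    unfolding s using partition_on_insert_singleton[OF p] by auto
  have fin: "finite p" using p by (rule finite_partition)
  have F': "(\<lambda>(y, \<mu>). F y \<mu>) \<in> borel_measurable ((\<Pi>\<^sub>M i\<in>insert (Suc n) {1..n}. borel) \<Otimes>\<^sub>M bfa)"
    using F by (simp only: s)
  have eq: "expand (Suc n) ?q (\<lambda>C. snd ((z({Suc n} := x)) C)) = (expand n p (\<lambda>C. snd (z C)))(Suc n := snd x)" for z :: "nat set \<Rightarrow> 's \<times> 'y" and x
    using expand_insert_singleton[OF p, of "\<lambda>C. snd (z C)" "snd x"] by (simp add: fun_upd_def if_distrib cong: if_cong)
  have at: "add_points ?q (z({Suc n} := x)) \<mu> = add_points p z (add_points {()} (\<lambda>_. x) \<mu>)"
    if \<mu>: "\<mu> \<in> boundedly_finite" for z x \<mu>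
  proof -
    have "add_points ?q (z({Suc n} := x)) \<mu> = add_points p (z({Suc n} := x)) (add_points {()} (\<lambda>_. x) \<mu>)"
      unfolding add_points_def
      using add_atoms_insert[OF boundedly_finite_sets[OF \<mu>] fin new, where u="()"] by simp
    also have "\<dots> = add_points p z (add_points {()} (\<lambda>_. x) \<mu>)"
      using new unfolding add_points_def add_atoms_def
      by (intro arg_cong[where f="measure_of UNIV (sets borel)"] ext arg_cong2[where f="(+)"] refl sum.cong) auto
    finally show ?thesis .
  qed
  define I where "I z = (\<integral>\<^sup>+\<mu>. F (expand (Suc n) ?q (\<lambda>C. snd (z C))) (add_points ?q z \<mu>) \<partial>P)" for z
  have "I \<in> borel_measurable (\<Pi>\<^sub>M C\<in>?q. borel \<Otimes>\<^sub>M borel)"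
    unfolding I_def[abs_def]
    by (rule measurable_nn_integral_P, unfold case_prod_beta, rule measurable_palm_integrand[OF q _ _ F])
       (auto intro!: measurable_compose[OF measurable_fst] measurable_component_block)
  then have "palm (Suc n) ?q F = (\<integral>\<^sup>+z. (\<integral>\<^sup>+x. I (z({Suc n} := x)) \<partial>block_intensity {Suc n}) \<partial>PiM p block_intensity)"
    unfolding palm_def I_def[symmetric]
    by (intro blocks.product_nn_integral_insert[OF fin new]) (simp add: measurable_cong_sets[OF sets_PiM_block_intensity refl])
  also have "\<dots> = (\<integral>\<^sup>+z. (\<integral>\<^sup>+\<mu>. \<integral>\<^sup>+v. F ((expand n p (\<lambda>C. snd (z C)))(Suc n := v)) (add_points p z \<mu>) \<partial>\<mu> \<partial>P) \<partial>PiM p block_intensity)"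
  proof (intro nn_integral_cong)
    fix z assume "z \<in> space (PiM p block_intensity)"
    then have z: "z \<in> space (\<Pi>\<^sub>M C\<in>p. borel \<Otimes>\<^sub>M borel)"
      using sets_eq_imp_space_eq[OF sets_PiM_block_intensity] by simp
    have "expand n p (\<lambda>C. snd (z C)) \<in> space (\<Pi>\<^sub>M i\<in>{1..n}. (borel :: 'y measure))"
      by (auto simp: space_PiM expand_def PiE_iff)
    then have "(\<lambda>(v, \<mu>). ((expand n p (\<lambda>C. snd (z C)))(Suc n := v), add_points p z \<mu>))
        \<in> borel \<Otimes>\<^sub>M bfa \<rightarrow>\<^sub>M (\<Pi>\<^sub>M i\<in>insert (Suc n) {1..n}. borel) \<Otimes>\<^sub>M bfa"
      unfolding case_prod_beta
      by (intro measurable_Pair measurable_fun_upd[where J="{1..n}"] measurable_const measurable_add_points fin)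
         (auto simp: space_pair_measure)
    from measurable_compose[OF this F']
    have m: "(\<lambda>(v, \<mu>). F ((expand n p (\<lambda>C. snd (z C)))(Suc n := v)) (add_points p z \<mu>)) \<in> borel_measurable (borel \<Otimes>\<^sub>M bfa)"
      by (simp add: case_prod_beta)
    have "(\<integral>\<^sup>+\<mu>. \<integral>\<^sup>+v. F ((expand n p (\<lambda>C. snd (z C)))(Suc n := v)) (add_points p z \<mu>) \<partial>\<mu> \<partial>P) =
      (\<integral>\<^sup>+x. \<integral>\<^sup>+\<mu>. F ((expand n p (\<lambda>C. snd (z C)))(Suc n := snd x)) (add_points p z (add_points {()} (\<lambda>_. x) \<mu>)) \<partial>P \<partial>\<nu> 1)"
      by (rule mecke[OF m])
    also have "\<dots> = (\<integral>\<^sup>+x. I (z({Suc n} := x)) \<partial>block_intensity {Suc n})"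
      unfolding I_def eq block_intensity_def
      by (simp, intro nn_integral_cong) (simp add: at space_P)
    finally show "(\<integral>\<^sup>+x. I (z({Suc n} := x)) \<partial>block_intensity {Suc n}) =
      (\<integral>\<^sup>+\<mu>. \<integral>\<^sup>+v. F ((expand n p (\<lambda>C. snd (z C)))(Suc n := v)) (add_points p z \<mu>) \<partial>\<mu> \<partial>P)" ..
  qed
  finally show ?thesis ..
qed

text \<open>The observation that falls on the atom of the block C. The mass h(s) of the atom raises
  the power of h in the intensity of C by one, which gives the intensity of the enlarged block; the
  remaining work is to rename the coordinate.\<close>

lemma palm_insert_part:
  assumes p: "partition_on {1..n} p" and C: "C \<in> p"
    and F: "(\<lambda>(y, \<mu>). F y \<mu>) \<in> borel_measurable ((\<Pi>\<^sub>M i\<in>{1..Suc n}. borel) \<Otimes>\<^sub>M bfa)"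
  shows "(\<integral>\<^sup>+z. ennreal (h (fst (z C))) *
      (\<integral>\<^sup>+\<mu>. F ((expand n p (\<lambda>C. snd (z C)))(Suc n := snd (z C))) (add_points p z \<mu>) \<partial>P) \<partial>PiM p block_intensity)
    = palm (Suc n) (insert (insert (Suc n) C) (p - {C})) F"
proof -
  let ?D = "insert (Suc n) C"
  let ?q = "insert ?D (p - {C})"
  have s: "{1..Suc n} = insert (Suc n) {1..n}" by auto
  have q: "partition_on {1..Suc n} ?q" and new: "?D \<notin> p"
    unfolding s using partition_on_insert_part[OF p _ C] by auto
  have fin: "finite p" using p by (rule finite_partition)
  have F': "(\<lambda>(y, \<mu>). F y \<mu>) \<in> borel_measurable ((\<Pi>\<^sub>M i\<in>insert (Suc n) {1..n}. borel) \<Otimes>\<^sub>M bfa)"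
    using F by (simp only: s)
  \<comment> \<open>Blocks are nonempty and finite, so the maximum with 1 is inactive and the order
    really goes up by one.\<close>
  have cardC: "max 1 (card ?D) = Suc (max 1 (card C))"
  proof -
    have "C \<noteq> {}" using partition_on_part_nonempty[OF p C] .
    moreover have "C \<subseteq> {1..n}" using p C by (auto simp: partition_on_def)
    ultimately have "finite C" "card C > 0" "Suc n \<notin> C" using finite_subset[of C "{1..n}"] by (auto simp: card_gt_0_iff)
    then show ?thesis by simp
  qed
  have eq: "expand (Suc n) ?q (\<lambda>E. snd ((z(?D := x)) E)) = (expand n p (\<lambda>E. snd ((z(C := x)) E)))(Suc n := snd x)"
    for z :: "nat set \<Rightarrow> 's \<times> 'y" and x
  proof -
    have *: "(\<lambda>E. snd ((z(D := x)) E)) = (\<lambda>E. snd (z E))(D := snd x)" for D by (simp add: fun_eq_iff)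
    show ?thesis unfolding * by (rule expand_insert_part[OF p C])
  qed
  have at: "add_points ?q (z(?D := x)) \<mu> = add_points p (z(C := x)) \<mu>" for z x \<mu>
  proof -
    have sum: "(\<Sum>E\<in>?q. g ((z(?D := x)) E)) = (\<Sum>E\<in>p. g ((z(C := x)) E))" for g :: "_ \<Rightarrow> ennreal"
    proof -
      have "(\<Sum>E\<in>?q. g ((z(?D := x)) E)) = g x + (\<Sum>E\<in>p - {C}. g ((z(?D := x)) E))"
        using fin new by (subst sum.insert) auto
      also have "(\<Sum>E\<in>p - {C}. g ((z(?D := x)) E)) = (\<Sum>E\<in>p - {C}. g ((z(C := x)) E))"
        using new by (intro sum.cong) auto
      also have "g x + \<dots> = (\<Sum>E\<in>p. g ((z(C := x)) E))"
        using fin C by (subst sum.remove[of p C]) auto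
      finally show ?thesis .
    qed
    show ?thesis
      unfolding add_points_def add_atoms_def
      by (intro arg_cong[where f="measure_of UNIV (sets borel)"] ext arg_cong2[where f="(+)"] refl)
         (rule sum)
  qed
  define I where "I z = (\<integral>\<^sup>+\<mu>. F (expand (Suc n) ?q (\<lambda>E. snd (z E))) (add_points ?q z \<mu>) \<partial>P)" for z
  have I: "I \<in> borel_measurable (\<Pi>\<^sub>M E\<in>?q. borel \<Otimes>\<^sub>M borel)"
    unfolding I_def[abs_def]
    by (rule measurable_nn_integral_P, unfold case_prod_beta, rule measurable_palm_integrand[OF q _ _ F])
       (auto intro!: measurable_compose[OF measurable_fst] measurable_component_block)
  define K where "K z = (\<integral>\<^sup>+\<mu>. F ((expand n p (\<lambda>C. snd (z C)))(Suc n := snd (z C))) (add_points p z \<mu>) \<partial>P)" for z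
  have IK: "I (z(?D := x)) = K (z(C := x))" for z x
    unfolding I_def K_def eq at by simp
  have K: "K \<in> borel_measurable (\<Pi>\<^sub>M E\<in>p. borel \<Otimes>\<^sub>M borel)"
  proof -
    have "(\<lambda>(z, \<mu>). ((expand n p (\<lambda>C. snd (z C)))(Suc n := snd (z C)), add_points p z \<mu>))
        \<in> (\<Pi>\<^sub>M E\<in>p. borel \<Otimes>\<^sub>M borel) \<Otimes>\<^sub>M bfa \<rightarrow>\<^sub>M (\<Pi>\<^sub>M i\<in>insert (Suc n) {1..n}. borel) \<Otimes>\<^sub>M bfa"
      unfolding case_prod_beta using C
      by (intro measurable_Pair measurable_fun_upd[where J="{1..n}"] measurable_add_points fin measurable_expand[OF p])
         (auto intro!: measurable_compose[OF measurable_compose[OF measurable_fst measurable_component_block] measurable_snd]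
            measurable_compose[OF measurable_fst measurable_component_block])
    from measurable_compose[OF this F'] show ?thesis
      unfolding K_def[abs_def] by (intro measurable_nn_integral_P) (simp add: case_prod_beta)
  qed
  have pC: "p = insert C (p - {C})" "C \<notin> p - {C}" "finite (p - {C})" "?D \<notin> p - {C}" using C fin new by auto
  have "palm (Suc n) ?q F = (\<integral>\<^sup>+z. (\<integral>\<^sup>+x. I (z(?D := x)) \<partial>block_intensity ?D) \<partial>PiM (p - {C}) block_intensity)"
    unfolding palm_def I_def[symmetric]
    using I by (intro blocks.product_nn_integral_insert[OF pC(3,4)]) (simp add: measurable_cong_sets[OF sets_PiM_block_intensity refl])
  also have "\<dots> = (\<integral>\<^sup>+z. (\<integral>\<^sup>+x. ennreal (h (fst ((z(C := x)) C))) * K (z(C := x)) \<partial>block_intensity C) \<partial>PiM (p - {C}) block_intensity)"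
  proof (intro nn_integral_cong)
    fix z assume "z \<in> space (PiM (p - {C}) block_intensity)"
    then have z: "z \<in> space (\<Pi>\<^sub>M E\<in>p - {C}. borel \<Otimes>\<^sub>M borel)"
      using sets_eq_imp_space_eq[OF sets_PiM_block_intensity] by simp
    have K': "K \<in> borel_measurable (\<Pi>\<^sub>M E\<in>insert C (p - {C}). borel \<Otimes>\<^sub>M borel)"
      using K pC(1) by simp
    have "(\<lambda>x. z(C := x)) \<in> borel \<Otimes>\<^sub>M borel \<rightarrow>\<^sub>M (\<Pi>\<^sub>M E\<in>insert C (p - {C}). borel \<Otimes>\<^sub>M borel)"
      using z by (intro measurable_fun_upd[where J="p - {C}"] measurable_const) auto
    from measurable_compose[OF this K']
    have "(\<lambda>x. K (z(C := x))) \<in> borel_measurable (borel \<Otimes>\<^sub>M borel)" .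
    from nn_integral_\<nu>_Suc[OF this, of "max 1 (card C)"]
    show "(\<integral>\<^sup>+x. I (z(?D := x)) \<partial>block_intensity ?D) =
        (\<integral>\<^sup>+x. ennreal (h (fst ((z(C := x)) C))) * K (z(C := x)) \<partial>block_intensity C)"
      unfolding IK block_intensity_def cardC by simp
  qed
  also have "\<dots> = (\<integral>\<^sup>+z. ennreal (h (fst (z C))) * K z \<partial>PiM (insert C (p - {C})) block_intensity)"
  proof (rule blocks.product_nn_integral_insert[OF pC(3,2), symmetric])
    have "(\<lambda>z. ennreal (h (fst (z C))) * K z) \<in> borel_measurable (\<Pi>\<^sub>M E\<in>p. borel \<Otimes>\<^sub>M borel)"
      using measurable_compose[OF measurable_compose[OF measurable_component_block[OF C] measurable_fst] h] K by measurable
    then show "(\<lambda>z. ennreal (h (fst (z C))) * K z) \<in> borel_measurable (PiM (insert C (p - {C})) block_intensity)"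
      unfolding measurable_cong_sets[OF sets_PiM_block_intensity refl] pC(1)[symmetric] .
  qed
  finally show ?thesis unfolding K_def pC(1)[symmetric] ..
qed

text \<open>The last coordinate is integrated first, and the induction hypothesis is applied to the
  resulting function \<open>H\<close> of the other coordinates and \<mu>. The integral in
  \<open>H\<close> is against \<mu> itself, so once atoms have been added to \<mu> it splits into a
  part from the original measure and one term per atom.\<close>

theorem iterated_mecke:
  assumes "(\<lambda>(y, \<mu>). F y \<mu>) \<in> borel_measurable ((\<Pi>\<^sub>M i\<in>{1..n}. borel) \<Otimes>\<^sub>M bfa)"
  shows "(\<integral>\<^sup>+\<mu>. \<integral>\<^sup>+y. F y \<mu> \<partial>(\<Pi>\<^sub>M i\<in>{1..n}. \<mu>) \<partial>P) = (\<Sum>p | partition_on {1..n} p. palm n p F)"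
  using assms
proof (induction n arbitrary: F)
  case 0
  \<comment> \<open>Without coordinates the vector is constantly \<open>undefined\<close>, and the
    only partition is the empty one.\<close>
  have e: "expand 0 {} z = (\<lambda>_. undefined)" for z :: "nat set \<Rightarrow> 'y"
    by (simp add: expand_def fun_eq_iff)
  have a: "add_points {} z \<mu> = \<mu>" if "\<mu> \<in> boundedly_finite" for z :: "nat set \<Rightarrow> 's \<times> 'y" and \<mu>
  proof (rule measure_eqI)
    show "sets (add_points {} z \<mu>) = sets \<mu>"
      using boundedly_finite_sets[OF that] by (simp add: add_points_def)
    show "emeasure (add_points {} z \<mu>) A = emeasure \<mu> A" if "A \<in> sets (add_points {} z \<mu>)" for A
      using that emeasure_add_atoms[OF boundedly_finite_sets[OF \<open>\<mu> \<in> boundedly_finite\<close>] finite.emptyI, of A]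
      by (simp add: add_points_def)
  qed
  have "palm 0 {} F = (\<integral>\<^sup>+\<mu>. F (\<lambda>_. undefined) \<mu> \<partial>P)"
    unfolding palm_def e
    by (simp add: PiM_empty nn_integral_count_space_finite, intro nn_integral_cong) (simp add: a space_P)
  moreover have "{p. partition_on {1..0::nat} p} = {{}}"
    by (auto simp: partition_on_empty)
  ultimately show ?case by (simp add: PiM_empty nn_integral_count_space_finite)
next
  case (Suc n)
  have s: "{1..Suc n} = insert (Suc n) {1..n}" by auto
  have F: "(\<lambda>(y, \<mu>). F y \<mu>) \<in> borel_measurable ((\<Pi>\<^sub>M i\<in>insert (Suc n) {1..n}. borel) \<Otimes>\<^sub>M bfa)"
    using Suc.prems by (simp only: s)
  define H where "H y \<mu> = (\<integral>\<^sup>+v. F (y(Suc n := v)) \<mu> \<partial>\<mu>)" for y and \<mu> :: "'y measure"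
  have up: "(\<lambda>((y, \<mu>), v). (y(Suc n := v), \<mu>)) \<in> ((\<Pi>\<^sub>M i\<in>{1..n}. borel) \<Otimes>\<^sub>M bfa) \<Otimes>\<^sub>M borel
      \<rightarrow>\<^sub>M (\<Pi>\<^sub>M i\<in>insert (Suc n) {1..n}. (borel :: 'y measure)) \<Otimes>\<^sub>M bfa"
    unfolding case_prod_beta
    by (intro measurable_Pair measurable_fun_upd[where J="{1..n}"]
        measurable_compose[OF measurable_fst measurable_fst] measurable_compose[OF measurable_fst measurable_snd]) auto
  have H: "(\<lambda>(y, \<mu>). H y \<mu>) \<in> borel_measurable ((\<Pi>\<^sub>M i\<in>{1..n}. borel) \<Otimes>\<^sub>M bfa)"
    unfolding H_def
    using measurable_compose[OF up F] by (intro measurable_nn_integral_bfa) (simp add: case_prod_beta')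
  have "(\<integral>\<^sup>+\<mu>. \<integral>\<^sup>+y. F y \<mu> \<partial>(\<Pi>\<^sub>M i\<in>{1..Suc n}. \<mu>) \<partial>P) = (\<integral>\<^sup>+\<mu>. \<integral>\<^sup>+y. H y \<mu> \<partial>(\<Pi>\<^sub>M i\<in>{1..n}. \<mu>) \<partial>P)"
  proof (intro nn_integral_cong)
    fix \<mu> assume "\<mu> \<in> space P"
    then have \<mu>: "\<mu> \<in> boundedly_finite" by (simp add: space_P)
    interpret product_sigma_finite "\<lambda>_ :: nat. \<mu>"
      by (rule product_sigma_finite.intro) (rule sigma_finite_boundedly_finite[OF \<mu>])
    have "sets (\<Pi>\<^sub>M i\<in>insert (Suc n) {1..n}. \<mu>) = sets (\<Pi>\<^sub>M i\<in>insert (Suc n) {1..n}. (borel :: 'y measure))"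
      by (intro sets_PiM_cong refl boundedly_finite_sets[OF \<mu>])
    moreover have "(\<lambda>y. F y \<mu>) \<in> borel_measurable (\<Pi>\<^sub>M i\<in>insert (Suc n) {1..n}. borel)"
      using measurable_compose[OF measurable_Pair2'[of \<mu> bfa] F] \<mu> by simp
    ultimately have "(\<lambda>y. F y \<mu>) \<in> borel_measurable (\<Pi>\<^sub>M i\<in>insert (Suc n) {1..n}. \<mu>)"
      by (simp cong: measurable_cong_sets)
    then show "(\<integral>\<^sup>+y. F y \<mu> \<partial>(\<Pi>\<^sub>M i\<in>{1..Suc n}. \<mu>)) = (\<integral>\<^sup>+y. H y \<mu> \<partial>(\<Pi>\<^sub>M i\<in>{1..n}. \<mu>))"
      unfolding s H_def by (intro product_nn_integral_insert) auto
  qed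
  also have "\<dots> = (\<Sum>p | partition_on {1..n} p. palm n p H)"
    by (rule Suc.IH[OF H])
  also have "\<dots> = (\<Sum>p | partition_on {1..n} p. palm (Suc n) (insert {Suc n} p) F +
      (\<Sum>C\<in>p. palm (Suc n) (insert (insert (Suc n) C) (p - {C})) F))"
  proof (intro sum.cong refl)
    fix p assume "p \<in> {p. partition_on {1..n} p}"
    then have p: "partition_on {1..n} p" by simp
    have fin: "finite p" using p by (rule finite_partition)
    let ?Z = "\<Pi>\<^sub>M C\<in>p. (borel :: 's measure) \<Otimes>\<^sub>M (borel :: 'y measure)"
    define G where "G z \<mu> v = F ((expand n p (\<lambda>C. snd (z C)))(Suc n := v)) (add_points p z \<mu>)" for z \<mu> v
    have ex: "(\<lambda>z. expand n p (\<lambda>C. snd (z C))) \<in> ?Z \<rightarrow>\<^sub>M (\<Pi>\<^sub>M i\<in>{1..n}. borel)"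
      by (rule measurable_expand[OF p]) (rule measurable_compose[OF measurable_component_block measurable_snd])
    have G3: "(\<lambda>((z, \<mu>), v). G z \<mu> v) \<in> borel_measurable ((?Z \<Otimes>\<^sub>M bfa) \<Otimes>\<^sub>M borel)"
    proof -
      have "(\<lambda>((z, \<mu>), v). ((expand n p (\<lambda>C. snd (z C)))(Suc n := v), add_points p z \<mu>))
          \<in> (?Z \<Otimes>\<^sub>M bfa) \<Otimes>\<^sub>M borel \<rightarrow>\<^sub>M (\<Pi>\<^sub>M i\<in>insert (Suc n) {1..n}. borel) \<Otimes>\<^sub>M bfa"
        unfolding case_prod_beta
        by (intro measurable_Pair measurable_fun_upd[where J="{1..n}"] measurable_add_points fin
            measurable_compose[OF measurable_compose[OF measurable_fst measurable_fst] ex])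
           (auto intro!: measurable_compose[OF measurable_compose[OF measurable_fst measurable_fst] measurable_component_block])
      from measurable_compose[OF this F] show ?thesis by (simp add: G_def case_prod_beta')
    qed
    have Gint: "(\<lambda>(z, \<mu>). \<integral>\<^sup>+v. G z \<mu> v \<partial>\<mu>) \<in> borel_measurable (?Z \<Otimes>\<^sub>M bfa)"
      by (rule measurable_nn_integral_bfa[OF G3])
    have GC: "(\<lambda>(z, \<mu>). G z \<mu> (snd (z C))) \<in> borel_measurable (?Z \<Otimes>\<^sub>M bfa)" if "C \<in> p" for C
    proof -
      have "(\<lambda>x. (x, snd (fst x C))) \<in> ?Z \<Otimes>\<^sub>M bfa \<rightarrow>\<^sub>M (?Z \<Otimes>\<^sub>M bfa) \<Otimes>\<^sub>M borel"
        by (intro measurable_Pair measurable_ident_sets refl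
            measurable_compose[OF measurable_compose[OF measurable_fst measurable_component_block[OF that]] measurable_snd])
      from measurable_compose[OF this G3] show ?thesis by (simp add: case_prod_beta')
    qed
    \<comment> \<open>The first summand leads to a new singleton block, each term of the sum to the
      enlargement of an existing block.\<close>
    have HG: "H (expand n p (\<lambda>C. snd (z C))) (add_points p z \<mu>) =
        (\<integral>\<^sup>+v. G z \<mu> v \<partial>\<mu>) + (\<Sum>C\<in>p. ennreal (h (fst (z C))) * G z \<mu> (snd (z C)))"
      if z: "z \<in> space ?Z" and \<mu>: "\<mu> \<in> boundedly_finite" for z \<mu>
    proof -
      have "(\<lambda>v. ((z, \<mu>), v)) \<in> borel \<rightarrow>\<^sub>M (?Z \<Otimes>\<^sub>M bfa) \<Otimes>\<^sub>M borel"
        using z \<mu> by (intro measurable_Pair1') (simp add: space_pair_measure)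
      from measurable_compose[OF this G3] have "G z \<mu> \<in> borel_measurable borel" by simp
      then show ?thesis
        unfolding H_def G_def[symmetric] by (rule nn_integral_add_points[OF fin \<mu>])
    qed
    have spZ: "space (PiM p block_intensity) = space ?Z"
      by (rule sets_eq_imp_space_eq[OF sets_PiM_block_intensity])
    have mZ: "borel_measurable (PiM p block_intensity) = borel_measurable ?Z"
      by (rule measurable_cong_sets[OF sets_PiM_block_intensity refl])
    have hC: "(\<lambda>z. ennreal (h (fst (z C)))) \<in> borel_measurable ?Z" if "C \<in> p" for C
      using measurable_compose[OF measurable_compose[OF measurable_component_block[OF that] measurable_fst] h] by measurable
    have slice: "(\<lambda>\<mu>. f z \<mu>) \<in> borel_measurable P"
      if "(\<lambda>(z, \<mu>). f z \<mu>) \<in> borel_measurable (?Z \<Otimes>\<^sub>M bfa)" "z \<in> space ?Z" for f z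
      using measurable_compose[OF measurable_Pair1'[OF that(2)] that(1)] by (simp add: measurable_P)
    have "palm n p H = (\<integral>\<^sup>+z. (\<integral>\<^sup>+\<mu>. \<integral>\<^sup>+v. G z \<mu> v \<partial>\<mu> \<partial>P) +
        (\<Sum>C\<in>p. ennreal (h (fst (z C))) * (\<integral>\<^sup>+\<mu>. G z \<mu> (snd (z C)) \<partial>P)) \<partial>PiM p block_intensity)"
      unfolding palm_def
    proof (intro nn_integral_cong)
      fix z assume "z \<in> space (PiM p block_intensity)"
      then have z: "z \<in> space ?Z" by (simp add: spZ)
      have "(\<integral>\<^sup>+\<mu>. H (expand n p (\<lambda>C. snd (z C))) (add_points p z \<mu>) \<partial>P)
          = (\<integral>\<^sup>+\<mu>. (\<integral>\<^sup>+v. G z \<mu> v \<partial>\<mu>) + (\<Sum>C\<in>p. ennreal (h (fst (z C))) * G z \<mu> (snd (z C))) \<partial>P)"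
        using HG[OF z] by (intro nn_integral_cong) (simp add: space_P)
      also have "\<dots> = (\<integral>\<^sup>+\<mu>. \<integral>\<^sup>+v. G z \<mu> v \<partial>\<mu> \<partial>P) + (\<integral>\<^sup>+\<mu>. (\<Sum>C\<in>p. ennreal (h (fst (z C))) * G z \<mu> (snd (z C))) \<partial>P)"
        using slice[OF Gint z] slice[OF GC z]
        by (intro nn_integral_add borel_measurable_sum borel_measurable_times_ennreal borel_measurable_const) auto
      also have "(\<integral>\<^sup>+\<mu>. (\<Sum>C\<in>p. ennreal (h (fst (z C))) * G z \<mu> (snd (z C))) \<partial>P)
          = (\<Sum>C\<in>p. ennreal (h (fst (z C))) * (\<integral>\<^sup>+\<mu>. G z \<mu> (snd (z C)) \<partial>P))"
        using slice[OF GC z]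
        by (subst nn_integral_sum) (auto intro!: borel_measurable_times_ennreal sum.cong nn_integral_cmult)
      finally show "(\<integral>\<^sup>+\<mu>. H (expand n p (\<lambda>C. snd (z C))) (add_points p z \<mu>) \<partial>P) =
          (\<integral>\<^sup>+\<mu>. \<integral>\<^sup>+v. G z \<mu> v \<partial>\<mu> \<partial>P) + (\<Sum>C\<in>p. ennreal (h (fst (z C))) * (\<integral>\<^sup>+\<mu>. G z \<mu> (snd (z C)) \<partial>P))" .
    qed
    also have "\<dots> = (\<integral>\<^sup>+z. (\<integral>\<^sup>+\<mu>. \<integral>\<^sup>+v. G z \<mu> v \<partial>\<mu> \<partial>P) \<partial>PiM p block_intensity) +
        (\<integral>\<^sup>+z. (\<Sum>C\<in>p. ennreal (h (fst (z C))) * (\<integral>\<^sup>+\<mu>. G z \<mu> (snd (z C)) \<partial>P)) \<partial>PiM p block_intensity)"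
      unfolding mZ using hC
      by (intro nn_integral_add)
         (auto simp: mZ intro!: borel_measurable_sum borel_measurable_times_ennreal measurable_nn_integral_P Gint GC)
    also have "(\<integral>\<^sup>+z. (\<Sum>C\<in>p. ennreal (h (fst (z C))) * (\<integral>\<^sup>+\<mu>. G z \<mu> (snd (z C)) \<partial>P)) \<partial>PiM p block_intensity)
        = (\<Sum>C\<in>p. \<integral>\<^sup>+z. ennreal (h (fst (z C))) * (\<integral>\<^sup>+\<mu>. G z \<mu> (snd (z C)) \<partial>P) \<partial>PiM p block_intensity)"
      using hC
      by (intro nn_integral_sum)
         (auto simp: mZ intro!: borel_measurable_times_ennreal measurable_nn_integral_P GC)
    also have "\<dots> = (\<Sum>C\<in>p. palm (Suc n) (insert (insert (Suc n) C) (p - {C})) F)"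
      unfolding G_def by (intro sum.cong refl palm_insert_part[OF p _ Suc.prems])
    also have "(\<integral>\<^sup>+z. (\<integral>\<^sup>+\<mu>. \<integral>\<^sup>+v. G z \<mu> v \<partial>\<mu> \<partial>P) \<partial>PiM p block_intensity) = palm (Suc n) (insert {Suc n} p) F"
      unfolding G_def by (rule palm_insert_singleton[OF p Suc.prems])
    finally show "palm n p H = palm (Suc n) (insert {Suc n} p) F +
        (\<Sum>C\<in>p. palm (Suc n) (insert (insert (Suc n) C) (p - {C})) F)" .
  qed
  also have "\<dots> = (\<Sum>q | partition_on {1..Suc n} q. palm (Suc n) q F)"
    unfolding s by (rule sum_partition_on_insert[symmetric]) auto
  finally show ?case .
qed

end

section \<open>Products of \<open>\<sigma>\<close>-finite measures\<close>

text \<open>Integrating coordinate i first annihilates the exceptional set. The other factors may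
  have infinite mass, since the integral of 0 is still 0.\<close>

lemma (in product_sigma_finite) AE_PiM_component_finite:
  assumes I: "finite I" "i \<in> I" and Q: "AE x in M i. Q x"
  shows "AE z in PiM I M. Q (z i)"
proof -
  obtain N where N: "{x\<in>space (M i). \<not> Q x} \<subseteq> N" "N \<in> sets (M i)" "emeasure (M i) N = 0"
    using AE_E[OF Q] by metis
  have comp: "(\<lambda>z. z i) \<in> PiM I M \<rightarrow>\<^sub>M M i" using I(2) by (rule measurable_component_singleton)
  have m: "(\<lambda>z. indicator N (z i) :: ennreal) \<in> borel_measurable (PiM I M)"
    by (rule measurable_compose[OF comp borel_measurable_indicator[OF N(2)]])
  have ins: "insert i (I - {i}) = I" using I by auto
  have "(\<integral>\<^sup>+z. indicator N (z i) \<partial>PiM I M) = (\<integral>\<^sup>+z. (\<integral>\<^sup>+x. indicator N x \<partial>M i) \<partial>PiM (I - {i}) M)"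
    using product_nn_integral_insert[of "I - {i}" i "\<lambda>z. indicator N (z i)", unfolded ins, OF _ _ m] I by simp
  also have "\<dots> = 0" using N by simp
  finally have "AE z in PiM I M. indicator N (z i) = (0::ennreal)"
    using nn_integral_0_iff_AE[OF m] by simp
  then show ?thesis
  proof (rule AE_mp, intro AE_I2 impI)
    fix z assume "z \<in> space (PiM I M)" "indicator N (z i) = (0::ennreal)"
    then show "Q (z i)" using N(1) measurable_space[OF comp] by (auto simp: indicator_def split: if_splits)
  qed
qed

text \<open>With coordinate i innermost, the section of the event z(i) = z(j) is a single point,
  which \<open>M i\<close> does not charge. The event is expressed through the distance, which makes
  it measurable.\<close>

lemma AE_PiM_distinct:
  fixes M :: "'i \<Rightarrow> 'a::{second_countable_topology, metric_space} measure"
  assumes M: "product_sigma_finite M" and I: "finite I" "i \<in> I" "j \<in> I" "i \<noteq> j"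
    and s: "\<And>i. i \<in> I \<Longrightarrow> sets (M i) = sets borel"
    and na: "\<And>v. emeasure (M i) {v} = 0"
  shows "AE z in PiM I M. z i \<noteq> z j"
proof -
  interpret product_sigma_finite M by fact
  have comp: "(\<lambda>z. z k) \<in> borel_measurable (PiM I M)" if "k \<in> I" for k
    using measurable_component_singleton[OF that, of M] measurable_cong_sets[OF refl s[OF that]] by blast
  have m: "(\<lambda>z. indicator {0} (dist (z i) (z j)) :: ennreal) \<in> borel_measurable (PiM I M)"
    using comp[OF I(2)] comp[OF I(3)] by measurable
  have ins: "insert i (I - {i}) = I" using I by auto
  have "(\<integral>\<^sup>+z. indicator {0} (dist (z i) (z j)) \<partial>PiM I M)
      = (\<integral>\<^sup>+z. (\<integral>\<^sup>+x. indicator {0} (dist x (z j)) \<partial>M i) \<partial>PiM (I - {i}) M)"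
    using product_nn_integral_insert[of "I - {i}" i "\<lambda>z. indicator {0} (dist (z i) (z j))", unfolded ins, OF _ _ m] I
    by simp
  also have "\<dots> = (\<integral>\<^sup>+z. 0 \<partial>PiM (I - {i}) M)"
  proof (intro nn_integral_cong)
    fix z
    have "(\<integral>\<^sup>+x. indicator {0} (dist x (z j)) \<partial>M i) = (\<integral>\<^sup>+x. indicator {z j} x \<partial>M i)"
      by (intro nn_integral_cong) (auto simp: indicator_def)
    also have "\<dots> = 0" using na s[OF I(2)] by simp
    finally show "(\<integral>\<^sup>+x. indicator {0} (dist x (z j)) \<partial>M i) = 0" .
  qed
  finally have "AE z in PiM I M. indicator {0} (dist (z i) (z j)) = (0::ennreal)"
    using nn_integral_0_iff_AE[OF m] by simp
  then show ?thesis by eventually_elim (auto simp: indicator_def)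
qed

text \<open>Each factor, weighted by f, splits into a constant, a measure for the second coordinate
  and a kernel for the first. In the product all second coordinates can be integrated outermost;
  given them, the first coordinates are governed by a product of kernels.\<close>

lemma nn_integral_PiM_disintegrate:
  fixes M :: "'i \<Rightarrow> ('s::topological_space \<times> 'y::topological_space) measure"
    and f :: "'i \<Rightarrow> 's \<times> 'y \<Rightarrow> ennreal" and k :: "'i \<Rightarrow> 'y \<Rightarrow> 's measure"
  assumes M: "product_sigma_finite M" "\<And>i. sets (M i) = sets (borel \<Otimes>\<^sub>M borel)"
    and B: "product_sigma_finite B" "\<And>i. sets (B i) = sets borel"
    and k: "\<And>i. s_finite_kernel borel borel (k i)" "\<And>i v. sigma_finite_measure (k i v)"
    and f: "\<And>i. f i \<in> borel_measurable (borel \<Otimes>\<^sub>M borel)"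
    and I: "finite I"
    and dis: "\<And>i g. i \<in> I \<Longrightarrow> g \<in> borel_measurable (borel \<Otimes>\<^sub>M borel) \<Longrightarrow>
       (\<integral>\<^sup>+z. f i z * g z \<partial>M i) = c i * (\<integral>\<^sup>+v. \<integral>\<^sup>+s. g (s, v) \<partial>k i v \<partial>B i)"
    and G: "G \<in> borel_measurable (\<Pi>\<^sub>M i\<in>I. borel \<Otimes>\<^sub>M borel)"
  shows "(\<integral>\<^sup>+z. (\<Prod>i\<in>I. f i (z i)) * G z \<partial>PiM I M) =
    (\<Prod>i\<in>I. c i) * (\<integral>\<^sup>+v. \<integral>\<^sup>+s. G (\<lambda>i\<in>I. (s i, v i)) \<partial>(\<Pi>\<^sub>M i\<in>I. k i (v i)) \<partial>PiM I B)"
  using I dis G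
proof (induction I arbitrary: G rule: finite_induct)
  case empty
  then show ?case by (simp add: PiM_empty nn_integral_count_space_finite restrict_def)
next
  case (insert i I)
  interpret M: product_sigma_finite M by fact
  interpret B: product_sigma_finite B by fact
  let ?E = "(borel :: 's measure) \<Otimes>\<^sub>M (borel :: 'y measure)"
  note Gm = insert.prems(2)
  have sM: "sets (PiM J M) = sets (\<Pi>\<^sub>M i\<in>J. ?E)" for J by (intro sets_PiM_cong refl M(2))
  have sB: "sets (PiM J B) = sets (\<Pi>\<^sub>M i\<in>J. (borel :: 'y measure))" for J by (intro sets_PiM_cong refl B(2))
  have sk: "sets (k j v) = sets borel" for j v using s_finite_kernel_sets[OF k(1)] by simp
  have sK: "sets (\<Pi>\<^sub>M j\<in>J. k j (v j)) = sets (\<Pi>\<^sub>M i\<in>J. (borel :: 's measure))" for J v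
    by (intro sets_PiM_cong refl sk)
  have psf: "product_sigma_finite (\<lambda>j. k j (v j))" for v by (rule product_sigma_finite.intro) (rule k(2))
  have up: "(\<lambda>(z, x). z(i := x)) \<in> (\<Pi>\<^sub>M i\<in>I. ?E) \<Otimes>\<^sub>M ?E \<rightarrow>\<^sub>M (\<Pi>\<^sub>M i\<in>insert i I. ?E)"
    unfolding case_prod_beta by (intro measurable_fun_upd[where J=I]) auto
  have fP: "(\<lambda>z. \<Prod>j\<in>J. f j (z j)) \<in> borel_measurable (\<Pi>\<^sub>M i\<in>J. ?E)" for J
  proof (rule borel_measurable_prod_ennreal)
    show "(\<lambda>z. f j (z j)) \<in> borel_measurable (\<Pi>\<^sub>M i\<in>J. ?E)" if "j \<in> J" for j
      using that by (intro measurable_compose[OF _ f[of j]] measurable_component_singleton)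
  qed
  \<comment> \<open>The integral over the new factor as a function of the remaining pairs; the
    induction hypothesis is applied to it in place of G.\<close>
  define g where "g z = (\<integral>\<^sup>+v. \<integral>\<^sup>+s. G (z(i := (s, v))) \<partial>k i v \<partial>B i)" for z
  have inner: "(\<lambda>x. \<integral>\<^sup>+s. G ((fst x)(i := (s, snd x))) \<partial>k i (snd x)) \<in> borel_measurable ((\<Pi>\<^sub>M i\<in>I. ?E) \<Otimes>\<^sub>M borel)"
  proof (rule s_finite_kernel_nn_integral[OF k(1) measurable_snd])
    have "(\<lambda>(x, s). (fst x, (s, snd x))) \<in> ((\<Pi>\<^sub>M i\<in>I. ?E) \<Otimes>\<^sub>M borel) \<Otimes>\<^sub>M borel \<rightarrow>\<^sub>M (\<Pi>\<^sub>M i\<in>I. ?E) \<Otimes>\<^sub>M ?E"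
      by measurable
    from measurable_compose[OF measurable_compose[OF this up] Gm]
    show "(\<lambda>(x, s). G ((fst x)(i := (s, snd x)))) \<in> borel_measurable (((\<Pi>\<^sub>M i\<in>I. ?E) \<Otimes>\<^sub>M borel) \<Otimes>\<^sub>M borel)"
      by (simp only: case_prod_beta' fst_conv snd_conv)
  qed
  have inner': "(\<lambda>x. \<integral>\<^sup>+s. G ((fst x)(i := (s, snd x))) \<partial>k i (snd x)) \<in> borel_measurable ((\<Pi>\<^sub>M i\<in>I. ?E) \<Otimes>\<^sub>M B i)"
    using inner by (simp add: measurable_cong_sets[OF sets_pair_measure_cong[OF refl B(2)] refl])
  have g: "g \<in> borel_measurable (\<Pi>\<^sub>M i\<in>I. ?E)"
    using sigma_finite_measure.borel_measurable_nn_integral_fst[OF B.sigma_finite_measures inner'] by (simp add: g_def[abs_def])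
  have "(\<integral>\<^sup>+z. (\<Prod>j\<in>insert i I. f j (z j)) * G z \<partial>PiM (insert i I) M)
      = (\<integral>\<^sup>+z. (\<integral>\<^sup>+x. (\<Prod>j\<in>insert i I. f j ((z(i := x)) j)) * G (z(i := x)) \<partial>M i) \<partial>PiM I M)"
    by (rule M.product_nn_integral_insert[OF insert.hyps(1,2)])
       (simp only: measurable_cong_sets[OF sM refl], intro borel_measurable_times_ennreal fP Gm)
  also have "\<dots> = (\<integral>\<^sup>+z. (\<Prod>j\<in>I. f j (z j)) * (c i * g z) \<partial>PiM I M)"
  proof (intro nn_integral_cong)
    fix z assume "z \<in> space (PiM I M)"
    then have z: "z \<in> space (\<Pi>\<^sub>M i\<in>I. ?E)" using sets_eq_imp_space_eq[OF sM] by simp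
    have Gz: "(\<lambda>x. G (z(i := x))) \<in> borel_measurable ?E"
      using measurable_compose[OF measurable_compose[OF measurable_Pair1'[OF z] up] Gm] by (simp only: prod.case)
    have "(\<Prod>j\<in>insert i I. f j ((z(i := x)) j)) = (\<Prod>j\<in>I. f j (z j)) * f i x" for x
    proof -
      have "(\<Prod>j\<in>I. f j ((z(i := x)) j)) = (\<Prod>j\<in>I. f j (z j))"
        using insert.hyps(2) by (intro prod.cong) auto
      then show ?thesis using insert.hyps by (simp add: mult.commute)
    qed
    then have "(\<integral>\<^sup>+x. (\<Prod>j\<in>insert i I. f j ((z(i := x)) j)) * G (z(i := x)) \<partial>M i)
        = (\<integral>\<^sup>+x. (\<Prod>j\<in>I. f j (z j)) * (f i x * G (z(i := x))) \<partial>M i)"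
      by (simp only: mult.assoc)
    also have "\<dots> = (\<Prod>j\<in>I. f j (z j)) * (\<integral>\<^sup>+x. f i x * G (z(i := x)) \<partial>M i)"
      using Gz f by (intro nn_integral_cmult) (simp add: measurable_cong_sets[OF M(2) refl])
    also have "(\<integral>\<^sup>+x. f i x * G (z(i := x)) \<partial>M i) = c i * g z"
      unfolding g_def by (rule insert.prems(1)[OF insertI1 Gz])
    finally show "(\<integral>\<^sup>+x. (\<Prod>j\<in>insert i I. f j ((z(i := x)) j)) * G (z(i := x)) \<partial>M i)
        = (\<Prod>j\<in>I. f j (z j)) * (c i * g z)" .
  qed
  also have "\<dots> = (\<integral>\<^sup>+z. c i * ((\<Prod>j\<in>I. f j (z j)) * g z) \<partial>PiM I M)"
    by (simp only: mult.left_commute)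
  also have "\<dots> = c i * (\<integral>\<^sup>+z. (\<Prod>j\<in>I. f j (z j)) * g z \<partial>PiM I M)"
    by (rule nn_integral_cmult) (simp only: measurable_cong_sets[OF sM refl], intro borel_measurable_times_ennreal fP g)
  also have "(\<integral>\<^sup>+z. (\<Prod>j\<in>I. f j (z j)) * g z \<partial>PiM I M) =
      (\<Prod>j\<in>I. c j) * (\<integral>\<^sup>+v. \<integral>\<^sup>+s. g (\<lambda>j\<in>I. (s j, v j)) \<partial>(\<Pi>\<^sub>M j\<in>I. k j (v j)) \<partial>PiM I B)"
    using insert.prems(1) by (intro insert.IH g) auto
  also have "(\<integral>\<^sup>+v. \<integral>\<^sup>+s. g (\<lambda>j\<in>I. (s j, v j)) \<partial>(\<Pi>\<^sub>M j\<in>I. k j (v j)) \<partial>PiM I B)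
      = (\<integral>\<^sup>+v. \<integral>\<^sup>+u. (\<integral>\<^sup>+s. G (\<lambda>j\<in>insert i I. (s j, (v(i := u)) j)) \<partial>(\<Pi>\<^sub>M j\<in>insert i I. k j ((v(i := u)) j))) \<partial>B i \<partial>PiM I B)"
  proof (intro nn_integral_cong)
    fix v assume "v \<in> space (PiM I B)"
    interpret K: product_sigma_finite "\<lambda>j. k j (v j)" by (rule psf)
    interpret KI: sigma_finite_measure "\<Pi>\<^sub>M j\<in>I. k j (v j)" by (rule K.sigma_finite[OF insert.hyps(1)])
    interpret pair_sigma_finite "\<Pi>\<^sub>M j\<in>I. k j (v j)" "B i" ..
    have pr: "(\<lambda>s. \<lambda>j\<in>I. (s j, v j)) \<in> (\<Pi>\<^sub>M j\<in>I. (borel :: 's measure)) \<rightarrow>\<^sub>M (\<Pi>\<^sub>M j\<in>I. ?E)"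
      by (intro measurable_restrict measurable_Pair measurable_component_singleton measurable_const) auto
    have upd: "(\<lambda>j\<in>insert i I. ((s(i := t)) j, (v(i := u)) j)) = (\<lambda>j\<in>I. (s j, v j))(i := (t, u))" for s t u
      using insert.hyps(2) by (auto simp: fun_eq_iff)
    have "(\<lambda>x. (\<lambda>j\<in>I. (fst x j, v j), snd x)) \<in> (\<Pi>\<^sub>M j\<in>I. (borel :: 's measure)) \<Otimes>\<^sub>M borel \<rightarrow>\<^sub>M (\<Pi>\<^sub>M j\<in>I. ?E) \<Otimes>\<^sub>M (borel :: 'y measure)"
      by (intro measurable_Pair measurable_compose[OF measurable_fst pr] measurable_snd)
    from measurable_compose[OF this inner]
    have m: "(\<lambda>x. \<integral>\<^sup>+t. G ((\<lambda>j\<in>I. (fst x j, v j))(i := (t, snd x))) \<partial>k i (snd x)) \<in> borel_measurable ((\<Pi>\<^sub>M j\<in>I. k j (v j)) \<Otimes>\<^sub>M B i)"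
      by (simp add: measurable_cong_sets[OF sets_pair_measure_cong[OF sK B(2)] refl])
    have "(\<integral>\<^sup>+s. g (\<lambda>j\<in>I. (s j, v j)) \<partial>(\<Pi>\<^sub>M j\<in>I. k j (v j))) =
      (\<integral>\<^sup>+s. \<integral>\<^sup>+u. \<integral>\<^sup>+t. G ((\<lambda>j\<in>I. (s j, v j))(i := (t, u))) \<partial>k i u \<partial>B i \<partial>(\<Pi>\<^sub>M j\<in>I. k j (v j)))"
      by (simp add: g_def)
    \<comment> \<open>Fubini moves the second coordinate u of the new factor outside the first
      coordinates s of the old factors, whose kernels do not depend on u.\<close>
    also have "\<dots> = (\<integral>\<^sup>+u. \<integral>\<^sup>+s. \<integral>\<^sup>+t. G ((\<lambda>j\<in>I. (s j, v j))(i := (t, u))) \<partial>k i u \<partial>(\<Pi>\<^sub>M j\<in>I. k j (v j)) \<partial>B i)"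
      using Fubini'[of "\<lambda>s u. \<integral>\<^sup>+t. G ((\<lambda>j\<in>I. (s j, v j))(i := (t, u))) \<partial>k i u"] m
      by (simp add: case_prod_beta')
    also have "\<dots> = (\<integral>\<^sup>+u. (\<integral>\<^sup>+s. G (\<lambda>j\<in>insert i I. (s j, (v(i := u)) j)) \<partial>(\<Pi>\<^sub>M j\<in>insert i I. k j ((v(i := u)) j))) \<partial>B i)"
    proof (intro nn_integral_cong)
      fix u
      interpret K': product_sigma_finite "\<lambda>j. k j ((v(i := u)) j)" by (rule psf)
      have "(\<lambda>s. \<lambda>j\<in>insert i I. (s j, (v(i := u)) j)) \<in> (\<Pi>\<^sub>M j\<in>insert i I. (borel :: 's measure)) \<rightarrow>\<^sub>M (\<Pi>\<^sub>M j\<in>insert i I. ?E)"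
        by (intro measurable_restrict measurable_Pair measurable_component_singleton measurable_const) auto
      from measurable_compose[OF this Gm]
      have "(\<lambda>s. G (\<lambda>j\<in>insert i I. (s j, (v(i := u)) j))) \<in> borel_measurable (\<Pi>\<^sub>M j\<in>insert i I. k j ((v(i := u)) j))"
        unfolding measurable_cong_sets[OF sK refl] .
      from K'.product_nn_integral_insert[OF insert.hyps(1,2) this]
      have "(\<integral>\<^sup>+s. G (\<lambda>j\<in>insert i I. (s j, (v(i := u)) j)) \<partial>(\<Pi>\<^sub>M j\<in>insert i I. k j ((v(i := u)) j))) =
        (\<integral>\<^sup>+s. \<integral>\<^sup>+t. G ((\<lambda>j\<in>I. (s j, v j))(i := (t, u))) \<partial>k i u \<partial>(\<Pi>\<^sub>M j\<in>I. k j ((v(i := u)) j)))"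
        unfolding upd by simp
      also have "(\<Pi>\<^sub>M j\<in>I. k j ((v(i := u)) j)) = (\<Pi>\<^sub>M j\<in>I. k j (v j))"
        using insert.hyps(2) by (intro PiM_cong) auto
      finally show "(\<integral>\<^sup>+s. \<integral>\<^sup>+t. G ((\<lambda>j\<in>I. (s j, v j))(i := (t, u))) \<partial>k i u \<partial>(\<Pi>\<^sub>M j\<in>I. k j (v j))) =
        (\<integral>\<^sup>+s. G (\<lambda>j\<in>insert i I. (s j, (v(i := u)) j)) \<partial>(\<Pi>\<^sub>M j\<in>insert i I. k j ((v(i := u)) j)))" ..
    qed
    finally show "(\<integral>\<^sup>+s. g (\<lambda>j\<in>I. (s j, v j)) \<partial>(\<Pi>\<^sub>M j\<in>I. k j (v j))) =
      (\<integral>\<^sup>+u. (\<integral>\<^sup>+s. G (\<lambda>j\<in>insert i I. (s j, (v(i := u)) j)) \<partial>(\<Pi>\<^sub>M j\<in>insert i I. k j ((v(i := u)) j))) \<partial>B i)" .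
  qed
  also have "\<dots> = (\<integral>\<^sup>+v. (\<integral>\<^sup>+s. G (\<lambda>j\<in>insert i I. (s j, v j)) \<partial>(\<Pi>\<^sub>M j\<in>insert i I. k j (v j))) \<partial>PiM (insert i I) B)"
  proof (rule B.product_nn_integral_insert[OF insert.hyps(1,2), symmetric])
    have "(\<lambda>v. \<integral>\<^sup>+s. G (\<lambda>j\<in>insert i I. (s j, v j)) \<partial>(\<Pi>\<^sub>M j\<in>insert i I. k j (v j)))
        \<in> borel_measurable (\<Pi>\<^sub>M j\<in>insert i I. (borel :: 'y measure))"
    proof (rule nn_integral_PiM_kernel)
      show "finite (insert i I)" using insert.hyps by simp
      show "s_finite_kernel (\<Pi>\<^sub>M j\<in>insert i I. (borel :: 'y measure)) borel (\<lambda>v. k j (v j))" if "j \<in> insert i I" for j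
        by (rule s_finite_kernel_compose[OF k(1) measurable_component_singleton[OF that]])
      show "sigma_finite_measure (k j (v j))" for j v by (rule k(2))
      have "(\<lambda>x. \<lambda>j\<in>insert i I. (snd x j, fst x j)) \<in> (\<Pi>\<^sub>M j\<in>insert i I. (borel :: 'y measure)) \<Otimes>\<^sub>M (\<Pi>\<^sub>M j\<in>insert i I. (borel :: 's measure))
         \<rightarrow>\<^sub>M (\<Pi>\<^sub>M j\<in>insert i I. ?E)"
        by (intro measurable_restrict measurable_Pair measurable_compose[OF measurable_fst measurable_component_singleton]
             measurable_compose[OF measurable_snd measurable_component_singleton])
      from measurable_compose[OF this Gm]
      show "(\<lambda>(v, s). G (\<lambda>j\<in>insert i I. (s j, v j))) \<in>
         borel_measurable ((\<Pi>\<^sub>M j\<in>insert i I. (borel :: 'y measure)) \<Otimes>\<^sub>M (\<Pi>\<^sub>M j\<in>insert i I. (borel :: 's measure)))"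
        by (simp only: case_prod_beta')
    qed
    then show "(\<lambda>v. \<integral>\<^sup>+s. G (\<lambda>j\<in>insert i I. (s j, v j)) \<partial>(\<Pi>\<^sub>M j\<in>insert i I. k j (v j)))
        \<in> borel_measurable (PiM (insert i I) B)"
      unfolding measurable_cong_sets[OF sB refl] .
  qed
  finally show ?case by (simp only: prod.insert[OF insert.hyps(1,2)] mult.assoc)
qed

section \<open>Distinct values of an expanded vector\<close>

text \<open>Injectivity keeps two blocks from merging; with equal values on two blocks the ties
  would be coarser than p.\<close>

lemma ties_expand:
  assumes p: "partition_on {1..n} p" and inj: "inj_on v p"
  shows "ties n (expand n p v) = p"
proof -
  have block: "{i\<in>{1..n}. expand n p v i = v C} = C" if C: "C \<in> p" for C
  proof (intro equalityI subsetI)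
    fix i assume i: "i \<in> {i\<in>{1..n}. expand n p v i = v C}"
    then obtain D where D: "D \<in> p" "i \<in> D" using partition_on_obtain_part[OF p, of i] by auto
    have "expand n p v i = v C" using i by simp
    then have "v D = v C" using expand_apply[OF p D, of v] by simp
    then have "D = C" using inj D C by (auto dest: inj_onD)
    then show "i \<in> C" using D by simp
  next
    fix i assume "i \<in> C"
    moreover have "\<Union> p = {1..n}" using p by (simp add: partition_on_def)
    ultimately show "i \<in> {i\<in>{1..n}. expand n p v i = v C}"
      using C expand_apply[OF p C, of i] by auto
  qed
  have "expand n p v ` {1..n} = v ` p"
  proof (intro equalityI subsetI)
    fix x assume "x \<in> expand n p v ` {1..n}"
    then obtain i where i: "i \<in> {1..n}" "x = expand n p v i" by auto
    obtain C where "C \<in> p" "i \<in> C" using partition_on_obtain_part[OF p i(1)] by metis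
    then show "x \<in> v ` p" using i expand_apply[OF p] by auto
  next
    fix x assume "x \<in> v ` p"
    then obtain C where C: "C \<in> p" "x = v C" by auto
    obtain i where i: "i \<in> C" using partition_on_part_nonempty[OF p C(1)] by auto
    then have "i \<in> {1..n}" using block[OF C(1)] by auto
    then show "x \<in> expand n p v ` {1..n}" using C i expand_apply[OF p C(1) i] by (metis imageI)
  qed
  then have "ties n (expand n p v) = (\<lambda>C. {i\<in>{1..n}. expand n p v i = v C}) ` p"
    by (simp add: ties_def image_image)
  also have "\<dots> = (\<lambda>C. C) ` p" by (rule image_cong[OF refl block])
  finally show ?thesis by simp
qed

lemma partition_on_ties: "partition_on {1..n} (ties n y)"
proof (rule partition_onI')
  show "\<Union> (ties n y) = {1..n}" by (auto simp: ties_def)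
qed (auto simp: ties_def)

text \<open>Comparison of the ties with a fixed partition is reduced to finitely many conditions on
  pairs of coordinates, each of which is measurable.\<close>

lemma ties_eq_iff:
  assumes q: "partition_on {1..n} q"
  shows "ties n y = q \<longleftrightarrow> (\<forall>i\<in>{1..n}. \<forall>j\<in>{1..n}. y i = y j \<longleftrightarrow> (\<exists>C\<in>q. i \<in> C \<and> j \<in> C))"
proof
  assume q: "ties n y = q"
  show "\<forall>i\<in>{1..n}. \<forall>j\<in>{1..n}. y i = y j \<longleftrightarrow> (\<exists>C\<in>q. i \<in> C \<and> j \<in> C)"
    by (auto simp: ties_def q[symmetric])
next
  assume *: "\<forall>i\<in>{1..n}. \<forall>j\<in>{1..n}. y i = y j \<longleftrightarrow> (\<exists>C\<in>q. i \<in> C \<and> j \<in> C)"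
  have U: "\<Union> q = {1..n}" using q by (simp add: partition_on_def)
  have block: "{j\<in>{1..n}. y j = y i} = C" if "C \<in> q" "i \<in> C" for C i
  proof -
    have i: "i \<in> {1..n}" using that U by auto
    have "y j = y i \<longleftrightarrow> j \<in> C" if j: "j \<in> {1..n}" for j
      using * i j partition_on_part_unique[OF q \<open>C \<in> q\<close> _ \<open>i \<in> C\<close>] \<open>C \<in> q\<close> \<open>i \<in> C\<close> by metis
    moreover have "C \<subseteq> {1..n}" using that U by blast
    ultimately show ?thesis by blast
  qed
  show "ties n y = q"
  proof (intro equalityI subsetI)
    fix C assume "C \<in> ties n y"
    then obtain i where i: "i \<in> {1..n}" "C = {j\<in>{1..n}. y j = y i}" by (auto simp: ties_def)
    obtain D where "D \<in> q" "i \<in> D" using partition_on_obtain_part[OF q i(1)] by metis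
    then show "C \<in> q" using block i by simp
  next
    fix C assume C: "C \<in> q"
    obtain i where i: "i \<in> C" using partition_on_part_nonempty[OF q C] by auto
    then have "i \<in> {1..n}" using C U by auto
    then show "C \<in> ties n y" using block[OF C i] by (auto simp: ties_def)
  qed
qed

text \<open>The least index of a block serves as representative, which turns the common value into a
  coordinate of the vector and hence into a measurable function of it.\<close>

lemma common_value_ties:
  assumes "C \<in> ties n y" shows "common_value y C = y (Min C)" "Min C \<in> {1..n}"
proof -
  obtain i where i: "i \<in> {1..n}" "C = {j\<in>{1..n}. y j = y i}" using assms by (auto simp: ties_def)
  then have "finite C" "C \<noteq> {}" by auto
  then have M: "Min C \<in> C" by (rule Min_in)
  then show "Min C \<in> {1..n}" using i by auto
  have "y ` C = {y (Min C)}" using M i by auto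
  then show "common_value y C = y (Min C)" by (simp add: common_value_def)
qed

lemma measurable_ties:
  assumes q: "partition_on {1..n} q"
  shows "{y\<in>space (\<Pi>\<^sub>M i\<in>{1..n}. (borel :: 'y::polish_space measure)). ties n y = q} \<in> sets (\<Pi>\<^sub>M i\<in>{1..n}. borel)"
proof -
  let ?M = "\<Pi>\<^sub>M i\<in>{1..n}. (borel :: 'y measure)"
  have eq: "{y\<in>space ?M. y i = y j} \<in> sets ?M" if "i \<in> {1..n}" "j \<in> {1..n}" for i j
  proof -
    have "(\<lambda>y. dist (y i) (y j)) \<in> borel_measurable ?M"
      using that by (intro borel_measurable_dist measurable_component_singleton)
    then have "(\<lambda>y. dist (y i) (y j)) -` {0} \<inter> space ?M \<in> sets ?M" by (rule measurable_sets) simp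
    also have "(\<lambda>y. dist (y i) (y j)) -` {0} \<inter> space ?M = {y\<in>space ?M. y i = y j}" by auto
    finally show ?thesis .
  qed
  have "{y\<in>space ?M. y i = y j \<longleftrightarrow> (\<exists>C\<in>q. i \<in> C \<and> j \<in> C)} \<in> sets ?M" if "i \<in> {1..n}" "j \<in> {1..n}" for i j
    using eq[OF that] sets.sets_Collect_neg[OF eq[OF that]]
    by (cases "\<exists>C\<in>q. i \<in> C \<and> j \<in> C") simp_all
  then show ?thesis
    unfolding ties_eq_iff[OF q]
    by (intro sets.sets_Collect_finite_All) auto
qed

section \<open>Jump laws and block laws\<close>

lemma normalize_measure_nn_integral:
  assumes "f \<in> borel_measurable M"
  shows "(\<integral>\<^sup>+x. f x \<partial>normalize_measure M) = inverse (emeasure M (space M)) * (\<integral>\<^sup>+x. f x \<partial>M)"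
  unfolding normalize_measure_def by (rule nn_integral_scale_measure[OF assms])

lemma sets_normalize_measure [simp]: "sets (normalize_measure M) = sets M"
  by (simp add: normalize_measure_def)

lemma space_normalize_measure [simp]: "space (normalize_measure M) = space M"
  by (rule sets_eq_imp_space_eq) simp

lemma emeasure_normalize_measure: "emeasure (normalize_measure M) A = inverse (emeasure M (space M)) * emeasure M A"
  by (simp add: normalize_measure_def)

lemma ennreal_inverse_mult_cancel: "0 < (a::ennreal) \<Longrightarrow> a < \<infinity> \<Longrightarrow> inverse a * a = 1"
  using ennreal_divide_self[of a] by (simp add: divide_ennreal_def mult.commute less_top)

lemma prob_space_normalize_measure:
  assumes "0 < emeasure M (space M)" "emeasure M (space M) < \<infinity>"
  shows "prob_space (normalize_measure M)"
  using ennreal_inverse_mult_cancel[OF assms]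
  by (intro prob_spaceI) (simp only: emeasure_normalize_measure space_normalize_measure)

text \<open>A singleton has no subset of strictly smaller positive measure.\<close>

lemma nonatomic_singleton:
  assumes "nonatomic M" "{v} \<in> sets M"
  shows "emeasure M {v} = 0"
proof (rule ccontr)
  assume "emeasure M {v} \<noteq> 0"
  then obtain B where B: "B \<in> sets M" "B \<subseteq> {v}" "0 < emeasure M B" "emeasure M B < emeasure M {v}"
    using assms unfolding nonatomic_def by (metis zero_less_iff_neq_zero)
  then have "B = {} \<or> B = {v}" by auto
  then show False using B by auto
qed

text \<open>The tilting function f is absent: in the application it is absorbed in \<rho> and
  \<open>P\<close>, and it returns with the untilted law in the joint measure.\<close>

locale mixture_model = crm h \<rho> \<eta> P
  for h :: "'s::polish_space \<Rightarrow> real" and \<rho> :: "'y::polish_space \<Rightarrow> 's measure" and \<eta> P +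
  fixes K :: "'x::polish_space \<Rightarrow> 'y \<Rightarrow> real" and X :: "nat \<Rightarrow> 'x" and n :: nat
  assumes K: "(\<lambda>(x, y). K x y) \<in> borel_measurable (borel \<Otimes>\<^sub>M borel)" "\<And>x y. 0 \<le> K x y"
    and nonatomic: "nonatomic \<eta>"
begin

lemma K_section: "K x \<in> borel_measurable borel"
  using measurable_compose[OF measurable_Pair1'[of x borel borel] K(1)] by simp

definition lik :: "nat set \<Rightarrow> 'y \<Rightarrow> ennreal" where
  "lik C v = ennreal (\<Prod>i\<in>C. K (X i) v)"

lemma lik_measurable [measurable]: "lik C \<in> borel_measurable borel"
proof -
  have "(\<lambda>v. \<Prod>i\<in>C. K (X i) v) \<in> borel_measurable borel"
    by (intro borel_measurable_prod K_section)
  then show ?thesis unfolding lik_def[abs_def] by (rule measurable_compose[OF _ measurable_ennreal])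
qed

definition weight :: "nat set \<Rightarrow> ennreal" where
  "weight C = (\<integral>\<^sup>+v. lik C v * kappa h (card C) \<rho> v \<partial>\<eta>)"

lemma partition_weight_eq: "partition_weight K X h \<rho> \<eta> p = (\<Prod>C\<in>p. weight C)"
  by (simp add: partition_weight_def weight_def lik_def)

lemma measurable_\<eta>: "borel_measurable \<eta> = borel_measurable borel"
  by (rule measurable_cong_sets[OF \<eta> refl])

subsection \<open>Jump laws\<close>

definition jump :: "nat \<Rightarrow> 'y \<Rightarrow> 's measure" where
  "jump m v = jump_law h m \<rho> v"

lemma sets_jump: "sets (jump m v) = sets borel"
  by (simp add: jump_def jump_law_def sets_\<rho>)

lemma space_jump: "space (jump m v) = UNIV"
  using sets_eq_imp_space_eq[OF sets_jump] by simp

lemma jump_density_mass: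
  "emeasure (density (\<rho> v) (\<lambda>s. ennreal (h s ^ m))) (space (density (\<rho> v) (\<lambda>s. ennreal (h s ^ m)))) = kappa h m \<rho> v"
proof -
  have "(\<lambda>s. ennreal (h s ^ m)) \<in> borel_measurable (\<rho> v)"
    unfolding measurable_cong_sets[OF sets_\<rho> refl] by measurable
  then show ?thesis
    unfolding space_density kappa_def by (subst emeasure_density) (auto intro!: nn_integral_cong)
qed

lemma nn_integral_jump:
  assumes "g \<in> borel_measurable borel"
  shows "(\<integral>\<^sup>+s. g s \<partial>jump m v) = inverse (kappa h m \<rho> v) * (\<integral>\<^sup>+s. ennreal (h s ^ m) * g s \<partial>\<rho> v)"
proof -
  have m: "(\<lambda>s. ennreal (h s ^ m)) \<in> borel_measurable (\<rho> v)" "g \<in> borel_measurable (\<rho> v)"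
    unfolding measurable_cong_sets[OF sets_\<rho> refl] using assms by measurable
  then show ?thesis
    unfolding jump_def jump_law_def
    by (subst normalize_measure_nn_integral) (simp_all add: jump_density_mass[unfolded space_density] nn_integral_density)
qed

text \<open>Stated with the cumulant as a factor, the formula holds for every v: where the cumulant
  vanishes, h^m is 0 almost everywhere and both sides are 0.\<close>

lemma kappa_mult_nn_integral_jump:
  assumes m: "1 \<le> m" and g: "g \<in> borel_measurable borel"
  shows "kappa h m \<rho> v * (\<integral>\<^sup>+s. g s \<partial>jump m v) = (\<integral>\<^sup>+s. ennreal (h s ^ m) * g s \<partial>\<rho> v)"
proof (cases "kappa h m \<rho> v = 0")
  case True
  have hm: "(\<lambda>s. ennreal (h s ^ m)) \<in> borel_measurable (\<rho> v)"
    unfolding measurable_cong_sets[OF sets_\<rho> refl] by measurable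
  have "AE s in \<rho> v. ennreal (h s ^ m) = 0"
    using True nn_integral_0_iff_AE[OF hm] by (simp add: kappa_def)
  then have "(\<integral>\<^sup>+s. ennreal (h s ^ m) * g s \<partial>\<rho> v) = (\<integral>\<^sup>+s. 0 \<partial>\<rho> v)"
    by (intro nn_integral_cong_AE) (auto elim!: eventually_mono)
  then show ?thesis using True by simp
next
  case False
  have "kappa h m \<rho> v * inverse (kappa h m \<rho> v) = 1"
    using ennreal_inverse_mult_cancel[of "kappa h m \<rho> v"] kappa_finite[OF m, of v] False
    by (simp add: mult.commute zero_less_iff_neq_zero)
  then show ?thesis unfolding nn_integral_jump[OF g] by (simp add: mult.assoc[symmetric])
qed

lemma jump_mass: "emeasure (jump m v) UNIV = inverse (kappa h m \<rho> v) * kappa h m \<rho> v"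
  using nn_integral_jump[of "\<lambda>_. 1" m v] sets_eq_imp_space_eq[OF sets_jump, of m v] by (simp add: kappa_def)

text \<open>If the cumulant is 0 or \<infinity>, its product with its inverse is 0. Hence
  \<open>jump\<close> is a subprobability measure for every v and every m, and no exceptional set
  has to be removed before measurability in v is proved.\<close>

lemma jump_mass_le_1: "emeasure (jump m v) UNIV \<le> 1"
  unfolding jump_mass
  by (cases "kappa h m \<rho> v = 0"; cases "kappa h m \<rho> v = \<infinity>")
     (auto simp: ennreal_inverse_mult_cancel zero_less_iff_neq_zero less_top)

lemma prob_space_jump: "1 \<le> m \<Longrightarrow> 0 < kappa h m \<rho> v \<Longrightarrow> prob_space (jump m v)"
  using kappa_finite[of m v] by (intro prob_spaceI) (simp add: space_jump jump_mass ennreal_inverse_mult_cancel)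

lemma finite_measure_jump: "finite_measure (jump m v)"
  using jump_mass_le_1[of m v] by (intro finite_measureI) (auto simp: space_jump top_unique)

lemma sigma_finite_jump: "sigma_finite_measure (jump m v)"
  using finite_measure_jump by (rule finite_measure.axioms)

lemma measurable_jump: "jump m \<in> borel \<rightarrow>\<^sub>M subprob_algebra borel"
proof (rule measurable_subprob_algebra)
  show "subprob_space (jump m v)" for v
    using jump_mass_le_1[of m v] by (intro subprob_spaceI) (simp_all add: space_jump)
  show "sets (jump m v) = sets borel" for v by (rule sets_jump)
  fix A :: "'s set" assume A [measurable]: "A \<in> sets borel"
  have "(\<lambda>v. \<integral>\<^sup>+s. ennreal (h s ^ m) * indicator A s \<partial>\<rho> v) \<in> borel_measurable borel"
    by (rule measurable_\<rho>) measurable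
  then have "(\<lambda>v. inverse (kappa h m \<rho> v) * (\<integral>\<^sup>+s. ennreal (h s ^ m) * indicator A s \<partial>\<rho> v)) \<in> borel_measurable borel"
    by measurable
  moreover have "emeasure (jump m v) A = inverse (kappa h m \<rho> v) * (\<integral>\<^sup>+s. ennreal (h s ^ m) * indicator A s \<partial>\<rho> v)" for v
    using nn_integral_jump[of "indicator A" m v] A by (simp add: sets_jump)
  ultimately show "(\<lambda>v. emeasure (jump m v) A) \<in> borel_measurable borel" by simp
qed

lemma s_finite_kernel_jump: "s_finite_kernel borel borel (jump m)"
  by (rule subprob_kernel_s_finite[OF measurable_jump])

subsection \<open>Block laws\<close>

definition block :: "nat set \<Rightarrow> 'y measure" where "block C = block_law K X h \<rho> \<eta> C"

lemma sets_block_measure: "sets (block_measure K X h \<rho> \<eta> C) = sets borel"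
  by (simp add: block_measure_def \<eta>)

lemma sets_block: "sets (block C) = sets borel"
  by (simp add: block_def block_law_def sets_block_measure)

lemma nn_integral_block_measure:
  assumes "g \<in> borel_measurable borel"
  shows "(\<integral>\<^sup>+v. g v \<partial>block_measure K X h \<rho> \<eta> C) = (\<integral>\<^sup>+v. lik C v * kappa h (card C) \<rho> v * g v \<partial>\<eta>)"
proof -
  have "(\<lambda>v. lik C v * kappa h (card C) \<rho> v) \<in> borel_measurable \<eta>" "g \<in> borel_measurable \<eta>"
    unfolding measurable_\<eta> using assms by measurable
  then show ?thesis
    unfolding block_measure_def lik_def[symmetric] by (rule nn_integral_density)
qed

lemma mass_block_measure: "emeasure (block_measure K X h \<rho> \<eta> C) (space (block_measure K X h \<rho> \<eta> C)) = weight C"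
  using nn_integral_block_measure[of "\<lambda>_. 1" C] by (simp add: weight_def)

lemma nn_integral_block:
  assumes "g \<in> borel_measurable borel"
  shows "(\<integral>\<^sup>+v. g v \<partial>block C) = inverse (weight C) * (\<integral>\<^sup>+v. lik C v * kappa h (card C) \<rho> v * g v \<partial>\<eta>)"
  unfolding block_def block_law_def
  using assms normalize_measure_nn_integral[of g "block_measure K X h \<rho> \<eta> C"]
  by (simp add: mass_block_measure nn_integral_block_measure measurable_cong_sets[OF sets_block_measure refl])

lemma prob_space_block:
  assumes "0 < weight C" "weight C < \<infinity>"
  shows "prob_space (block C)"
  unfolding block_def block_law_def
  by (rule prob_space_normalize_measure) (simp_all only: mass_block_measure assms)

text \<open>The block law is absolutely continuous with respect to \<eta>, which has no atoms. The
  unnormalized integral is already 0, so the normalizing factor is harmless even if it is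
  infinite.\<close>

lemma block_singleton: "emeasure (block C) {v} = 0"
proof -
  have "emeasure (block C) {v} = (\<integral>\<^sup>+u. indicator {v} u \<partial>block C)" by (simp add: sets_block)
  also have "\<dots> = inverse (weight C) * (\<integral>\<^sup>+u. lik C u * kappa h (card C) \<rho> u * indicator {v} u \<partial>\<eta>)"
    by (rule nn_integral_block) simp
  also have "(\<integral>\<^sup>+u. lik C u * kappa h (card C) \<rho> u * indicator {v} u \<partial>\<eta>) = 0"
  proof -
    have m: "(\<lambda>u. lik C u * kappa h (card C) \<rho> u * indicator {v} u) \<in> borel_measurable \<eta>"
      unfolding measurable_\<eta> by measurable
    have "emeasure \<eta> {v} = 0" by (rule nonatomic_singleton[OF nonatomic]) (simp add: \<eta>)
    then have "AE u in \<eta>. u \<noteq> v" by (intro AE_I[where N="{v}"]) (auto simp: \<eta>)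
    then show ?thesis
      unfolding nn_integral_0_iff_AE[OF m] by eventually_elim simp
  qed
  finally show ?thesis by simp
qed

text \<open>The density of the block law contains the cumulant as a factor, so its zeros, at which
  the jump law degenerates, are not charged.\<close>

lemma AE_block_kappa_pos: "AE v in block C. 0 < kappa h (card C) \<rho> v"
proof -
  have m: "(\<lambda>v. indicator {0} (kappa h (card C) \<rho> v) :: ennreal) \<in> borel_measurable borel" by measurable
  have "lik C v * kappa h (card C) \<rho> v * indicator {0} (kappa h (card C) \<rho> v) = 0" for v
    by (simp add: indicator_def)
  then have "(\<integral>\<^sup>+v. indicator {0} (kappa h (card C) \<rho> v) \<partial>block C) = 0"
    unfolding nn_integral_block[OF m] by (simp only: nn_integral_const mult_zero_left mult_zero_right)
  moreover have "(\<lambda>v. indicator {0} (kappa h (card C) \<rho> v) :: ennreal) \<in> borel_measurable (block C)"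
    using m by (simp add: measurable_cong_sets[OF sets_block refl])
  ultimately have "AE v in block C. indicator {0} (kappa h (card C) \<rho> v) = (0::ennreal)"
    using nn_integral_0_iff_AE by blast
  then show ?thesis by eventually_elim (auto simp: indicator_def zero_less_iff_neq_zero split: if_splits)
qed

text \<open>The intensity of a block, weighted with the likelihood, splits into its total mass, the
  law of the value and the law of the jump given the value. For nonempty finite C the maximum in
  \<open>block_intensity\<close> is the cardinality, and \<open>kappa_mult_nn_integral_jump\<close>
  covers values with vanishing cumulant.\<close>

lemma block_disintegration:
  assumes C: "finite C" "C \<noteq> {}" and w: "0 < weight C" "weight C < \<infinity>"
    and g: "g \<in> borel_measurable (borel \<Otimes>\<^sub>M borel)"
  shows "(\<integral>\<^sup>+z. lik C (snd z) * g z \<partial>block_intensity C) =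
    weight C * (\<integral>\<^sup>+v. \<integral>\<^sup>+s. g (s, v) \<partial>jump (card C) v \<partial>block C)"
proof -
  note [measurable] = g
  have card: "1 \<le> card C" using C by (simp add: Suc_le_eq card_gt_0_iff)
  have gs: "(\<lambda>s. g (s, v)) \<in> borel_measurable borel" for v by measurable
  have Jm: "(\<lambda>v. \<integral>\<^sup>+s. g (s, v) \<partial>jump (card C) v) \<in> borel_measurable borel"
    by (rule s_finite_kernel_nn_integral[OF s_finite_kernel_jump measurable_ident_sets[OF refl]]) measurable
  have "(\<integral>\<^sup>+z. lik C (snd z) * g z \<partial>block_intensity C) =
      (\<integral>\<^sup>+v. \<integral>\<^sup>+s. ennreal (h s ^ card C) * (lik C v * g (s, v)) \<partial>\<rho> v \<partial>\<eta>)"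
    unfolding block_intensity_def using card by (subst nn_integral_\<nu>) (simp_all add: max_def)
  also have "\<dots> = (\<integral>\<^sup>+v. lik C v * kappa h (card C) \<rho> v * (\<integral>\<^sup>+s. g (s, v) \<partial>jump (card C) v) \<partial>\<eta>)"
  proof (intro nn_integral_cong)
    fix v
    have m: "(\<lambda>s. ennreal (h s ^ card C) * g (s, v)) \<in> borel_measurable (\<rho> v)"
      unfolding measurable_cong_sets[OF sets_\<rho> refl] by measurable
    have "(\<integral>\<^sup>+s. ennreal (h s ^ card C) * (lik C v * g (s, v)) \<partial>\<rho> v) =
        (\<integral>\<^sup>+s. lik C v * (ennreal (h s ^ card C) * g (s, v)) \<partial>\<rho> v)"
      by (simp only: mult.left_commute)
    also have "\<dots> = lik C v * (\<integral>\<^sup>+s. ennreal (h s ^ card C) * g (s, v) \<partial>\<rho> v)"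
      by (rule nn_integral_cmult[OF m])
    finally show "(\<integral>\<^sup>+s. ennreal (h s ^ card C) * (lik C v * g (s, v)) \<partial>\<rho> v) =
        lik C v * kappa h (card C) \<rho> v * (\<integral>\<^sup>+s. g (s, v) \<partial>jump (card C) v)"
      using kappa_mult_nn_integral_jump[OF card gs] by (simp add: mult.assoc)
  qed
  also have "\<dots> = weight C * (\<integral>\<^sup>+v. \<integral>\<^sup>+s. g (s, v) \<partial>jump (card C) v \<partial>block C)"
    unfolding nn_integral_block[OF Jm] using ennreal_inverse_mult_cancel[OF w]
    by (simp add: mult.assoc[symmetric] mult.commute[of "weight C"])
  finally show ?thesis .
qed

lemma nn_integral_lik_block_intensity:
  assumes C: "finite C" "C \<noteq> {}"
  shows "(\<integral>\<^sup>+z. lik C (snd z) \<partial>block_intensity C) = weight C"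
proof -
  have "max 1 (card C) = card C" using C by (simp add: max_def Suc_le_eq card_gt_0_iff)
  then show ?thesis
    unfolding block_intensity_def weight_def by (simp add: nn_integral_\<nu>_snd)
qed

end

section \<open>The posterior law\<close>

text \<open>A product in the extended reals can be 0 through a factor 0 next to a factor
  \<infinity>. Once it is known to be nonzero, an infinite factor would make it infinite.\<close>

lemma ennreal_prod_less_top_factor:
  fixes f :: "'a \<Rightarrow> ennreal"
  assumes "finite I" "(\<Prod>i\<in>I. f i) \<noteq> 0" "(\<Prod>i\<in>I. f i) < \<infinity>" "i \<in> I"
  shows "0 < f i" "f i < \<infinity>"
proof -
  have eq: "(\<Prod>i\<in>I. f i) = f i * (\<Prod>j\<in>I - {i}. f j)" by (rule prod.remove) fact+
  then have ne: "f i \<noteq> 0" "(\<Prod>j\<in>I - {i}. f j) \<noteq> 0" using assms(2) by auto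
  then show "0 < f i" by (simp add: zero_less_iff_neq_zero)
  show "f i < \<infinity>"
  proof (rule ccontr)
    assume "\<not> f i < \<infinity>"
    then have "f i = top" by (simp add: less_top[symmetric])
    then have "(\<Prod>i\<in>I. f i) = top"
      unfolding eq using ne(2) by (simp only: ennreal_top_mult if_False)
    then show False using assms(3) by simp
  qed
qed

section \<open>The conditional law of the random measure given the latent vector\<close>

context mixture_model
begin

abbreviation "vectors \<equiv> (\<Pi>\<^sub>M i\<in>{1..n}. (borel :: 'y measure))"

definition cond :: "(nat \<Rightarrow> 'y) \<Rightarrow> 'y measure measure" where
  "cond y = conditional_law h \<rho> P n y"

definition atom_at :: "(nat \<Rightarrow> 'y) \<Rightarrow> (nat set \<Rightarrow> 's) \<Rightarrow> nat set \<Rightarrow> 's \<times> 'y" where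
  "atom_at y s C = (s C, y (Min C))"

definition jumps :: "nat set set \<Rightarrow> (nat \<Rightarrow> 'y) \<Rightarrow> (nat set \<Rightarrow> 's) measure" where
  "jumps q y = (\<Pi>\<^sub>M C\<in>q. jump (card C) (y (Min C)))"

lemma sets_jumps: "sets (jumps q y) = sets (\<Pi>\<^sub>M C\<in>q. (borel :: 's measure))"
  unfolding jumps_def by (intro sets_PiM_cong refl sets_jump)

lemma product_sigma_finite_jump: "product_sigma_finite (\<lambda>C. jump (m C) (v C))"
  by (rule product_sigma_finite.intro) (rule sigma_finite_jump)

lemma sigma_finite_jumps: "finite q \<Longrightarrow> sigma_finite_measure (jumps q y)"
  unfolding jumps_def by (rule product_sigma_finite.sigma_finite[OF product_sigma_finite_jump])

lemma finite_ties: "finite (ties n y)"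
  by (rule finite_partition[OF partition_on_ties])

lemma conditional_law_eq_distr:
  "cond y = distr (P \<Otimes>\<^sub>M jumps (ties n y) y) bfa (\<lambda>(\<mu>, s). add_points (ties n y) (atom_at y s) \<mu>)"
proof -
  have jl: "(\<Pi>\<^sub>M C\<in>ties n y. jump_law h (card C) \<rho> (common_value y C)) = jumps (ties n y) y"
    unfolding jumps_def by (intro PiM_cong refl) (simp add: common_value_ties jump_def)
  have aj: "add_jumps h n y \<mu> s = add_points (ties n y) (atom_at y s) \<mu>" for \<mu> s
    unfolding add_jumps_def add_points_def add_atoms_def atom_at_def
    by (intro arg_cong[where f="measure_of UNIV (sets borel)"] ext arg_cong2[where f="(+)"] refl sum.cong)
       (simp add: common_value_ties)
  show ?thesis by (simp only: cond_def conditional_law_def jl aj)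
qed

lemma sets_cond: "sets (cond y) = sets bfa"
  unfolding conditional_law_eq_distr by simp

lemma measurable_add_points_pair:
  assumes q: "finite q"
  shows "(\<lambda>(\<mu>, s). add_points q (atom_at y s) \<mu>) \<in> P \<Otimes>\<^sub>M jumps q y \<rightarrow>\<^sub>M bfa"
  unfolding measurable_cong_sets[OF sets_pair_measure_cong[OF sets_P sets_jumps] refl] case_prod_beta
proof (rule measurable_add_points[OF q measurable_fst])
  fix C assume C: "C \<in> q"
  show "(\<lambda>x. atom_at y (snd x) C) \<in> bfa \<Otimes>\<^sub>M (\<Pi>\<^sub>M C\<in>q. borel) \<rightarrow>\<^sub>M borel \<Otimes>\<^sub>M borel"
    unfolding atom_at_def
    by (intro measurable_Pair measurable_compose[OF measurable_snd measurable_component_singleton[OF C]]) simp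
qed

lemma nn_integral_cond:
  assumes \<phi>: "\<phi> \<in> borel_measurable bfa"
  shows "(\<integral>\<^sup>+\<mu>. \<phi> \<mu> \<partial>cond y) =
    (\<integral>\<^sup>+s. \<integral>\<^sup>+\<mu>. \<phi> (add_points (ties n y) (atom_at y s) \<mu>) \<partial>P \<partial>jumps (ties n y) y)"
proof -
  let ?a = "\<lambda>(\<mu>, s). add_points (ties n y) (atom_at y s) \<mu>"
  have a: "?a \<in> P \<Otimes>\<^sub>M jumps (ties n y) y \<rightarrow>\<^sub>M bfa" by (rule measurable_add_points_pair[OF finite_ties])
  interpret J: sigma_finite_measure "jumps (ties n y) y" by (rule sigma_finite_jumps[OF finite_ties])
  interpret pair_sigma_finite P "jumps (ties n y) y" ..
  have m: "(\<lambda>x. \<phi> (?a x)) \<in> borel_measurable (P \<Otimes>\<^sub>M jumps (ties n y) y)"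
    by (rule measurable_compose[OF a \<phi>])
  have "(\<integral>\<^sup>+\<mu>. \<phi> \<mu> \<partial>cond y) = (\<integral>\<^sup>+x. \<phi> (?a x) \<partial>(P \<Otimes>\<^sub>M jumps (ties n y) y))"
    unfolding conditional_law_eq_distr by (rule nn_integral_distr[OF a]) (simp add: \<phi>)
  also have "\<dots> = (\<integral>\<^sup>+s. \<integral>\<^sup>+\<mu>. \<phi> (?a (\<mu>, s)) \<partial>P \<partial>jumps (ties n y) y)"
    by (rule nn_integral_snd[symmetric]) (simp only: case_prod_eta m)
  finally show ?thesis by simp
qed

lemma prob_space_cond:
  assumes "\<And>C. C \<in> ties n y \<Longrightarrow> 0 < kappa h (card C) \<rho> (y (Min C))"
  shows "prob_space (cond y)"
proof -
  have "prob_space (jump (card C) (y (Min C)))" if C: "C \<in> ties n y" for C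
  proof (rule prob_space_jump[OF _ assms[OF C]])
    have "C \<noteq> {}" by (rule partition_on_part_nonempty[OF partition_on_ties C])
    moreover have "C \<subseteq> {1..n}" using C partition_on_ties[of n y] by (auto simp: partition_on_def)
    ultimately show "1 \<le> card C" using finite_subset[of C "{1..n}"] by (simp add: Suc_le_eq card_gt_0_iff)
  qed
  then have "prob_space (jumps (ties n y) y)" unfolding jumps_def by (intro prob_space_PiM)
  then have "emeasure (jumps (ties n y) y) (space (jumps (ties n y) y)) = 1" by (rule prob_space.emeasure_space_1)
  then have "(\<integral>\<^sup>+\<mu>. 1 \<partial>cond y) = 1"
    by (subst nn_integral_cond) (simp_all add: P.emeasure_space_1)
  then show ?thesis by (intro prob_spaceI) simp
qed

lemma Min_part: "partition_on {1..n} q \<Longrightarrow> C \<in> q \<Longrightarrow> Min C \<in> {1..n} \<and> Min C \<in> C"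
proof -
  assume q: "partition_on {1..n} q" "C \<in> q"
  have "C \<noteq> {}" by (rule partition_on_part_nonempty[OF q])
  moreover have "C \<subseteq> {1..n}" using q by (auto simp: partition_on_def)
  ultimately have "Min C \<in> C" using finite_subset[of C "{1..n}"] by (intro Min_in) auto
  then show ?thesis using \<open>C \<subseteq> {1..n}\<close> by auto
qed

text \<open>The index set of the jump variables varies with y. On each of the finitely many sets
  where the ties equal a fixed partition it is constant, and there the integral is one over a finite
  product of kernels with parameter y.\<close>

lemma measurable_nn_integral_cond:
  assumes \<phi>: "(\<lambda>(y, \<mu>). \<phi> y \<mu>) \<in> borel_measurable (vectors \<Otimes>\<^sub>M bfa)"
  shows "(\<lambda>y. \<integral>\<^sup>+\<mu>. \<phi> y \<mu> \<partial>cond y) \<in> borel_measurable vectors"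
proof -
  define R where "R q y = (\<integral>\<^sup>+s. \<integral>\<^sup>+\<mu>. \<phi> y (add_points q (atom_at y s) \<mu>) \<partial>P \<partial>jumps q y)" for q y
  have R: "R q \<in> borel_measurable vectors" if q: "partition_on {1..n} q" for q
  proof -
    have fin: "finite q" using q by (rule finite_partition)
    have comp: "(\<lambda>y. y (Min C)) \<in> vectors \<rightarrow>\<^sub>M borel" if "C \<in> q" for C
      using Min_part[OF q that] by (intro measurable_component_singleton) simp
    show ?thesis
      unfolding R_def[abs_def] jumps_def
    proof (rule nn_integral_PiM_kernel[OF fin])
      show "s_finite_kernel vectors borel (\<lambda>y. jump (card C) (y (Min C)))" if "C \<in> q" for C
        by (rule s_finite_kernel_compose[OF s_finite_kernel_jump comp[OF that]])
      show "sigma_finite_measure (jump (card C) (y (Min C)))" for C y by (rule sigma_finite_jump)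
      let ?N = "vectors \<Otimes>\<^sub>M (\<Pi>\<^sub>M C\<in>q. (borel :: 's measure))"
      have "(\<lambda>x. (fst (fst x), add_points q (atom_at (fst (fst x)) (snd (fst x))) (snd x))) \<in> ?N \<Otimes>\<^sub>M bfa \<rightarrow>\<^sub>M vectors \<Otimes>\<^sub>M bfa"
      proof (intro measurable_Pair measurable_compose[OF measurable_fst measurable_fst] measurable_add_points[OF fin measurable_snd])
        fix C assume C: "C \<in> q"
        show "(\<lambda>x. atom_at (fst (fst x)) (snd (fst x)) C) \<in> ?N \<Otimes>\<^sub>M bfa \<rightarrow>\<^sub>M borel \<Otimes>\<^sub>M borel"
          unfolding atom_at_def
          by (intro measurable_Pair measurable_compose[OF measurable_compose[OF measurable_fst measurable_fst] comp[OF C]]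
            measurable_compose[OF measurable_compose[OF measurable_fst measurable_snd] measurable_component_singleton[OF C]])
      qed
      from measurable_compose[OF this \<phi>]
      have "(\<lambda>(x, \<mu>). \<phi> (fst x) (add_points q (atom_at (fst x) (snd x)) \<mu>)) \<in> borel_measurable (?N \<Otimes>\<^sub>M bfa)"
        by (simp only: case_prod_beta' fst_conv snd_conv)
      from measurable_nn_integral_P[OF this]
      show "(\<lambda>(y, s). \<integral>\<^sup>+\<mu>. \<phi> y (add_points q (atom_at y s) \<mu>) \<partial>P) \<in> borel_measurable ?N"
        by (simp only: case_prod_beta')
    qed
  qed
  have S: "(\<lambda>y. \<Sum>q | partition_on {1..n} q. indicator {y\<in>space vectors. ties n y = q} y * R q y) \<in> borel_measurable vectors"
    by (intro borel_measurable_sum borel_measurable_times_ennreal borel_measurable_indicator measurable_ties R) auto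
  have E: "(\<integral>\<^sup>+\<mu>. \<phi> y \<mu> \<partial>cond y) = (\<Sum>q | partition_on {1..n} q. indicator {y\<in>space vectors. ties n y = q} y * R q y)"
    if y: "y \<in> space vectors" for y
  proof -
    have "(\<Sum>q | partition_on {1..n} q. indicator {y\<in>space vectors. ties n y = q} y * R q y)
        = (\<Sum>q\<in>{ties n y}. indicator {y\<in>space vectors. ties n y = q} y * R q y)"
      using partition_on_ties[of n y]
      by (intro sum.mono_neutral_right finitely_many_partition_on) (auto simp: indicator_def)
    also have "\<dots> = R (ties n y) y" using y by simp
    also have "\<dots> = (\<integral>\<^sup>+\<mu>. \<phi> y \<mu> \<partial>cond y)"
      unfolding R_def
      using measurable_compose[OF measurable_Pair1'[OF y] \<phi>] by (subst nn_integral_cond) simp_all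
    finally show ?thesis ..
  qed
  show ?thesis by (rule measurable_cong[THEN iffD2, OF E S])
qed

section \<open>The latent law and integration against the posterior\<close>

definition pp :: "nat set set \<Rightarrow> ennreal" where
  "pp p = partition_prob n K X h \<rho> \<eta> p"

lemma sets_PiM_block: "sets (PiM p block) = sets (\<Pi>\<^sub>M C\<in>p. (borel :: 'y measure))"
  by (intro sets_PiM_cong refl sets_block)

lemma measurable_expand_block:
  assumes p: "partition_on {1..n} p"
  shows "expand n p \<in> PiM p block \<rightarrow>\<^sub>M vectors"
  unfolding measurable_cong_sets[OF sets_PiM_block refl]
  using measurable_expand[OF p, of "\<lambda>C v. v C" "\<Pi>\<^sub>M C\<in>p. (borel :: 'y measure)" borel]
  by (simp add: measurable_component_singleton)

text \<open>Integration against the latent law, as a functional on nonnegative functions. A weight 0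
  removes its partition even if a block law is degenerate, since 0 times \<infinity> is 0.\<close>

definition latent_functional :: "((nat \<Rightarrow> 'y) \<Rightarrow> ennreal) \<Rightarrow> ennreal" where
  "latent_functional g = (\<Sum>p | partition_on {1..n} p. pp p * (\<integral>\<^sup>+v. g (expand n p v) \<partial>PiM p block))"

lemma finite_partitions: "finite {p. partition_on {1..n} p}"
  by (rule finitely_many_partition_on) simp

lemma positive_functional_latent: "positive_functional vectors latent_functional"
proof
  have m: "(\<lambda>v. f (expand n p v)) \<in> borel_measurable (PiM p block)"
    if "f \<in> borel_measurable vectors" "p \<in> {p. partition_on {1..n} p}" for f :: "_ \<Rightarrow> ennreal" and p
    using measurable_compose[OF measurable_expand_block that(1)] that(2) by simp
  show "latent_functional f = latent_functional g" if "\<And>x. x \<in> space vectors \<Longrightarrow> f x = g x" for f g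
    unfolding latent_functional_def
  proof (intro sum.cong refl arg_cong2[where f="(*)"] nn_integral_cong that)
    fix p v assume p: "p \<in> {p. partition_on {1..n} p}" and v: "v \<in> space (PiM p block)"
    show "expand n p v \<in> space vectors"
      by (rule measurable_space[OF measurable_expand_block v]) (use p in simp)
  qed
  show "latent_functional (\<lambda>x. f x + g x) = latent_functional f + latent_functional g"
    if "f \<in> borel_measurable vectors" "g \<in> borel_measurable vectors" for f g
    unfolding latent_functional_def sum.distrib[symmetric]
    by (intro sum.cong refl) (simp only: nn_integral_add m[OF that(1)] m[OF that(2)] distrib_left)
  show "latent_functional (\<lambda>x. c * f x) = c * latent_functional f" if "f \<in> borel_measurable vectors" for f c
    unfolding latent_functional_def sum_distrib_left
    by (intro sum.cong refl) (simp only: nn_integral_cmult m[OF that] mult.left_commute)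
  fix F :: "nat \<Rightarrow> (nat \<Rightarrow> 'y) \<Rightarrow> ennreal"
  assume F: "\<And>i. F i \<in> borel_measurable vectors" and inc: "incseq F"
  have mono: "F i x \<le> F j x" if "i \<le> j" for i j x using inc that by (auto simp: incseq_def le_fun_def)
  have "latent_functional (\<lambda>x. SUP i. F i x) =
      (\<Sum>p | partition_on {1..n} p. SUP i. pp p * (\<integral>\<^sup>+v. F i (expand n p v) \<partial>PiM p block))"
    unfolding latent_functional_def
  proof (intro sum.cong refl)
    fix p assume p: "p \<in> {p. partition_on {1..n} p}"
    have "(\<integral>\<^sup>+v. (SUP i. F i (expand n p v)) \<partial>PiM p block) = (SUP i. \<integral>\<^sup>+v. F i (expand n p v) \<partial>PiM p block)"
      by (intro nn_integral_monotone_convergence_SUP m F p) (auto simp: incseq_def le_fun_def intro: mono)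
    then show "pp p * (\<integral>\<^sup>+v. (SUP i. F i (expand n p v)) \<partial>PiM p block) =
        (SUP i. pp p * (\<integral>\<^sup>+v. F i (expand n p v) \<partial>PiM p block))"
      by (simp add: SUP_mult_left_ennreal)
  qed
  also have "\<dots> = (SUP i. latent_functional (F i))"
    unfolding latent_functional_def
    by (rule ennreal_SUP_sum[symmetric]) (auto simp: incseq_def intro!: mult_left_mono nn_integral_mono mono)
  finally show "latent_functional (\<lambda>x. SUP i. F i x) = (SUP i. latent_functional (F i))" .
qed

definition latent :: "(nat \<Rightarrow> 'y) measure" where "latent = latent_law n K X h \<rho> \<eta>"

lemma
  shows sets_latent: "sets latent = sets vectors"
    and nn_integral_latent: "g \<in> borel_measurable vectors \<Longrightarrow> (\<integral>\<^sup>+y. g y \<partial>latent) = latent_functional g"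
proof -
  interpret positive_functional vectors latent_functional by (rule positive_functional_latent)
  have "latent = functional_measure"
    unfolding latent_def latent_law_def functional_measure_def block_def[symmetric] pp_def[symmetric]
  proof (rule measure_of_eq[OF sets.space_closed])
    fix A assume "A \<in> sigma_sets (space vectors) (sets vectors)"
    then have A: "A \<in> sets vectors" by (simp only: sets.sigma_sets_eq)
    show "(\<Sum>p | partition_on {1..n} p. pp p * emeasure (distr (PiM p (\<lambda>C. block C)) vectors (expand n p)) A) = latent_functional (indicator A)"
      unfolding latent_functional_def
    proof (intro sum.cong refl arg_cong2[where f="(*)"])
      fix p assume "p \<in> {p. partition_on {1..n} p}"
      then have e: "expand n p \<in> PiM p block \<rightarrow>\<^sub>M vectors" using measurable_expand_block by simp
      have "emeasure (distr (PiM p block) vectors (expand n p)) A = (\<integral>\<^sup>+y. indicator A y \<partial>distr (PiM p block) vectors (expand n p))"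
        using A by simp
      also have "\<dots> = (\<integral>\<^sup>+v. indicator A (expand n p v) \<partial>PiM p block)"
        by (rule nn_integral_distr[OF e], rule borel_measurable_indicator, unfold sets_distr, rule A)
      finally show "emeasure (distr (PiM p (\<lambda>C. block C)) vectors (expand n p)) A = (\<integral>\<^sup>+v. indicator A (expand n p v) \<partial>PiM p block)"
        by simp
    qed
  qed
  then show "sets latent = sets vectors"
    "g \<in> borel_measurable vectors \<Longrightarrow> (\<integral>\<^sup>+y. g y \<partial>latent) = latent_functional g"
    by (simp_all only: sets_functional_measure nn_integral_functional_measure)
qed

definition posterior :: "((nat \<Rightarrow> 'y) \<times> 'y measure) measure" where
  "posterior = posterior_law n K X h \<rho> \<eta> P"

lemma sets_posterior: "sets posterior = sets (vectors \<Otimes>\<^sub>M bfa)"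
  by (simp add: posterior_def posterior_law_def)

lemma nn_integral_posterior:
  assumes \<phi>: "(\<lambda>(y, \<mu>). \<phi> y \<mu>) \<in> borel_measurable (vectors \<Otimes>\<^sub>M bfa)"
  shows "(\<integral>\<^sup>+(y, \<mu>). \<phi> y \<mu> \<partial>posterior) =
    (\<Sum>p | partition_on {1..n} p. pp p * (\<integral>\<^sup>+v. \<integral>\<^sup>+\<mu>. \<phi> (expand n p v) \<mu> \<partial>cond (expand n p v) \<partial>PiM p block))"
proof -
  let ?k = "kernel_measure bfa cond latent"
  have post: "posterior = distr ?k (vectors \<Otimes>\<^sub>M bfa) prod.swap"
    unfolding posterior_def posterior_law_def latent_def cond_def[abs_def] by simp
  have sk: "sets ?k = sets (bfa \<Otimes>\<^sub>M vectors)"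
    unfolding sets_kernel_measure by (rule sets_pair_measure_cong[OF refl sets_latent])
  have sw: "prod.swap \<in> ?k \<rightarrow>\<^sub>M vectors \<Otimes>\<^sub>M bfa"
    unfolding measurable_cong_sets[OF sk refl] prod.swap_def by (intro measurable_Pair measurable_fst measurable_snd)
  have mL: "borel_measurable latent = borel_measurable vectors"
    by (rule measurable_cong_sets[OF sets_latent refl])
  have "(\<integral>\<^sup>+(y, \<mu>). \<phi> y \<mu> \<partial>posterior) = (\<integral>\<^sup>+x. \<phi> (snd x) (fst x) \<partial>?k)"
    unfolding post using nn_integral_distr[OF sw, of "\<lambda>(y, \<mu>). \<phi> y \<mu>"] \<phi> by (simp add: case_prod_beta')
  also have "\<dots> = (\<integral>\<^sup>+y. \<integral>\<^sup>+\<mu>. \<phi> (snd (\<mu>, y)) (fst (\<mu>, y)) \<partial>cond y \<partial>latent)"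
  proof (rule nn_integral_kernel_measure)
    show "sets (cond y) = sets bfa" for y by (rule sets_cond)
    show "(\<lambda>y. \<integral>\<^sup>+\<mu>. G y \<mu> \<partial>cond y) \<in> borel_measurable latent"
      if "(\<lambda>(y, \<mu>). G y \<mu>) \<in> borel_measurable (latent \<Otimes>\<^sub>M bfa)" for G
      unfolding mL
      using that by (intro measurable_nn_integral_cond)
        (simp only: measurable_cong_sets[OF sets_pair_measure_cong[OF sets_latent refl] refl])
    show "(\<lambda>x. \<phi> (snd x) (fst x)) \<in> borel_measurable (bfa \<Otimes>\<^sub>M latent)"
      unfolding measurable_cong_sets[OF sets_pair_measure_cong[OF refl sets_latent] refl]
      using measurable_compose[OF measurable_Pair[OF measurable_snd measurable_fst] \<phi>] by simp
  qed
  also have "\<dots> = latent_functional (\<lambda>y. \<integral>\<^sup>+\<mu>. \<phi> y \<mu> \<partial>cond y)"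
    using nn_integral_latent[OF measurable_nn_integral_cond[OF \<phi>]] by simp
  finally show ?thesis by (simp add: latent_functional_def)
qed

subsection \<open>Comparison with the iterated Mecke formula\<close>

definition likelihood :: "(nat \<Rightarrow> 'y) \<Rightarrow> ennreal" where
  "likelihood y = ennreal (\<Prod>i\<in>{1..n}. K (X i) (y i))"

lemma likelihood_measurable: "likelihood \<in> borel_measurable vectors"
proof -
  have "(\<lambda>y. \<Prod>i\<in>{1..n}. K (X i) (y i)) \<in> borel_measurable vectors"
    by (intro borel_measurable_prod measurable_compose[OF _ K_section] measurable_component_singleton)
  then show ?thesis unfolding likelihood_def[abs_def] by (rule measurable_compose[OF _ measurable_ennreal])
qed

lemma likelihood_expand:
  assumes p: "partition_on {1..n} p"
  shows "likelihood (expand n p v) = (\<Prod>C\<in>p. lik C (v C))"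
proof -
  have U: "\<Union> p = {1..n}" using p by (simp add: partition_on_def)
  have "(\<Prod>i\<in>\<Union> p. K (X i) (expand n p v i)) = (\<Prod>C\<in>p. \<Prod>i\<in>C. K (X i) (expand n p v i))"
  proof -
    have "finite C" if "C \<in> p" for C using that U by (metis Sup_upper finite_atLeastAtMost finite_subset)
    moreover have "C \<inter> D = {}" if "C \<in> p" "D \<in> p" "C \<noteq> D" for C D
      using p that by (auto simp: partition_on_def disjoint_def)
    ultimately show ?thesis by (subst prod.Union_disjoint) auto
  qed
  also have "\<dots> = (\<Prod>C\<in>p. \<Prod>i\<in>C. K (X i) (v C))"
    by (intro prod.cong refl) (simp add: expand_apply[OF p])
  finally have "likelihood (expand n p v) = ennreal (\<Prod>C\<in>p. \<Prod>i\<in>C. K (X i) (v C))"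
    by (simp add: likelihood_def U)
  then show ?thesis unfolding lik_def using K(2) by (simp add: prod_ennreal prod_nonneg)
qed

definition palm_slice :: "nat set set \<Rightarrow> ((nat \<Rightarrow> 'y) \<Rightarrow> 'y measure \<Rightarrow> ennreal) \<Rightarrow> (nat set \<Rightarrow> 's \<times> 'y) \<Rightarrow> ennreal" where
  "palm_slice p \<phi> z = (\<integral>\<^sup>+\<mu>. \<phi> (expand n p (\<lambda>C. snd (z C))) (add_points p z \<mu>) \<partial>P)"

lemma measurable_palm_slice:
  assumes p: "partition_on {1..n} p" and \<phi>: "(\<lambda>(y, \<mu>). \<phi> y \<mu>) \<in> borel_measurable (vectors \<Otimes>\<^sub>M bfa)"
  shows "palm_slice p \<phi> \<in> borel_measurable (\<Pi>\<^sub>M C\<in>p. borel \<Otimes>\<^sub>M borel)"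
  unfolding palm_slice_def[abs_def]
  by (rule measurable_nn_integral_P, unfold case_prod_beta, rule measurable_palm_integrand[OF p _ _ \<phi>])
     (auto intro!: measurable_compose[OF measurable_fst] measurable_component_block)

text \<open>The likelihood depends on the values at the points but not on \<mu>, so it leaves the
  inner integral and factors over the blocks.\<close>

lemma palm_likelihood:
  assumes p: "partition_on {1..n} p" and \<phi>: "(\<lambda>(y, \<mu>). \<phi> y \<mu>) \<in> borel_measurable (vectors \<Otimes>\<^sub>M bfa)"
  shows "palm n p (\<lambda>y \<mu>. likelihood y * \<phi> y \<mu>) =
    (\<integral>\<^sup>+z. (\<Prod>C\<in>p. lik C (snd (z C))) * palm_slice p \<phi> z \<partial>PiM p block_intensity)"
  unfolding palm_def palm_slice_def
proof (intro nn_integral_cong)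
  fix z assume "z \<in> space (PiM p block_intensity)"
  then have z: "z \<in> space (\<Pi>\<^sub>M C\<in>p. (borel :: 's measure) \<Otimes>\<^sub>M (borel :: 'y measure))"
    using sets_eq_imp_space_eq[OF sets_PiM_block_intensity] by simp
  have "(\<lambda>\<mu>. \<phi> (expand n p (\<lambda>C. snd (z C))) (add_points p z \<mu>)) \<in> borel_measurable P"
    unfolding measurable_P by (rule measurable_palm_integrand[OF p _ measurable_ident_sets[OF refl] \<phi>]) (simp add: space_pair_measure)
  then show "(\<integral>\<^sup>+\<mu>. likelihood (expand n p (\<lambda>C. snd (z C))) * \<phi> (expand n p (\<lambda>C. snd (z C))) (add_points p z \<mu>) \<partial>P) =
      (\<Prod>C\<in>p. lik C (snd (z C))) * (\<integral>\<^sup>+\<mu>. \<phi> (expand n p (\<lambda>C. snd (z C))) (add_points p z \<mu>) \<partial>P)"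
    unfolding likelihood_expand[OF p] by (rule nn_integral_cmult)
qed

lemma partition_part:
  assumes "partition_on {1..n} p" "C \<in> p" shows "finite C" "C \<noteq> {}"
  using partition_on_part_nonempty[OF assms] assms finite_subset[of C "{1..n}"]
  by (auto simp: partition_on_def)

lemma measurable_prod_lik: "(\<lambda>z. \<Prod>C\<in>p. lik C (snd (z C))) \<in> borel_measurable (\<Pi>\<^sub>M C\<in>p. (borel :: 's measure) \<Otimes>\<^sub>M borel)"
  by (rule borel_measurable_prod_ennreal)
     (rule measurable_compose[OF measurable_compose[OF measurable_component_block measurable_snd] lik_measurable])

lemma nn_integral_prod_lik:
  assumes p: "partition_on {1..n} p"
  shows "(\<integral>\<^sup>+z. (\<Prod>C\<in>p. lik C (snd (z C))) \<partial>PiM p block_intensity) = (\<Prod>C\<in>p. weight C)"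
proof -
  have "(\<lambda>x. lik C (snd x)) \<in> borel_measurable (block_intensity C)" for C
    unfolding measurable_cong_sets[OF sets_block_intensity refl] by measurable
  then show ?thesis
    using blocks.product_nn_integral_prod[OF finite_partition[OF p], of "\<lambda>C x. lik C (snd x)"]
    by (simp add: nn_integral_lik_block_intensity partition_part[OF p])
qed

text \<open>A partition weight may be 0 while a block weight is infinite, and then the
  disintegration does not apply. But the integral of the product of the likelihoods is this weight,
  so the product vanishes almost everywhere, and with it the whole integrand.\<close>

lemma palm_likelihood_null:
  assumes p: "partition_on {1..n} p" and \<phi>: "(\<lambda>(y, \<mu>). \<phi> y \<mu>) \<in> borel_measurable (vectors \<Otimes>\<^sub>M bfa)"
    and w: "(\<Prod>C\<in>p. weight C) = 0"
  shows "palm n p (\<lambda>y \<mu>. likelihood y * \<phi> y \<mu>) = 0"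
proof -
  have m: "(\<lambda>z. \<Prod>C\<in>p. lik C (snd (z C))) \<in> borel_measurable (PiM p block_intensity)"
    unfolding measurable_cong_sets[OF sets_PiM_block_intensity refl] by (rule measurable_prod_lik)
  have "AE z in PiM p block_intensity. (\<Prod>C\<in>p. lik C (snd (z C))) = 0"
    using nn_integral_0_iff_AE[OF m] nn_integral_prod_lik[OF p] w by simp
  then have "(\<integral>\<^sup>+z. (\<Prod>C\<in>p. lik C (snd (z C))) * palm_slice p \<phi> z \<partial>PiM p block_intensity) =
      (\<integral>\<^sup>+z. 0 \<partial>PiM p block_intensity)"
    by (intro nn_integral_cong_AE) (erule eventually_mono, simp only: mult_zero_left)
  then show ?thesis by (simp only: palm_likelihood[OF p \<phi>] nn_integral_const mult_zero_left)
qed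

lemma palm_likelihood_mass:
  assumes p: "partition_on {1..n} p"
  shows "palm n p (\<lambda>y \<mu>. likelihood y * 1) = (\<Prod>C\<in>p. weight C)"
  using palm_likelihood[OF p, of "\<lambda>_ _. 1"] nn_integral_prod_lik[OF p]
  by (simp add: palm_slice_def P.emeasure_space_1)

end

section \<open>Disintegration of the Palm terms into the factors of the posterior\<close>

context mixture_model
begin

lemma product_sigma_finite_block:
  assumes w: "\<And>C. C \<in> p \<Longrightarrow> 0 < weight C \<and> weight C < \<infinity>"
  shows "product_sigma_finite (\<lambda>C. if C \<in> p then block C else null_measure borel)"
proof (rule product_sigma_finite.intro)
  fix C
  have "sigma_finite_measure (null_measure (borel :: 'y measure))"
    by (intro finite_measure.axioms(1) finite_measureI) simp
  moreover have "sigma_finite_measure (block C)" if "C \<in> p"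
    using w[OF that] by (intro prob_space_imp_sigma_finite prob_space_block) auto
  ultimately show "sigma_finite_measure (if C \<in> p then block C else null_measure borel)"
    by simp
qed

text \<open>Distinctness holds pair by pair because block laws have no atoms, positivity block by
  block because of the density; a partition has only finitely many blocks. Together they make the
  ties and the conditional law at the expanded vector non-degenerate.\<close>

lemma AE_block_inj:
  assumes p: "partition_on {1..n} p" and w: "\<And>C. C \<in> p \<Longrightarrow> 0 < weight C \<and> weight C < \<infinity>"
  shows "AE v in PiM p block. inj_on v p"
    and "AE v in PiM p block. \<forall>C\<in>p. 0 < kappa h (card C) \<rho> (v C)"
proof -
  define B where "B C = (if C \<in> p then block C else null_measure borel)" for C
  have B: "product_sigma_finite B"
    unfolding B_def by (rule product_sigma_finite_block[OF w])
  have PB: "PiM p B = PiM p block" by (intro PiM_cong refl) (simp add: B_def)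
  have fin: "finite p" using p by (rule finite_partition)
  have "AE v in PiM p B. C \<noteq> D \<longrightarrow> v C \<noteq> v D" if "C \<in> p" "D \<in> p" for C D
  proof (cases "C = D")
    case False
    have "AE v in PiM p B. v C \<noteq> v D"
    proof (rule AE_PiM_distinct[OF B fin that False])
      show "sets (B i) = sets borel" for i by (simp add: B_def sets_block)
      show "emeasure (B C) {v} = 0" for v using that by (simp add: B_def block_singleton)
    qed
    then show ?thesis by eventually_elim simp
  qed simp
  then have "AE v in PiM p B. \<forall>C\<in>p. \<forall>D\<in>p. C \<noteq> D \<longrightarrow> v C \<noteq> v D"
    by (intro AE_finite_allI fin)
  then show "AE v in PiM p block. inj_on v p"
    unfolding PB by eventually_elim (auto simp: inj_on_def)
  have "AE v in PiM p B. 0 < kappa h (card C) \<rho> (v C)" if "C \<in> p" for C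
  proof (rule product_sigma_finite.AE_PiM_component_finite[OF B fin that])
    have "B C = block C" using that by (simp add: B_def)
    then show "AE v in B C. 0 < kappa h (card C) \<rho> v" using AE_block_kappa_pos[of C] by (simp only:)
  qed
  then show "AE v in PiM p block. \<forall>C\<in>p. 0 < kappa h (card C) \<rho> (v C)"
    unfolding PB[symmetric] by (intro AE_finite_allI fin)
qed

lemma expand_Min: "partition_on {1..n} p \<Longrightarrow> C \<in> p \<Longrightarrow> expand n p v (Min C) = v C"
  using expand_apply[of n p C "Min C" v] Min_part[of p C] by simp

text \<open>For distinct values the ties of the expanded vector are p itself, so the conditional law
  has one jump per block of p, and the atoms it adds are the marked points of the Palm
  integral.\<close>

lemma nn_integral_cond_expand:
  assumes p: "partition_on {1..n} p" and inj: "inj_on v p" and v: "v \<in> space (PiM p block)"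
    and \<phi>: "(\<lambda>(y, \<mu>). \<phi> y \<mu>) \<in> borel_measurable (vectors \<Otimes>\<^sub>M bfa)"
  shows "(\<integral>\<^sup>+\<mu>. \<phi> (expand n p v) \<mu> \<partial>cond (expand n p v)) =
    (\<integral>\<^sup>+s. palm_slice p \<phi> (\<lambda>C\<in>p. (s C, v C)) \<partial>(\<Pi>\<^sub>M C\<in>p. jump (card C) (v C)))"
proof -
  let ?y = "expand n p v"
  have y: "?y \<in> space vectors" by (rule measurable_space[OF measurable_expand_block[OF p] v])
  have ties: "ties n ?y = p" by (rule ties_expand[OF p inj])
  have jumps: "jumps p ?y = (\<Pi>\<^sub>M C\<in>p. jump (card C) (v C))"
    unfolding jumps_def by (intro PiM_cong refl) (simp add: expand_Min[OF p])
  have m: "(\<lambda>\<mu>. \<phi> ?y \<mu>) \<in> borel_measurable bfa"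
    using measurable_compose[OF measurable_Pair1'[OF y] \<phi>] by (simp only: prod.case)
  have pts: "add_points p (atom_at ?y s) \<mu> = add_points p (\<lambda>C\<in>p. (s C, v C)) \<mu>" for s \<mu>
    unfolding add_points_def add_atoms_def atom_at_def
    by (intro arg_cong[where f="measure_of UNIV (sets borel)"] ext arg_cong2[where f="(+)"] refl sum.cong)
       (simp add: expand_Min[OF p])
  have ex: "expand n p (\<lambda>C. snd ((\<lambda>C\<in>p. (s C, v C)) C)) = ?y" for s :: "nat set \<Rightarrow> 's"
    by (rule expand_cong[OF _ p]) simp
  show ?thesis
    unfolding nn_integral_cond[OF m] ties jumps pts palm_slice_def ex ..
qed

text \<open>Block by block disintegration first leaves the jumps to be integrated with the values v
  held fixed. Coinciding values form a null set, and outside it this inner integral is the one over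
  the conditional law.\<close>

lemma palm_likelihood_posterior:
  assumes p: "partition_on {1..n} p" and \<phi>: "(\<lambda>(y, \<mu>). \<phi> y \<mu>) \<in> borel_measurable (vectors \<Otimes>\<^sub>M bfa)"
    and w: "\<And>C. C \<in> p \<Longrightarrow> 0 < weight C \<and> weight C < \<infinity>"
  shows "palm n p (\<lambda>y \<mu>. likelihood y * \<phi> y \<mu>) =
    (\<Prod>C\<in>p. weight C) * (\<integral>\<^sup>+v. \<integral>\<^sup>+\<mu>. \<phi> (expand n p v) \<mu> \<partial>cond (expand n p v) \<partial>PiM p block)"
proof -
  define B where "B C = (if C \<in> p then block C else null_measure borel)" for C
  have B: "product_sigma_finite B"
    unfolding B_def by (rule product_sigma_finite_block[OF w])
  have PB: "PiM p B = PiM p block" by (intro PiM_cong refl) (simp add: B_def)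
  have "palm n p (\<lambda>y \<mu>. likelihood y * \<phi> y \<mu>) =
      (\<integral>\<^sup>+z. (\<Prod>C\<in>p. lik C (snd (z C))) * palm_slice p \<phi> z \<partial>PiM p block_intensity)"
    by (rule palm_likelihood[OF p \<phi>])
  also have "\<dots> = (\<Prod>C\<in>p. weight C) *
      (\<integral>\<^sup>+v. \<integral>\<^sup>+s. palm_slice p \<phi> (\<lambda>C\<in>p. (s C, v C)) \<partial>(\<Pi>\<^sub>M C\<in>p. jump (card C) (v C)) \<partial>PiM p B)"
  proof (rule nn_integral_PiM_disintegrate[where k="\<lambda>C. jump (card C)" and f="\<lambda>C z. lik C (snd z)"])
    show "product_sigma_finite block_intensity" by (rule blocks.product_sigma_finite_axioms)
    show "sets (block_intensity C) = sets (borel \<Otimes>\<^sub>M borel)" for C by (rule sets_block_intensity)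
    show "product_sigma_finite B" by (rule B)
    show "sets (B C) = sets borel" for C by (simp add: B_def sets_block)
    show "s_finite_kernel borel borel (jump (card C))" for C :: "nat set" by (rule s_finite_kernel_jump)
    show "sigma_finite_measure (jump (card C) v)" for C :: "nat set" and v by (rule sigma_finite_jump)
    show "(\<lambda>z. lik C (snd z)) \<in> borel_measurable (borel \<Otimes>\<^sub>M borel)" for C
      by (rule measurable_compose[OF measurable_snd lik_measurable])
    show "finite p" using p by (rule finite_partition)
    show "palm_slice p \<phi> \<in> borel_measurable (\<Pi>\<^sub>M C\<in>p. borel \<Otimes>\<^sub>M borel)"
      by (rule measurable_palm_slice[OF p \<phi>])
    show "(\<integral>\<^sup>+z. lik C (snd z) * g z \<partial>block_intensity C) = weight C * (\<integral>\<^sup>+v. \<integral>\<^sup>+s. g (s, v) \<partial>jump (card C) v \<partial>B C)"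
      if "C \<in> p" "g \<in> borel_measurable (borel \<Otimes>\<^sub>M borel)" for C g
      using block_disintegration[OF partition_part[OF p that(1)] _ _ that(2)] w[OF that(1)] that(1)
      by (simp add: B_def)
  qed
  also have "(\<integral>\<^sup>+v. \<integral>\<^sup>+s. palm_slice p \<phi> (\<lambda>C\<in>p. (s C, v C)) \<partial>(\<Pi>\<^sub>M C\<in>p. jump (card C) (v C)) \<partial>PiM p B)
      = (\<integral>\<^sup>+v. \<integral>\<^sup>+\<mu>. \<phi> (expand n p v) \<mu> \<partial>cond (expand n p v) \<partial>PiM p block)"
    unfolding PB
  proof (intro nn_integral_cong_AE)
    show "AE v in PiM p block. (\<integral>\<^sup>+s. palm_slice p \<phi> (\<lambda>C\<in>p. (s C, v C)) \<partial>(\<Pi>\<^sub>M C\<in>p. jump (card C) (v C)))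
        = (\<integral>\<^sup>+\<mu>. \<phi> (expand n p v) \<mu> \<partial>cond (expand n p v))"
    proof -
      have "AE v in PiM p block. inj_on v p" by (rule AE_block_inj(1)[OF p w])
      then show ?thesis
        using AE_space by eventually_elim (rule nn_integral_cond_expand[OF p _ _ \<phi>, symmetric])
    qed
  qed
  finally show ?thesis .
qed

lemma AE_cond_expand:
  assumes p: "partition_on {1..n} p" and w: "\<And>C. C \<in> p \<Longrightarrow> 0 < weight C \<and> weight C < \<infinity>"
  shows "AE v in PiM p block. ties n (expand n p v) = p \<and>
    (\<forall>C\<in>p. 0 < kappa h (card C) \<rho> (expand n p v (Min C))) \<and> prob_space (cond (expand n p v))"
proof -
  have "AE v in PiM p block. inj_on v p" by (rule AE_block_inj(1)[OF p w])
  moreover have "AE v in PiM p block. \<forall>C\<in>p. 0 < kappa h (card C) \<rho> (v C)"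
    by (rule AE_block_inj(2)[OF p w])
  ultimately show ?thesis
proof eventually_elim
  case (elim v)
  have ties: "ties n (expand n p v) = p" by (rule ties_expand[OF p elim(1)])
  have k: "0 < kappa h (card C) \<rho> (expand n p v (Min C))" if "C \<in> p" for C
    using elim(2) that by (simp add: expand_Min[OF p])
  show ?case using ties k prob_space_cond[of "expand n p v"] by simp
qed
qed

lemma prob_space_PiM_block:
  assumes "\<And>C. C \<in> p \<Longrightarrow> 0 < weight C \<and> weight C < \<infinity>"
  shows "prob_space (PiM p block)"
  using assms prob_space_block by (intro prob_space_PiM) auto

section \<open>The joint measure as a sum over partitions\<close>

lemma
  assumes P0: "has_laplace_exponent P0 \<Lambda>0"
    and add: "\<And>g. g \<in> borel_measurable borel \<Longrightarrow> \<Lambda>0 (\<lambda>y. f y + g y) = \<Lambda>0 f + laplace_exponent h \<rho> \<eta> g"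
    and f: "f \<in> borel_measurable borel"
  shows sets_joint: "sets (joint_measure n K X f P0) = sets (vectors \<Otimes>\<^sub>M bfa)"
    and nn_integral_joint: "(\<lambda>(y, \<mu>). \<phi> y \<mu>) \<in> borel_measurable (vectors \<Otimes>\<^sub>M bfa) \<Longrightarrow>
      (\<integral>\<^sup>+(y, \<mu>). \<phi> y \<mu> \<partial>joint_measure n K X f P0) =
        exp_neg (\<Lambda>0 f) * (\<Sum>p | partition_on {1..n} p. palm n p (\<lambda>y \<mu>. likelihood y * \<phi> y \<mu>))"
proof -
  note sP0 = has_laplace_exponent_sets[OF P0]
  have mP0: "borel_measurable P0 = borel_measurable bfa" by (rule measurable_cong_sets[OF sP0 refl])
  let ?k = "\<lambda>\<mu>. scale_measure (exp_neg (\<integral>\<^sup>+v. f v \<partial>\<mu>)) (density (\<Pi>\<^sub>M i\<in>{1..n}. \<mu>) likelihood)"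
  have J: "joint_measure n K X f P0 = kernel_measure vectors ?k P0"
    by (simp add: joint_measure_def likelihood_def[abs_def])
  have sv: "sets (\<Pi>\<^sub>M i\<in>{1..n}. \<mu>) = sets vectors" if "\<mu> \<in> space P0" for \<mu>
    using that has_laplace_exponent_space[OF P0] by (intro sets_PiM_cong refl boundedly_finite_sets) simp
  have sk: "sets (?k \<mu>) = sets vectors" if "\<mu> \<in> space P0" for \<mu> using sv[OF that] by simp
  show sJ: "sets (joint_measure n K X f P0) = sets (vectors \<Otimes>\<^sub>M bfa)"
    unfolding J sets_kernel_measure by (rule sets_pair_measure_cong[OF refl sP0])
  have kint: "(\<integral>\<^sup>+y. g y \<partial>?k \<mu>) = exp_neg (\<integral>\<^sup>+v. f v \<partial>\<mu>) * (\<integral>\<^sup>+y. likelihood y * g y \<partial>(\<Pi>\<^sub>M i\<in>{1..n}. \<mu>))"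
    if \<mu>: "\<mu> \<in> space P0" and g: "g \<in> borel_measurable vectors" for \<mu> g
  proof -
    have m: "likelihood \<in> borel_measurable (\<Pi>\<^sub>M i\<in>{1..n}. \<mu>)" "g \<in> borel_measurable (\<Pi>\<^sub>M i\<in>{1..n}. \<mu>)"
      unfolding measurable_cong_sets[OF sv[OF \<mu>] refl] by (rule likelihood_measurable, rule g)
    then show ?thesis by (simp add: nn_integral_scale_measure nn_integral_density)
  qed
  have PiM_meas: "(\<lambda>\<mu>. \<integral>\<^sup>+y. likelihood y * G \<mu> y \<partial>(\<Pi>\<^sub>M i\<in>{1..n}. \<mu>)) \<in> borel_measurable bfa"
    if G: "(\<lambda>(\<mu>, y). G \<mu> y) \<in> borel_measurable (bfa \<Otimes>\<^sub>M vectors)" for G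
  proof (rule nn_integral_PiM_kernel)
    show "s_finite_kernel bfa borel (\<lambda>\<mu>. \<mu>)" by (rule s_finite_kernel_bfa)
    show "sigma_finite_measure \<mu>" if "\<mu> \<in> space bfa" for \<mu> using that sigma_finite_boundedly_finite by simp
    show "(\<lambda>(\<mu>, y). likelihood y * G \<mu> y) \<in> borel_measurable (bfa \<Otimes>\<^sub>M vectors)"
      using borel_measurable_times_ennreal[OF measurable_compose[OF measurable_snd likelihood_measurable] G]
      by (simp only: case_prod_beta')
  qed simp
  show "(\<integral>\<^sup>+(y, \<mu>). \<phi> y \<mu> \<partial>joint_measure n K X f P0) =
        exp_neg (\<Lambda>0 f) * (\<Sum>p | partition_on {1..n} p. palm n p (\<lambda>y \<mu>. likelihood y * \<phi> y \<mu>))"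
    if \<phi>: "(\<lambda>(y, \<mu>). \<phi> y \<mu>) \<in> borel_measurable (vectors \<Otimes>\<^sub>M bfa)"
  proof -
    have swap: "(\<lambda>(\<mu>, y). \<phi> y \<mu>) \<in> borel_measurable (bfa \<Otimes>\<^sub>M vectors)"
      using measurable_compose[OF measurable_Pair[OF measurable_snd measurable_fst] \<phi>] by (simp only: case_prod_beta' fst_conv snd_conv)
    have "(\<integral>\<^sup>+(y, \<mu>). \<phi> y \<mu> \<partial>joint_measure n K X f P0) = (\<integral>\<^sup>+\<mu>. \<integral>\<^sup>+y. \<phi> y \<mu> \<partial>?k \<mu> \<partial>P0)"
    proof -
      have "(\<integral>\<^sup>+x. (case x of (y, \<mu>) \<Rightarrow> \<phi> y \<mu>) \<partial>kernel_measure vectors ?k P0)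
          = (\<integral>\<^sup>+\<mu>. \<integral>\<^sup>+y. (case (y, \<mu>) of (y, \<mu>) \<Rightarrow> \<phi> y \<mu>) \<partial>?k \<mu> \<partial>P0)"
      proof (rule nn_integral_kernel_measure[OF sk])
        fix G :: "'y measure \<Rightarrow> (nat \<Rightarrow> 'y) \<Rightarrow> ennreal"
        assume "(\<lambda>(\<mu>, y). G \<mu> y) \<in> borel_measurable (P0 \<Otimes>\<^sub>M vectors)"
        then have G: "(\<lambda>(\<mu>, y). G \<mu> y) \<in> borel_measurable (bfa \<Otimes>\<^sub>M vectors)"
          by (simp only: measurable_cong_sets[OF sets_pair_measure_cong[OF sP0 refl] refl])
        have "(\<lambda>\<mu>. exp_neg (\<integral>\<^sup>+v. f v \<partial>\<mu>) * (\<integral>\<^sup>+y. likelihood y * G \<mu> y \<partial>(\<Pi>\<^sub>M i\<in>{1..n}. \<mu>))) \<in> borel_measurable P0"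
          unfolding mP0 by (intro borel_measurable_times_ennreal exp_neg_nn_integral_measurable_bfa f PiM_meas G)
        moreover have "(\<integral>\<^sup>+y. G \<mu> y \<partial>?k \<mu>) =
            exp_neg (\<integral>\<^sup>+v. f v \<partial>\<mu>) * (\<integral>\<^sup>+y. likelihood y * G \<mu> y \<partial>(\<Pi>\<^sub>M i\<in>{1..n}. \<mu>))" if \<mu>: "\<mu> \<in> space P0" for \<mu>
        proof -
          have "\<mu> \<in> space bfa" using \<mu> has_laplace_exponent_space[OF P0] by simp
          from measurable_compose[OF measurable_Pair1'[OF this] G]
          have "G \<mu> \<in> borel_measurable vectors" by (simp only: prod.case)
          then show ?thesis by (rule kint[OF \<mu>])
        qed
        ultimately show "(\<lambda>\<mu>. \<integral>\<^sup>+y. G \<mu> y \<partial>?k \<mu>) \<in> borel_measurable P0"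
          by (subst measurable_cong)
      next
        show "(\<lambda>x. case x of (y, \<mu>) \<Rightarrow> \<phi> y \<mu>) \<in> borel_measurable (vectors \<Otimes>\<^sub>M P0)"
          using \<phi> by (simp only: measurable_cong_sets[OF sets_pair_measure_cong[OF refl sP0] refl])
      qed
      then show ?thesis by (simp only: J prod.case)
    qed
    also have "\<dots> = (\<integral>\<^sup>+\<mu>. exp_neg (\<integral>\<^sup>+v. f v \<partial>\<mu>) * (\<integral>\<^sup>+y. likelihood y * \<phi> y \<mu> \<partial>(\<Pi>\<^sub>M i\<in>{1..n}. \<mu>)) \<partial>P0)"
    proof (intro nn_integral_cong kint)
      fix \<mu> assume "\<mu> \<in> space P0"
      then have "\<mu> \<in> space bfa" using has_laplace_exponent_space[OF P0] by simp
      from measurable_compose[OF measurable_Pair1'[OF this] swap]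
      show "(\<lambda>y. \<phi> y \<mu>) \<in> borel_measurable vectors" by (simp only: prod.case)
    qed
    \<comment> \<open>The exponential weight is exchanged for a constant and the tilted law
      \<open>P\<close>, to which the iterated Mecke formula of the locale applies.\<close>
    also have "\<dots> = exp_neg (\<Lambda>0 f) * (\<integral>\<^sup>+\<mu>. (\<integral>\<^sup>+y. likelihood y * \<phi> y \<mu> \<partial>(\<Pi>\<^sub>M i\<in>{1..n}. \<mu>)) \<partial>P)"
      by (rule nn_integral_exponential_tilting[OF P0 law add f PiM_meas[OF swap]])
    also have "(\<integral>\<^sup>+\<mu>. (\<integral>\<^sup>+y. likelihood y * \<phi> y \<mu> \<partial>(\<Pi>\<^sub>M i\<in>{1..n}. \<mu>)) \<partial>P) =
        (\<Sum>p | partition_on {1..n} p. palm n p (\<lambda>y \<mu>. likelihood y * \<phi> y \<mu>))"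
    proof (rule iterated_mecke)
      show "(\<lambda>(y, \<mu>). likelihood y * \<phi> y \<mu>) \<in> borel_measurable (vectors \<Otimes>\<^sub>M bfa)"
        using borel_measurable_times_ennreal[OF measurable_compose[OF measurable_fst likelihood_measurable] \<phi>]
        by (simp only: case_prod_beta')
    qed
    finally show ?thesis .
  qed
qed

text \<open>Both measures are sums over partitions with the same terms up to constants. The constant
  \<open>exp_neg (\<Lambda>0 f)\<close> of the joint measure cancels in the normalization, and
  division by the sum of the partition weights produces \<open>partition_prob\<close>.\<close>

lemma normalized_joint_eq_posterior:
  assumes P0: "has_laplace_exponent P0 \<Lambda>0"
    and add: "\<And>g. g \<in> borel_measurable borel \<Longrightarrow> \<Lambda>0 (\<lambda>y. f y + g y) = \<Lambda>0 f + laplace_exponent h \<rho> \<eta> g"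
    and f: "f \<in> borel_measurable borel"
    and J: "J = joint_measure n K X f P0"
    and mass: "0 < emeasure J (space J)" "emeasure J (space J) < \<infinity>"
  shows "normalize_measure J = posterior"
    and "(\<Sum>p | partition_on {1..n} p. pp p) = 1"
    and "partition_on {1..n} p \<Longrightarrow> 0 < pp p \<Longrightarrow> C \<in> p \<Longrightarrow> 0 < weight C \<and> weight C < \<infinity>"
proof -
  let ?PP = "{p. partition_on {1..n} p}"
  define c where "c = exp_neg (\<Lambda>0 f)"
  define w where "w p = (\<Prod>C\<in>p. weight C)" for p
  define W where "W = (\<Sum>p\<in>?PP. w p)"
  have sJ: "sets J = sets (vectors \<Otimes>\<^sub>M bfa)" unfolding J by (rule sets_joint[OF P0 add f])
  have intJ: "(\<integral>\<^sup>+(y, \<mu>). \<phi> y \<mu> \<partial>J) = c * (\<Sum>p\<in>?PP. palm n p (\<lambda>y \<mu>. likelihood y * \<phi> y \<mu>))"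
    if "(\<lambda>(y, \<mu>). \<phi> y \<mu>) \<in> borel_measurable (vectors \<Otimes>\<^sub>M bfa)" for \<phi>
    unfolding J c_def by (rule nn_integral_joint[OF P0 add f that])
  have massJ: "emeasure J (space J) = c * W"
  proof -
    have "(\<integral>\<^sup>+(y, \<mu>). 1 \<partial>J) = c * (\<Sum>p\<in>?PP. palm n p (\<lambda>y \<mu>. likelihood y * 1))"
      by (rule intJ) simp
    also have "(\<Sum>p\<in>?PP. palm n p (\<lambda>y \<mu>. likelihood y * 1)) = W"
      unfolding W_def w_def by (intro sum.cong refl palm_likelihood_mass) simp
    finally show ?thesis by (simp add: case_prod_beta')
  qed
  \<comment> \<open>Positive mass forces c > 0, i.e. the exponent of f is finite; dividing out c
    then shows that W is positive and finite.\<close>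
  have c: "0 < c" "c < \<infinity>" using mass massJ by (auto simp: c_def zero_less_iff_neq_zero)
  have W: "0 < W" "W < \<infinity>"
    using mass massJ c by (auto simp: zero_less_iff_neq_zero ennreal_mult_less_top)
  have pp: "pp p = w p / W" for p
    unfolding pp_def partition_prob_def partition_weight_eq W_def w_def by simp
  have w_fin: "w p < \<infinity>" if "p \<in> ?PP" for p
    using W(2) that finite_partitions unfolding W_def by (simp add: less_top[symmetric])
  have w_part: "0 < weight C \<and> weight C < \<infinity>" if "p \<in> ?PP" "w p \<noteq> 0" "C \<in> p" for p C
    using ennreal_prod_less_top_factor[where I=p and f=weight and i=C] finite_partition[of n p] that w_fin[of p]
    by (simp add: w_def)
  show "(\<Sum>p | partition_on {1..n} p. pp p) = 1"
  proof -
    have "(\<Sum>p\<in>?PP. pp p) = W * inverse W"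
      by (simp only: pp divide_ennreal_def sum_distrib_right[symmetric] W_def)
    then show ?thesis using ennreal_inverse_mult_cancel[OF W] by (simp only: mult.commute[of W])
  qed
  show "partition_on {1..n} p \<Longrightarrow> 0 < pp p \<Longrightarrow> C \<in> p \<Longrightarrow> 0 < weight C \<and> weight C < \<infinity>"
    using w_part[of p C] by (auto simp: pp zero_less_iff_neq_zero)
  have inv: "inverse (c * W) * c = inverse W"
  proof -
    have "inverse (c * W) = inverse c * inverse W" using c W by (intro ennreal_inverse_mult) auto
    then have "inverse (c * W) * c = (inverse c * c) * inverse W" by (simp add: mult_ac)
    then show ?thesis using ennreal_inverse_mult_cancel[OF c] by simp
  qed
  \<comment> \<open>If the weight of p is 0, both sides vanish. Otherwise it is finite and nonzero,
    hence so is every block weight, and the disintegration applies.\<close>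
  have post: "pp p * (\<integral>\<^sup>+v. \<integral>\<^sup>+\<mu>. \<phi> (expand n p v) \<mu> \<partial>cond (expand n p v) \<partial>PiM p block)
      = inverse W * palm n p (\<lambda>y \<mu>. likelihood y * \<phi> y \<mu>)"
    if p: "p \<in> ?PP" and \<phi>: "(\<lambda>(y, \<mu>). \<phi> y \<mu>) \<in> borel_measurable (vectors \<Otimes>\<^sub>M bfa)" for p \<phi>
  proof (cases "w p = 0")
    case True
    then show ?thesis using palm_likelihood_null[OF _ \<phi>, of p] p by (simp add: pp w_def)
  next
    case False
    have "palm n p (\<lambda>y \<mu>. likelihood y * \<phi> y \<mu>) =
        w p * (\<integral>\<^sup>+v. \<integral>\<^sup>+\<mu>. \<phi> (expand n p v) \<mu> \<partial>cond (expand n p v) \<partial>PiM p block)"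
      unfolding w_def using p w_part[OF p False] by (intro palm_likelihood_posterior \<phi>) auto
    then show ?thesis by (simp only: pp divide_ennreal_def mult_ac)
  qed
  show "normalize_measure J = posterior"
  proof (rule measure_eqI)
    show "sets (normalize_measure J) = sets posterior" by (simp add: sJ sets_posterior)
    fix A assume "A \<in> sets (normalize_measure J)"
    then have A: "A \<in> sets (vectors \<Otimes>\<^sub>M bfa)" using sJ by simp
    define \<phi> where "\<phi> y \<mu> = (indicator A (y, \<mu>) :: ennreal)" for y \<mu>
    have \<phi>: "(\<lambda>(y, \<mu>). \<phi> y \<mu>) \<in> borel_measurable (vectors \<Otimes>\<^sub>M bfa)"
      using borel_measurable_indicator[OF A, where 'b=ennreal] by (simp add: \<phi>_def case_prod_beta')
    have "emeasure J A = (\<integral>\<^sup>+(y, \<mu>). \<phi> y \<mu> \<partial>J)"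
      using A sJ by (simp add: \<phi>_def case_prod_beta')
    then have "emeasure (normalize_measure J) A =
        inverse (c * W) * (c * (\<Sum>p\<in>?PP. palm n p (\<lambda>y \<mu>. likelihood y * \<phi> y \<mu>)))"
      unfolding emeasure_normalize_measure massJ intJ[OF \<phi>] by simp
    also have "\<dots> = inverse W * (\<Sum>p\<in>?PP. palm n p (\<lambda>y \<mu>. likelihood y * \<phi> y \<mu>))"
      by (simp only: mult.assoc[symmetric] inv)
    also have "\<dots> = (\<Sum>p\<in>?PP. pp p * (\<integral>\<^sup>+v. \<integral>\<^sup>+\<mu>. \<phi> (expand n p v) \<mu> \<partial>cond (expand n p v) \<partial>PiM p block))"
      unfolding sum_distrib_left by (intro sum.cong refl post[OF _ \<phi>, symmetric])
    also have "\<dots> = (\<integral>\<^sup>+(y, \<mu>). \<phi> y \<mu> \<partial>posterior)" by (rule nn_integral_posterior[OF \<phi>, symmetric])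
    also have "\<dots> = emeasure posterior A"
      using A sets_posterior by (simp add: \<phi>_def case_prod_beta')
    finally show "emeasure (normalize_measure J) A = emeasure posterior A" .
  qed
qed

text \<open>A vector drawn from the block laws of q almost surely has ties q, so only the summand q
  = p survives; it contributes its full weight because the block laws and conditional laws have mass
  1.\<close>

lemma posterior_partition:
  assumes w: "\<And>p C. partition_on {1..n} p \<Longrightarrow> 0 < pp p \<Longrightarrow> C \<in> p \<Longrightarrow> 0 < weight C \<and> weight C < \<infinity>"
    and p: "partition_on {1..n} p"
  shows "emeasure posterior {(y, \<mu>). (y, \<mu>) \<in> space posterior \<and> ties n y = p} = pp p"
proof -
  have sp: "space posterior = space vectors \<times> boundedly_finite"
    using sets_eq_imp_space_eq[OF sets_posterior] by (simp add: space_pair_measure)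
  let ?T = "{y\<in>space vectors. ties n y = p}"
  have T: "?T \<in> sets vectors" by (rule measurable_ties[OF p])
  have bf: "boundedly_finite \<in> sets bfa" using sets.top[of bfa] by simp
  have eq: "{(y, \<mu>). (y, \<mu>) \<in> space posterior \<and> ties n y = p} = ?T \<times> boundedly_finite"
    by (auto simp: sp)
  have TB: "?T \<times> boundedly_finite \<in> sets posterior"
    unfolding sets_posterior using T bf by (rule pair_measureI)
  define \<phi> where "\<phi> y \<mu> = (indicator ?T y :: ennreal)" for y and \<mu> :: "'y measure"
  have \<phi>: "(\<lambda>(y, \<mu>). \<phi> y \<mu>) \<in> borel_measurable (vectors \<Otimes>\<^sub>M bfa)"
    using measurable_compose[OF measurable_fst borel_measurable_indicator[OF T]]
    by (simp only: \<phi>_def case_prod_beta')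
  have "emeasure posterior (?T \<times> boundedly_finite) = (\<integral>\<^sup>+(y, \<mu>). \<phi> y \<mu> \<partial>posterior)"
  proof -
    have "emeasure posterior (?T \<times> boundedly_finite) = (\<integral>\<^sup>+x. indicator (?T \<times> boundedly_finite) x \<partial>posterior)"
      using TB by (rule nn_integral_indicator[symmetric])
    also have "\<dots> = (\<integral>\<^sup>+(y, \<mu>). \<phi> y \<mu> \<partial>posterior)"
      by (intro nn_integral_cong) (auto simp: \<phi>_def sp indicator_def)
    finally show ?thesis .
  qed
  also have "\<dots> = (\<Sum>q | partition_on {1..n} q. pp q * (\<integral>\<^sup>+v. \<integral>\<^sup>+\<mu>. \<phi> (expand n q v) \<mu> \<partial>cond (expand n q v) \<partial>PiM q block))"
    by (rule nn_integral_posterior[OF \<phi>])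
  also have "\<dots> = (\<Sum>q | partition_on {1..n} q. if q = p then pp p else 0)"
  proof (intro sum.cong refl)
    fix q assume "q \<in> {q. partition_on {1..n} q}"
    then have q: "partition_on {1..n} q" by simp
    show "pp q * (\<integral>\<^sup>+v. \<integral>\<^sup>+\<mu>. \<phi> (expand n q v) \<mu> \<partial>cond (expand n q v) \<partial>PiM q block) = (if q = p then pp p else 0)"
    proof (cases "pp q = 0")
      case False
      then have pos: "0 < pp q" by (simp add: zero_less_iff_neq_zero)
      have ae: "AE v in PiM q block. ties n (expand n q v) = q \<and>
          (\<forall>C\<in>q. 0 < kappa h (card C) \<rho> (expand n q v (Min C))) \<and> prob_space (cond (expand n q v))"
        by (rule AE_cond_expand[OF q w[OF q pos]])
      interpret B: prob_space "PiM q block" by (rule prob_space_PiM_block) (rule w[OF q pos])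
      have "(\<integral>\<^sup>+v. \<integral>\<^sup>+\<mu>. \<phi> (expand n q v) \<mu> \<partial>cond (expand n q v) \<partial>PiM q block) = (\<integral>\<^sup>+v. of_bool (q = p) \<partial>PiM q block)"
      proof (intro nn_integral_cong_AE)
        show "AE v in PiM q block. (\<integral>\<^sup>+\<mu>. \<phi> (expand n q v) \<mu> \<partial>cond (expand n q v)) = of_bool (q = p)"
          using ae AE_space
        proof eventually_elim
          case (elim v)
          have "expand n q v \<in> space vectors" by (rule measurable_space[OF measurable_expand_block[OF q] elim(2)])
          moreover have t: "ties n (expand n q v) = q" using elim(1) by blast
          ultimately have "\<phi> (expand n q v) \<mu> = of_bool (q = p)" for \<mu>
            by (auto simp: \<phi>_def indicator_def t)
          then show ?case using prob_space.emeasure_space_1[of "cond (expand n q v)"] elim(1) by simp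
        qed
      qed
      then show ?thesis by (simp add: B.emeasure_space_1)
    qed auto
  qed
  also have "\<dots> = pp p" using p finite_partitions by simp
  finally show ?thesis unfolding eq .
qed

text \<open>The claim is deduced from a condition that is measurable in y: on vectors,
  \<open>bad\<close> vanishes exactly when the cumulant is positive at the value of every block, and
  the posterior integral of \<open>bad\<close> is 0.\<close>

lemma posterior_AE_cond:
  assumes w: "\<And>p C. partition_on {1..n} p \<Longrightarrow> 0 < pp p \<Longrightarrow> C \<in> p \<Longrightarrow> 0 < weight C \<and> weight C < \<infinity>"
  shows "AE (y, \<mu>) in posterior. prob_space (cond y)"
proof -
  let ?PP = "{p. partition_on {1..n} p}"
  define r :: "nat set set \<Rightarrow> (nat \<Rightarrow> 'y) \<Rightarrow> ennreal"
    where "r q y = (\<Sum>C\<in>q. indicator {0} (kappa h (card C) \<rho> (y (Min C))))" for q y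
  define bad :: "(nat \<Rightarrow> 'y) \<Rightarrow> ennreal"
    where "bad y = (\<Sum>q\<in>?PP. indicator {y\<in>space vectors. ties n y = q} y * r q y)" for y
  have bad: "bad \<in> borel_measurable vectors"
    unfolding bad_def[abs_def] r_def
  proof (intro borel_measurable_sum borel_measurable_times_ennreal borel_measurable_indicator measurable_ties)
    fix q C assume q: "q \<in> ?PP" and C: "C \<in> q"
    have "(\<lambda>y. y (Min C)) \<in> vectors \<rightarrow>\<^sub>M borel"
      using Min_part[of q C] q C by (intro measurable_component_singleton) simp
    from measurable_compose[OF this kappa_measurable]
    show "(\<lambda>y. indicator {0} (kappa h (card C) \<rho> (y (Min C)))) \<in> borel_measurable vectors"
      by (rule measurable_compose) simp
  qed simp
  have bad_at: "bad y = r (ties n y) y" if y: "y \<in> space vectors" for y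
  proof -
    have "bad y = (\<Sum>q\<in>{ties n y}. indicator {y\<in>space vectors. ties n y = q} y * r q y)"
      unfolding bad_def using partition_on_ties[of n y]
      by (intro sum.mono_neutral_right finite_partitions) (auto simp: indicator_def)
    also have "\<dots> = r (ties n y) y" using y by simp
    finally show ?thesis .
  qed
  have m: "(\<lambda>(y, \<mu>). bad y) \<in> borel_measurable (vectors \<Otimes>\<^sub>M bfa)"
    using measurable_compose[OF measurable_fst bad] by (simp only: case_prod_beta')
  have "(\<integral>\<^sup>+(y, \<mu>). bad y \<partial>posterior) =
      (\<Sum>q\<in>?PP. pp q * (\<integral>\<^sup>+v. \<integral>\<^sup>+\<mu>. bad (expand n q v) \<partial>cond (expand n q v) \<partial>PiM q block))"
    by (rule nn_integral_posterior[OF m])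
  also have "\<dots> = (\<Sum>q\<in>?PP. 0)"
  proof (intro sum.cong refl)
    fix q assume "q \<in> ?PP"
    then have q: "partition_on {1..n} q" by simp
    show "pp q * (\<integral>\<^sup>+v. \<integral>\<^sup>+\<mu>. bad (expand n q v) \<partial>cond (expand n q v) \<partial>PiM q block) = 0"
    proof (cases "pp q = 0")
      case False
      then have pos: "0 < pp q" by (simp add: zero_less_iff_neq_zero)
      have ae: "AE v in PiM q block. ties n (expand n q v) = q \<and>
          (\<forall>C\<in>q. 0 < kappa h (card C) \<rho> (expand n q v (Min C))) \<and> prob_space (cond (expand n q v))"
        by (rule AE_cond_expand[OF q w[OF q pos]])
      have "(\<integral>\<^sup>+v. \<integral>\<^sup>+\<mu>. bad (expand n q v) \<partial>cond (expand n q v) \<partial>PiM q block) = (\<integral>\<^sup>+v. 0 \<partial>PiM q block)"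
      proof (intro nn_integral_cong_AE)
        show "AE v in PiM q block. (\<integral>\<^sup>+\<mu>. bad (expand n q v) \<partial>cond (expand n q v)) = 0"
          using ae AE_space
        proof eventually_elim
          case (elim v)
          have "expand n q v \<in> space vectors" by (rule measurable_space[OF measurable_expand_block[OF q] elim(2)])
          then have "bad (expand n q v) = 0"
            using elim(1) by (auto simp: bad_at r_def indicator_def intro!: sum.neutral)
          then show ?case by simp
        qed
      qed
      then show ?thesis by simp
    qed simp
  qed
  finally have "(\<integral>\<^sup>+(y, \<mu>). bad y \<partial>posterior) = 0" by simp
  moreover have "(\<lambda>(y, \<mu>). bad y) \<in> borel_measurable posterior"
    using m by (simp only: measurable_cong_sets[OF sets_posterior refl])
  ultimately have "AE x in posterior. (case x of (y, \<mu>) \<Rightarrow> bad y) = 0"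
    using nn_integral_0_iff_AE by blast
  then show ?thesis
    using AE_space
  proof eventually_elim
    case (elim x)
    obtain y \<mu> where x: "x = (y, \<mu>)" by (cases x)
    have y: "y \<in> space vectors"
      using elim(2) sets_eq_imp_space_eq[OF sets_posterior] by (simp add: x space_pair_measure)
    have "(\<Sum>C\<in>ties n y. indicator {0} (kappa h (card C) \<rho> (y (Min C)))) = (0::ennreal)"
      using elim(1) bad_at[OF y] by (simp only: x r_def prod.case)
    then have "\<forall>C\<in>ties n y. indicator {0} (kappa h (card C) \<rho> (y (Min C))) = (0::ennreal)"
      by (subst (asm) sum_eq_0_iff) (simp_all add: finite_ties)
    then have "prob_space (cond y)"
      by (intro prob_space_cond) (auto simp: indicator_def zero_less_iff_neq_zero split: if_splits)
    then show ?case by (simp add: x)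
  qed
qed

end

text \<open>Division by 0 or \<infinity> is defined in the extended reals, so the equality of
  measures alone would not show that its factors are probabilities. The remaining conjuncts rule out
  degenerate normalizations wherever they would affect the law.\<close>

theorem theorem4p1:
  fixes h :: "'s::polish_space \<Rightarrow> real"
    and \<rho> \<rho>' :: "'y::polish_space \<Rightarrow> 's measure"
    and \<eta> :: "'y measure"
    and K :: "'x::polish_space \<Rightarrow> 'y \<Rightarrow> real"
    and Yf :: "'x \<Rightarrow> real"
    and \<tau> :: "'x measure"
    and f :: "'y \<Rightarrow> ennreal"
    and n :: nat
    and X :: "nat \<Rightarrow> 'x"
    and \<Omega> :: "'w measure" and N :: "'w \<Rightarrow> ('s \<times> 'y) measure"
    and \<Omega>' :: "'v measure" and N' :: "'v \<Rightarrow> ('s \<times> 'y) measure"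
    and P P' :: "'y measure measure"
    and J :: "((nat \<Rightarrow> 'y) \<times> 'y measure) measure"
  assumes \<eta>: "sets \<eta> = sets borel" "sigma_finite_measure \<eta>" "nonatomic \<eta>"
    and \<rho>: "measurable_kernel borel borel \<rho>" "\<And>y. sigma_finite_measure (\<rho> y)"
    and h: "h \<in> borel_measurable borel" "\<And>s. 0 < h s"
    and integrability: "\<And>B. B \<in> sets borel \<Longrightarrow> bounded B \<Longrightarrow>
          (\<integral>\<^sup>+y\<in>B. (\<integral>\<^sup>+s. ennreal (min (h s) 1) \<partial>\<rho> y) \<partial>\<eta>) < \<infinity>"
    and K: "(\<lambda>(x, y). K x y) \<in> borel_measurable (borel \<Otimes>\<^sub>M borel)" "\<And>x y. 0 \<le> K x y"
    and \<tau>: "sets \<tau> = sets borel"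
    and Yf: "Yf \<in> borel_measurable borel" "\<And>x. 0 \<le> Yf x"
    and f_def: "f = mixture_fn Yf K \<tau>"
    and f: "f \<in> borel_measurable borel" "\<And>v. f v < \<infinity>"
    and n: "1 \<le> n"
    and N: "poisson_random_measure \<Omega> N (kernel_measure borel \<rho> \<eta>)"
    and P_def: "P = random_measure_law \<Omega> N h"
    and \<rho>'_def: "\<rho>' = tilted f h \<rho>"
    and N': "poisson_random_measure \<Omega>' N' (kernel_measure borel \<rho>' \<eta>)"
    and P'_def: "P' = random_measure_law \<Omega>' N' h"
    and kappa_finite: "\<And>m y. 1 \<le> m \<Longrightarrow> kappa h m \<rho>' y < \<infinity>"
    and J_def: "J = joint_measure n K X f P"
    and J_mass: "0 < emeasure J (space J)" "emeasure J (space J) < \<infinity>"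
  shows "normalize_measure J = posterior_law n K X h \<rho>' \<eta> P' \<and>
    (\<Sum>p | partition_on {1..n} p. partition_prob n K X h \<rho>' \<eta> p) = 1 \<and>
    (\<forall>p. partition_on {1..n} p \<longrightarrow>
       emeasure (normalize_measure J) {(y, \<mu>). (y, \<mu>) \<in> space J \<and> ties n y = p} =
         partition_prob n K X h \<rho>' \<eta> p) \<and>
    (\<forall>p C. partition_on {1..n} p \<and> 0 < partition_prob n K X h \<rho>' \<eta> p \<and> C \<in> p \<longrightarrow>
       prob_space (block_law K X h \<rho>' \<eta> C)) \<and>
    (AE (y, \<mu>) in normalize_measure J. prob_space (conditional_law h \<rho>' P' n y))"
proof -
  have kappa1: "kappa h 1 (tilted f h \<rho>) y < \<infinity>" for y
    using kappa_finite[of 1 y] by (simp add: \<rho>'_def)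
  have \<rho>s: "s_finite_kernel borel borel \<rho>" and \<rho>'s: "s_finite_kernel borel borel \<rho>'"
    unfolding \<rho>'_def using s_finite_kernel_of_tilted[OF \<rho>(1) h f kappa1] by auto
  have s\<rho>: "sets (\<rho> y) = sets borel" for y using s_finite_kernel_sets[OF \<rho>s] by simp
  \<comment> \<open>The tilting density is at most 1, so the condition on bounded sets is inherited
    from \<rho>.\<close>
  have integrability': "(\<integral>\<^sup>+y\<in>B. (\<integral>\<^sup>+s. ennreal (min (h s) 1) \<partial>\<rho>' y) \<partial>\<eta>) < \<infinity>"
    if B: "B \<in> sets borel" "bounded B" for B
  proof (rule le_less_trans[OF _ integrability[OF B]])
    have "(\<integral>\<^sup>+s. ennreal (min (h s) 1) \<partial>\<rho>' y) \<le> (\<integral>\<^sup>+s. ennreal (min (h s) 1) \<partial>\<rho> y)" for y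
    proof -
      have m: "(\<lambda>s. ennreal (min (h s) 1)) \<in> borel_measurable borel" using h(1) by measurable
      have "(\<integral>\<^sup>+s. ennreal (min (h s) 1) \<partial>\<rho>' y) = (\<integral>\<^sup>+s. exp_neg (f y * ennreal (h s)) * ennreal (min (h s) 1) \<partial>\<rho> y)"
        unfolding \<rho>'_def by (rule nn_integral_tilted[where h=h and \<rho>=\<rho> and f=f, OF h(1) s\<rho> f(2) h(2) m])
      also have "\<dots> \<le> (\<integral>\<^sup>+s. 1 * ennreal (min (h s) 1) \<partial>\<rho> y)"
        by (intro nn_integral_mono mult_right_mono) auto
      finally show ?thesis by simp
    qed
    then show "(\<integral>\<^sup>+y\<in>B. (\<integral>\<^sup>+s. ennreal (min (h s) 1) \<partial>\<rho>' y) \<partial>\<eta>) \<le>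
        (\<integral>\<^sup>+y\<in>B. (\<integral>\<^sup>+s. ennreal (min (h s) 1) \<partial>\<rho> y) \<partial>\<eta>)"
      by (intro nn_integral_mono mult_right_mono) auto
  qed
  have law_P: "has_laplace_exponent P (laplace_exponent h \<rho> \<eta>)"
    unfolding P_def by (rule random_measure_law_laplace[OF \<eta>(1) \<rho>s h integrability N])
  have law_P': "has_laplace_exponent P' (laplace_exponent h \<rho>' \<eta>)"
    unfolding P'_def by (rule random_measure_law_laplace[OF \<eta>(1) \<rho>'s h integrability' N'])
  have add: "laplace_exponent h \<rho> \<eta> (\<lambda>y. f y + g y) = laplace_exponent h \<rho> \<eta> f + laplace_exponent h \<rho>' \<eta> g"
    if "g \<in> borel_measurable borel" for g
    unfolding \<rho>'_def by (rule laplace_exponent_tilted[OF \<eta>(1) \<rho>s h f that])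
  \<comment> \<open>The locale receives the tilted kernel and law; the untilted \<open>P\<close>
    enters through \<open>law_P\<close> and \<open>add\<close> in the next fact.\<close>
  interpret mixture_model h \<rho>' \<eta> P' K X n
    by (intro mixture_model.intro crm.intro mixture_model_axioms.intro \<eta> \<rho>'s h kappa_finite law_P' K)
  note main = normalized_joint_eq_posterior[OF law_P add f(1) J_def J_mass]
  have "space J = space posterior"
    using main(1) by (metis space_normalize_measure)
  then have "emeasure (normalize_measure J) {(y, \<mu>). (y, \<mu>) \<in> space J \<and> ties n y = p} =
      partition_prob n K X h \<rho>' \<eta> p" if "partition_on {1..n} p" for p
    using posterior_partition[OF main(3) that] by (simp only: main(1) pp_def)
  moreover have "prob_space (block_law K X h \<rho>' \<eta> C)"
    if "partition_on {1..n} p" "0 < partition_prob n K X h \<rho>' \<eta> p" "C \<in> p" for p C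
    using prob_space_block[of C] main(3)[of p C] that by (simp only: pp_def block_def)
  moreover have "AE (y, \<mu>) in normalize_measure J. prob_space (conditional_law h \<rho>' P' n y)"
    using posterior_AE_cond[OF main(3)] by (simp only: main(1) cond_def)
  ultimately show ?thesis
    using main(1,2) by (simp only: posterior_def pp_def) blast
qed

end
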